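(* Let $\mathfrak P$ be a Laurent differentially essential and super essential system of sparse generic Laurent differential polynomials, and let $\mathcal S=\mathrm{ags}(\mathfrak P)$. Suppose that the sparse algebraic resultant $\mathrm{Res}(\mathcal S)$ is nontrivial. If $\Xi(\mathrm{Res}(\mathcal S))\ne0$, then $\Xi(\mathrm{Res}(\mathcal S))=\mathfrak E\,\partial\mathrm{Res}(\mathfrak P)$ with $\mathfrak E\in\mathfrak D$.
   Context: Generic system. Let $n\ge2$, $U=\{u_1,\dots,u_{n-1}\}$ differential indeterminates with derivation $\partial$, $u_{j,k}=\partial^ku_j$, $u_{j,0}=u_j$, $0\in\mathbb N$. For each $i=1,\dots,n$ let $M_i,M_{i,1},\dots,M_{i,l_i}$ be distinct Laurent monomials in the $u_{j,k}$, let $A_i=\{\mathfrak a_i,\mathfrak a_{i,1},\dots,\mathfrak a_{i,l_i}\}$ be differential indeterminates over $\mathbb Q$, $A=\bigcup_iA_i$, $\mathfrak D=\mathbb Q\{A\}$, $\mathbb F_i=\mathfrak a_iM_i+\sum_{k=1}^{l_i}\mathfrak a_{i,k}M_{i,k}$ and $\mathfrak P=\{\mathbb F_1,\dots,\mathbb F_n\}\subset\mathfrak D\{U^{\pm}\}=\mathfrak D[u_{j,k}^{\pm1}: 1\le j\le n-1,k\in\mathbb N]$. Each $\mathbb F_i$ involves some $u_{j,k}$, and for each $j$ some $u_{j,k}$ occurs in some $\mathbb F_i$. $[\mathfrak P]$ is the differential ideal generated by $\mathfrak P$ in $\mathfrak D\{U^\pm\}$. Differential resultant. $\mathfrak P$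 is Laurent differentially essential if for each $i$ there is $k_i\in\{1,\dots,l_i\}$ such that the set $\{M_{i,k_i}M_i^{-1}: 1\le i\le n\}$ has differential transcendence degree $n-1$ over $\mathbb Q$. Then $[\mathfrak P]\cap\mathfrak D$ is a prime differential ideal of codimension one equal to $\mathrm{sat}(R)$ for an irreducible $R=\partial\mathrm{Res}(\mathfrak P)\in\mathfrak D$, the sparse differential resultant; $\mathrm{sat}(R)$ is the set of differential polynomials in $\mathfrak D$ with zero differential remainder w.r.t. $R$ under any elimination ranking. Orders. $\mathfrak S_j(f)$ is the set of $k$ such that $u_{j,k}$ occurs in $f$; $o_{i,j}=\max\mathfrak S_j(\mathbb F_i)$ ($-\infty$ if empty). $J_i=\max_\mu\sum_{h\ne i}o_{h,\mu(h)}$ over bijections $\mu:\{1,\dots,n\}\setminus\{i\}\to\{1,\dots,n-1\}$. $\mathfrak P$ is super essential if $J_i\ge0$ for all $i$. $\gamma_j=\min\bigcup_i\mathfrak S_j(\mathbb F_i)$, $\gamma=\sum_j\gamma_j$, $M'_j=\max_i\{o_{i,j}+J_i\}-\gamma$. Put $\mathrm{ps}(\mathfrak P)=\{\partial^k\mathbb F_i: 1\le i\le n,\ 0\le k\le J_i-\gamma\}$, $L=\sum_i(J_i-\gamma+1)=|\mathrm{ps}(\mathfrak P)|$, $\mathcal V(\mathfrak P)=\{u_{j,k}:\gamma_j\le k\le M'_j\}$, of cardinality $L-1$. Algebraic generic system. Fix bijections $\lambda:\mathrm{ps}(\mathfrak P)\to\{1,\dots,L\}$, $\rho=\lambda^{-1}$,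 and $\upsilon:\mathcal Y=\{y_1,\dots,y_{L-1}\}\to\mathcal V(\mathfrak P)$ ($y_h$ algebraic indeterminates), extended to Laurent monomials. $\mathcal A(f)\subset\mathbb Z^{L-1}$ is the set of $\alpha$ such that $\upsilon(y^\alpha)$ has nonzero coefficient in $f$. With algebraic indeterminates $c^h_\alpha$ over $\mathbb Q$, put $P_h=\sum_{\alpha\in\mathcal A(\rho(h))}c^h_\alpha y^\alpha$, $\mathcal S=\mathrm{ags}(\mathfrak P)=\{P_1,\dots,P_L\}$, $\mathcal C_h=\{c_\alpha^h\}_\alpha$, $\mathcal C=\bigcup_h\mathcal C_h$. The specialization $\Xi:\mathbb Q[\mathcal C][\mathcal Y^\pm]\to\mathfrak D\{U^\pm\}$ is the ring homomorphism sending $c^h_\alpha$ to the coefficient of $\upsilon(y^\alpha)$ in $\rho(h)$ and $y_h$ to $\upsilon(y_h)$; so $\Xi(P_h)=\rho(h)$. It is assumed that $M_i$ is such that, for $\rho(h)=\partial^k\mathbb F_i\in\mathrm{ps}(\mathfrak P)$, one of the elements of $\mathcal C_h$ (the coefficient of the monomial corresponding to $M_i$) is specialized by $\Xi$ to $\partial^k\mathfrak a_i$. Sparse algebraic resultant. Let $Z_0$ be the set of points of $\prod_{h=1}^L\mathbf P^{|\mathcal C_h|-1}$ over $\mathbb C$, given by coefficient vectors of $P_1,\dots,P_L$, for which the specialized system $P_1=\dots=P_L=0$ has a common solution in $(\mathbb C\setminus\{0\})^{L-1}$, and let $Z$ be its Zariski closure, an irreducible variety. If $Z$ has codimension one, $\mathrm{Res}(\mathcal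 S)\in\mathbb Z[\mathcal C]$ is the irreducible polynomial defining $Z$; otherwise $\mathrm{Res}(\mathcal S)=1$. It is nontrivial if $Z$ has codimension one. *)

theory Defs
  imports
    Complex_Main
    "HOL-Library.Poly_Mapping"
    "HOL-Library.Extended_Real"
    "HOL-Library.FuncSet"
begin

alias lookup = Poly_Mapping.lookup
alias single = Poly_Mapping.single
alias keys = Poly_Mapping.keys

section \<open>Polynomials and Laurent polynomials\<close>

text \<open>
  A monomial is its exponent vector, written additively, so the product of two monomials is the
  sum of the mappings and the ring structure is the one of \<^theory>\<open>HOL-Library.Poly_Mapping\<close>.
\<close>

type_synonym ('v, 'a) mpol = "('v \<Rightarrow>\<^sub>0 nat) \<Rightarrow>\<^sub>0 'a"
type_synonym ('v, 'a) lpol = "('v \<Rightarrow>\<^sub>0 int) \<Rightarrow>\<^sub>0 'a"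

definition const :: "'a \<Rightarrow> 'm::zero \<Rightarrow>\<^sub>0 'a::zero" where
  "const c = single 0 c"

definition pvar :: "'v \<Rightarrow> ('v, 'a::zero_neq_one) mpol" where
  "pvar v = single (single v 1) 1"

definition occurring :: "(('v \<Rightarrow>\<^sub>0 'e::zero) \<Rightarrow>\<^sub>0 'a::zero) \<Rightarrow> 'v set" where
  "occurring p = (\<Union>m\<in>keys p. keys m)"

definition peval :: "('a::zero \<Rightarrow> 'b::comm_semiring_1) \<Rightarrow> ('v \<Rightarrow> 'b) \<Rightarrow> ('v, 'a) mpol \<Rightarrow> 'b" where
  "peval \<phi> x p = (\<Sum>m\<in>keys p. \<phi> (lookup p m) * (\<Prod>v\<in>keys m. x v ^ lookup m v))"

definition leval :: "('a::zero \<Rightarrow> 'b::field) \<Rightarrow> ('v \<Rightarrow> 'b) \<Rightarrow> ('v, 'a) lpol \<Rightarrow> 'b" where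
  "leval \<phi> x f = (\<Sum>m\<in>keys f. \<phi> (lookup f m) * (\<Prod>v\<in>keys m. x v powi lookup m v))"

text \<open>Irreducibility in a subring \<open>S\<close> of the ambient type.\<close>

definition irreducible_in :: "'a::comm_ring_1 set \<Rightarrow> 'a \<Rightarrow> bool" where
  "irreducible_in S p \<longleftrightarrow> p \<in> S \<and> p \<noteq> 0 \<and> \<not> (\<exists>q\<in>S. p * q = 1) \<and>
     (\<forall>a\<in>S. \<forall>b\<in>S. p = a * b \<longrightarrow> (\<exists>q\<in>S. a * q = 1) \<or> (\<exists>q\<in>S. b * q = 1))"

section \<open>The differential rings\<close>

text \<open>
  The triple \<open>(i, k, d)\<close> stands for the \<open>d\<close>-th derivative of \<open>\<aa>\<^sub>i\<^sub>,\<^sub>k\<close>, where \<open>\<aa>\<^sub>i\<^sub>,\<^sub>0\<close> is \<open>\<aa>\<^sub>i\<close>; the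
  pair \<open>(j, k)\<close> stands for \<open>u\<^sub>j\<^sub>,\<^sub>k\<close>.  The rings \<open>\<DD>\<close> and \<open>\<DD>{U\<^sup>\<plusminus>}\<close> are the subrings \<open>D_ring\<close>
  and \<open>DU_ring\<close> below, cut out by restricting the indices that may occur.
\<close>

type_synonym avar = "nat \<times> nat \<times> nat"
type_synonym uvar = "nat \<times> nat"
type_synonym dpol = "(avar, rat) mpol"
type_synonym dlpol = "(uvar, dpol) lpol"

fun a_next :: "avar \<Rightarrow> avar" where
  "a_next (i, k, d) = (i, k, Suc d)"

fun u_next :: "uvar \<Rightarrow> uvar" where
  "u_next (j, k) = (j, Suc k)"

text \<open>
  By the Leibniz rule, the derivative of a monomial \<open>m\<close> is the sum, over the indeterminates \<open>v\<close> in
  it, of \<open>m v\<close> times the monomial in which one factor \<open>v\<close> is replaced by the derivative of \<open>v\<close>.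
\<close>

definition dderiv :: "dpol \<Rightarrow> dpol" where
  "dderiv p = (\<Sum>m\<in>keys p. \<Sum>v\<in>keys m.
     single (m - single v 1 + single (a_next v) 1) (of_nat (lookup m v) * lookup p m))"

definition lderiv :: "dlpol \<Rightarrow> dlpol" where
  "lderiv f = (\<Sum>m\<in>keys f. single m (dderiv (lookup f m)) +
     (\<Sum>v\<in>keys m.
        single (m - single v 1 + single (u_next v) 1) (of_int (lookup m v) * lookup f m)))"

section \<open>Differential transcendence degree over the rationals\<close>

definition diff_independent :: "dlpol set \<Rightarrow> bool" where
  "diff_independent B \<longleftrightarrow>
     (\<forall>p :: (dlpol \<times> nat, rat) mpol. occurring p \<subseteq> B \<times> UNIV \<and> p \<noteq> 0 \<longrightarrow>
        peval (\<lambda>q. const (const q)) (\<lambda>(s, k). (lderiv ^^ k) s) p \<noteq> 0)"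

text \<open>\<open>S\<close> contains a differential transcendence basis of \<open>\<rat>\<langle>S\<rangle>\<close> with \<open>r\<close> elements.\<close>

definition has_diff_trdeg :: "dlpol set \<Rightarrow> nat \<Rightarrow> bool" where
  "has_diff_trdeg S r \<longleftrightarrow>
     (\<exists>B\<subseteq>S. finite B \<and> card B = r \<and> diff_independent B \<and>
        (\<forall>s\<in>S - B. \<not> diff_independent (insert s B)))"

section \<open>Ritt reduction\<close>

definition degree_in :: "'v \<Rightarrow> ('v, 'a::zero) mpol \<Rightarrow> nat" where
  "degree_in v p = Max (insert 0 ((\<lambda>m. lookup m v) ` keys p))"

definition coeff_in :: "'v \<Rightarrow> nat \<Rightarrow> ('v, 'a::comm_monoid_add) mpol \<Rightarrow> ('v, 'a) mpol" where
  "coeff_in v d p = (\<Sum>m\<in>{m \<in> keys p. lookup m v = d}. single (m - single v d) (lookup p m))"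

definition leader :: "avar rel \<Rightarrow> dpol \<Rightarrow> avar" where
  "leader r p = (THE v. v \<in> occurring p \<and> (\<forall>w\<in>occurring p - {v}. (w, v) \<in> r))"

text \<open>
  One pseudo-division step of \<open>f\<close> by \<open>\<partial>\<^sup>k R\<close>, for the largest \<open>k\<close> for which such a step is
  possible.  The leading coefficient of \<open>\<partial>\<^sup>k R\<close> in its leader is the separant of \<open>R\<close> if \<open>k > 0\<close>
  and the initial of \<open>R\<close> if \<open>k = 0\<close>.  The normal forms of this relation are the polynomials reduced with
  respect to \<open>R\<close>.
\<close>

definition divisible_at :: "avar rel \<Rightarrow> dpol \<Rightarrow> dpol \<Rightarrow> nat \<Rightarrow> bool" where
  "divisible_at r R f k \<longleftrightarrow>
     (let v = (a_next ^^ k) (leader r R)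
      in degree_in v ((dderiv ^^ k) R) \<le> degree_in v f)"

definition ritt_step :: "avar rel \<Rightarrow> dpol \<Rightarrow> dpol \<Rightarrow> dpol \<Rightarrow> bool" where
  "ritt_step r R f g \<longleftrightarrow>
     (\<exists>k. divisible_at r R f k \<and> (\<forall>k'>k. \<not> divisible_at r R f k') \<and>
        (let v = (a_next ^^ k) (leader r R); Q = (dderiv ^^ k) R;
             e = degree_in v Q; d = degree_in v f
         in g = coeff_in v e Q * f - coeff_in v d f * pvar v ^ (d - e) * Q))"

definition diff_remainder :: "avar rel \<Rightarrow> dpol \<Rightarrow> dpol \<Rightarrow> dpol \<Rightarrow> bool" where
  "diff_remainder r R f g \<longleftrightarrow> (ritt_step r R)\<^sup>*\<^sup>* f g \<and> (\<nexists>h. ritt_step r R g h)"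

section \<open>Sparse generic systems\<close>

text \<open>
  \<open>M i 0\<close> is the monomial \<open>M\<^sub>i\<close>, and \<open>M i k\<close> with \<open>1 \<le> k \<le> l i\<close> is \<open>M\<^sub>i\<^sub>,\<^sub>k\<close>.
\<close>

context
  fixes n :: nat and l :: "nat \<Rightarrow> nat" and M :: "nat \<Rightarrow> nat \<Rightarrow> (uvar \<Rightarrow>\<^sub>0 int)"
begin

definition A_derivs :: "avar set" where
  "A_derivs = {(i, k, d). i \<in> {1..n} \<and> k \<le> l i}"

definition D_ring :: "dpol set" where
  "D_ring = {p. occurring p \<subseteq> A_derivs}"

definition DU_ring :: "dlpol set" where
  "DU_ring = {f. occurring f \<subseteq> {1..n-1} \<times> UNIV \<and> (\<forall>m\<in>keys f. lookup f m \<in> D_ring)}"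

definition gen_F :: "nat \<Rightarrow> dlpol" where
  "gen_F i = (\<Sum>k\<le>l i. single (M i k) (pvar (i, k, 0)))"

definition generic_system :: bool where
  "generic_system \<longleftrightarrow> 2 \<le> n \<and>
     (\<forall>i\<in>{1..n}. inj_on (M i) {..l i} \<and> (\<forall>k\<le>l i. keys (M i k) \<subseteq> {1..n-1} \<times> UNIV)) \<and>
     (\<forall>i\<in>{1..n}. occurring (gen_F i) \<noteq> {}) \<and>
     (\<forall>j\<in>{1..n-1}. \<exists>i\<in>{1..n}. \<exists>k. (j, k) \<in> occurring (gen_F i))"

subsection \<open>Differential ideals, saturation and the sparse differential resultant\<close>

definition diff_ideal :: "dlpol set \<Rightarrow> bool" where
  "diff_ideal I \<longleftrightarrow> I \<subseteq> DU_ring \<and> 0 \<in> I \<and> (\<forall>f\<in>I. \<forall>g\<in>I. f + g \<in> I) \<and>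
     (\<forall>f\<in>I. \<forall>g\<in>DU_ring. g * f \<in> I) \<and> (\<forall>f\<in>I. lderiv f \<in> I)"

definition diff_ideal_P :: "dlpol set" where
  "diff_ideal_P = \<Inter>{I. diff_ideal I \<and> gen_F ` {1..n} \<subseteq> I}"

definition elimination_ideal :: "dpol set" where
  "elimination_ideal = {c \<in> D_ring. const c \<in> diff_ideal_P}"

text \<open>\<open>(v, w) \<in> r\<close> means that \<open>v\<close> is ranked below \<open>w\<close>.\<close>

definition ranking :: "avar rel \<Rightarrow> bool" where
  "ranking r \<longleftrightarrow> strict_linear_order_on A_derivs r \<and>
     (\<forall>v\<in>A_derivs. (v, a_next v) \<in> r) \<and>
     (\<forall>v\<in>A_derivs. \<forall>w\<in>A_derivs. (v, w) \<in> r \<longrightarrow> (a_next v, a_next w) \<in> r)"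

definition elimination_ranking :: "avar rel \<Rightarrow> bool" where
  "elimination_ranking r \<longleftrightarrow> ranking r \<and>
     (\<forall>i k j s. (i, k, 0) \<in> A_derivs \<and> (j, s, 0) \<in> A_derivs \<and> ((i, k, 0), (j, s, 0)) \<in> r \<longrightarrow>
        (\<forall>d e. ((i, k, d), (j, s, e)) \<in> r))"

definition sat :: "dpol \<Rightarrow> dpol set" where
  "sat R = {f \<in> D_ring. \<forall>r. elimination_ranking r \<longrightarrow> diff_remainder r R f 0}"

text \<open>
  That the elimination ideal is prime of codimension one follows from its being \<open>sat R\<close>.  This
  determines \<open>R\<close> up to a nonzero rational factor; it exists for every Laurent differentially
  essential system.
\<close>

definition is_sparse_diff_resultant :: "dpol \<Rightarrow> bool" where
  "is_sparse_diff_resultant R \<longleftrightarrow> irreducible_in D_ring R \<and> elimination_ideal = sat R"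

definition laurent_diff_essential :: bool where
  "laurent_diff_essential \<longleftrightarrow>
     (\<exists>\<kappa>. (\<forall>i\<in>{1..n}. \<kappa> i \<in> {1..l i}) \<and>
        has_diff_trdeg ((\<lambda>i. single (M i (\<kappa> i) - M i 0) 1) ` {1..n}) (n - 1))"

subsection \<open>Orders\<close>

definition order_set :: "nat \<Rightarrow> dlpol \<Rightarrow> nat set" where
  "order_set j f = {k. (j, k) \<in> occurring f}"

definition ord :: "nat \<Rightarrow> nat \<Rightarrow> ereal" where
  "ord i j = (if order_set j (gen_F i) = {} then -\<infinity>
              else ereal (real (Max (order_set j (gen_F i)))))"

definition jac :: "nat \<Rightarrow> ereal" where
  "jac i = Max ((\<lambda>\<mu>. \<Sum>h\<in>{1..n} - {i}. ord h (\<mu> h)) `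
     {\<mu> \<in> ({1..n} - {i}) \<rightarrow>\<^sub>E {1..n-1}. bij_betw \<mu> ({1..n} - {i}) {1..n-1}})"

definition super_essential :: bool where
  "super_essential \<longleftrightarrow> (\<forall>i\<in>{1..n}. 0 \<le> jac i)"

definition gam :: "nat \<Rightarrow> nat" where
  "gam j = Min (\<Union>i\<in>{1..n}. order_set j (gen_F i))"

definition gamma_sum :: nat where
  "gamma_sum = (\<Sum>j\<in>{1..n-1}. gam j)"

definition top_order :: "nat \<Rightarrow> ereal" where
  "top_order j = Max ((\<lambda>i. ord i j + jac i) ` {1..n}) - ereal (real gamma_sum)"

definition ps :: "dlpol set" where
  "ps = {(lderiv ^^ k) (gen_F i) | i k.
           i \<in> {1..n} \<and> ereal (real k) \<le> jac i - ereal (real gamma_sum)}"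

definition num_ps :: nat where
  "num_ps = card ps"

definition ps_vars :: "uvar set" where
  "ps_vars = {(j, k). j \<in> {1..n-1} \<and> gam j \<le> k \<and> ereal (real k) \<le> top_order j}"

end

section \<open>Sparse algebraic resultants\<close>

text \<open>
  The pair \<open>(h, \<alpha>)\<close> stands for the coefficient \<open>c\<^sup>h\<^sub>\<alpha>\<close>, and the number \<open>j\<close> for \<open>y\<^sub>j\<close>.
\<close>

type_synonym ymon = "nat \<Rightarrow>\<^sub>0 int"
type_synonym cvar = "nat \<times> ymon"

context
  fixes L :: nat and As :: "nat \<Rightarrow> ymon set"
begin

definition generic_P :: "nat \<Rightarrow> (nat, (cvar, rat) mpol) lpol" where
  "generic_P h = (\<Sum>\<alpha>\<in>As h. single \<alpha> (pvar (h, \<alpha>)))"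

definition coeff_vars :: "cvar set" where
  "coeff_vars = {(h, \<alpha>). h \<in> {1..L} \<and> \<alpha> \<in> As h}"

text \<open>
  The points of the product of the projective spaces \<open>P\<^bsup>|C\<^sub>h|-1\<^esup>\<close> over the complex numbers, as
  classes of multihomogeneous coordinate vectors (extended by 0 outside the coefficients).
\<close>

definition coord_vectors :: "(cvar \<Rightarrow> complex) set" where
  "coord_vectors =
     {z. (\<forall>c. c \<notin> coeff_vars \<longrightarrow> z c = 0) \<and> (\<forall>h\<in>{1..L}. \<exists>\<alpha>\<in>As h. z (h, \<alpha>) \<noteq> 0)}"

definition multiproj :: "(cvar \<Rightarrow> complex) set set" where
  "multiproj = coord_vectors //
     {(z, w). z \<in> coord_vectors \<and> w \<in> coord_vectors \<and>
        (\<exists>t. \<forall>h\<in>{1..L}. t h \<noteq> 0 \<and> (\<forall>\<alpha>\<in>As h. w (h, \<alpha>) = t h * z (h, \<alpha>)))}"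

definition multihomogeneous :: "(cvar, 'a::zero) mpol \<Rightarrow> bool" where
  "multihomogeneous F \<longleftrightarrow> occurring F \<subseteq> coeff_vars \<and>
     (\<exists>d. \<forall>m\<in>keys F. \<forall>h\<in>{1..L}. (\<Sum>\<alpha>\<in>As h. lookup m (h, \<alpha>)) = d h)"

definition zero_locus :: "(cvar, complex) mpol set \<Rightarrow> (cvar \<Rightarrow> complex) set set" where
  "zero_locus T = {X \<in> multiproj. \<forall>F\<in>T. \<forall>z\<in>X. peval id z F = 0}"

definition zariski_closed :: "(cvar \<Rightarrow> complex) set set \<Rightarrow> bool" where
  "zariski_closed W \<longleftrightarrow> (\<exists>T. (\<forall>F\<in>T. multihomogeneous F) \<and> W = zero_locus T)"

definition zariski_closure :: "(cvar \<Rightarrow> complex) set set \<Rightarrow> (cvar \<Rightarrow> complex) set set" where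
  "zariski_closure Y = \<Inter>{W. zariski_closed W \<and> Y \<subseteq> W}"

definition irreducible_closed :: "(cvar \<Rightarrow> complex) set set \<Rightarrow> bool" where
  "irreducible_closed Y \<longleftrightarrow> zariski_closed Y \<and> Y \<noteq> {} \<and>
     (\<forall>V W. zariski_closed V \<and> zariski_closed W \<and> Y = V \<union> W \<longrightarrow> Y = V \<or> Y = W)"

text \<open>Codimension of an irreducible closed set, by chains of irreducible closed sets above it.\<close>

definition codimension :: "(cvar \<Rightarrow> complex) set set \<Rightarrow> enat" where
  "codimension Y =
     (SUP m\<in>{m. \<exists>C. C 0 = Y \<and> (\<forall>i\<le>m. irreducible_closed (C i)) \<and> (\<forall>i<m. C i \<subset> C (Suc i))}.
        enat m)"

definition Z0 :: "(cvar \<Rightarrow> complex) set set" where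
  "Z0 = {X \<in> multiproj. \<exists>z\<in>X. \<exists>\<eta>. (\<forall>j\<in>{1..L-1}. \<eta> j \<noteq> 0) \<and>
           (\<forall>h\<in>{1..L}. leval (peval of_rat z) \<eta> (generic_P h) = 0)}"

definition Zres :: "(cvar \<Rightarrow> complex) set set" where
  "Zres = zariski_closure Z0"

definition nontrivial_resultant :: bool where
  "nontrivial_resultant \<longleftrightarrow> codimension Zres = 1"

text \<open>In the nontrivial case, this determines the resultant up to sign.\<close>

definition is_sparse_resultant :: "(cvar, int) mpol \<Rightarrow> bool" where
  "is_sparse_resultant Res \<longleftrightarrow>
     (if nontrivial_resultant
      then irreducible_in {p. occurring p \<subseteq> coeff_vars} Res \<and> multihomogeneous Res \<and>
           zero_locus {Poly_Mapping.map of_int Res} = Zres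
      else Res = 1)"

end

section \<open>The algebraic generic system\<close>

text \<open>The extension of \<open>\<upsilon>\<close> to Laurent monomials.\<close>

definition umon :: "(nat \<Rightarrow> uvar) \<Rightarrow> ymon \<Rightarrow> (uvar \<Rightarrow>\<^sub>0 int)" where
  "umon \<upsilon> \<alpha> = (\<Sum>h\<in>keys \<alpha>. single (\<upsilon> h) (lookup \<alpha> h))"

context
  fixes n :: nat and l :: "nat \<Rightarrow> nat" and M :: "nat \<Rightarrow> nat \<Rightarrow> (uvar \<Rightarrow>\<^sub>0 int)"
    and lam :: "dlpol \<Rightarrow> nat" and \<upsilon> :: "nat \<Rightarrow> uvar"
begin

definition rho :: "nat \<Rightarrow> dlpol" where
  "rho = inv_into (ps n l M) lam"

definition ags_support :: "nat \<Rightarrow> ymon set" where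
  "ags_support h =
     {\<alpha>. keys \<alpha> \<subseteq> {1..num_ps n l M - 1} \<and> lookup (rho h) (umon \<upsilon> \<alpha>) \<noteq> 0}"

definition Xi :: "(nat, (cvar, rat) mpol) lpol \<Rightarrow> dlpol" where
  "Xi f = (\<Sum>\<alpha>\<in>keys f. single (umon \<upsilon> \<alpha>)
     (peval const (\<lambda>(h, \<beta>). lookup (rho h) (umon \<upsilon> \<beta>)) (lookup f \<alpha>)))"

text \<open>
  The last clause is the standing assumption on the choice of \<open>M\<^sub>i\<close>: its coefficient in \<open>\<partial>\<^sup>k F\<^sub>i\<close> is
  \<open>\<partial>\<^sup>k \<aa>\<^sub>i\<close>, without contributions from the derivatives of the other terms.
\<close>

definition is_ags :: bool where
  "is_ags \<longleftrightarrow> bij_betw lam (ps n l M) {1..num_ps n l M} \<and>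
     bij_betw \<upsilon> {1..num_ps n l M - 1} (ps_vars n l M) \<and>
     (\<forall>i\<in>{1..n}. \<forall>k h. ereal (real k) \<le> jac n l M i - ereal (real (gamma_sum n l M)) \<and>
        h \<in> {1..num_ps n l M} \<and> rho h = (lderiv ^^ k) (gen_F l M i) \<longrightarrow>
        (\<exists>\<alpha>\<in>ags_support h. umon \<upsilon> \<alpha> = M i 0 \<and>
           Xi (const (pvar (h, \<alpha>))) = const ((dderiv ^^ k) (pvar (i, 0, 0)))))"

end

end

theory Submission
  imports Defs "HOL-Computational_Algebra.Fundamental_Theorem_Algebra" "HOL-Library.Product_Lexorder"
begin

text \<open>
  Let \<open>f\<close> be the specialized resultant.  An element of the elimination ideal in which, for some \<open>i\<close>
  occurring in \<open>R\<close>, no \<open>\<aa>\<^sub>i\<^sub>,\<^sub>k\<close> has a higher derivative than in \<open>R\<close>, is a multiple of \<open>R\<close>: reduce it by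
  \<open>R\<close> with respect to a ranking whose top indeterminate belongs to \<open>i\<close>; only \<open>R\<close> itself is used, and \<open>R\<close>
  is prime.  If the system contains no higher derivatives of \<open>\<bbbF>\<^sub>i\<close> this applies to \<open>f\<close>.  Otherwise all
  equations on which \<open>R\<close> depends belong to the system, and it suffices that \<open>R\<close> divides the partial
  specialization of the resultant in which only their coefficients are specialized.

  Suppose that it does not, and take a relation \<open>G\<close> of the partially specialized system that is not a
  multiple of \<open>R\<close> and minimal.  Let \<open>K\<close> be the set of the generic equations that it involves.  On
  solutions, the ratio of two monomials of an equation in \<open>K\<close> is the ratio of the partial derivatives of
  \<open>G\<close>.  Differentiating along the torus, together with the two relations \<open>R\<close> and \<open>G\<close>, shows that the
  exponent differences of the equations in \<open>K\<close> span a space of dimension at most two less than the number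
  of the equations of \<open>R\<close> and \<open>K\<close>.  Since \<open>K\<close> contains a derivative of each \<open>\<bbbF>\<^sub>i\<close> occurring in \<open>R\<close>, higher
  than those used by \<open>R\<close>, and supports of successive derivatives are nested, the supports of these
  equations of \<open>R\<close> are included.  So even after one more equation has been dropped there are more
  equations than independent exponents, and counting monomials gives a nonzero polynomial in the
  remaining coefficients that vanishes on all solvable systems.  This contradicts codimension one, as
  some indeterminate of the resultant does not occur in that polynomial.
\<close>

section \<open>Evaluation of polynomials and Laurent polynomials\<close>

text \<open>Membership in \<open>sat R\<close> only says that some product of initials and separants
  times f lies in the differential ideal of R. Once proper derivatives of R enter the reduction,
  divisibility by R itself is lost, so a bound on the orders in one block is essential, and the
  specialized resultant need not satisfy it. Hence the detour through generic coefficients.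
  Minimality of G ensures that its partial derivatives are not relations themselves, so at some
  solution all the ratios are defined at once. The loss of two dimensions comes from a
  parametrization: u and all but one coefficient of each equation are free, so each equation has one
  moving coordinate, and R and G give two independent linear relations between the velocities. K
  meets every block of R, because otherwise specializing the equations in K would give a low-order
  element of the elimination ideal that R does not divide. A triangular substitution takes the place
  of the Nullstellensatz, and prescribing all coefficients but one takes the place of dimension
  theory.\<close>

definition ring_hom :: "('a::comm_ring_1 \<Rightarrow> 'b::comm_ring_1) \<Rightarrow> bool" where
  "ring_hom \<phi> \<longleftrightarrow> \<phi> 0 = 0 \<and> \<phi> 1 = 1 \<and> (\<forall>a b. \<phi> (a + b) = \<phi> a + \<phi> b) \<and> (\<forall>a b. \<phi> (a * b) = \<phi> a * \<phi> b)"

lemma ring_homD: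
  assumes "ring_hom \<phi>"
  shows "\<phi> 0 = 0" "\<phi> 1 = 1" "\<phi> (a + b) = \<phi> a + \<phi> b" "\<phi> (a * b) = \<phi> a * \<phi> b"
  using assms by (auto simp: ring_hom_def)

lemma ring_hom_uminus: "ring_hom \<phi> \<Longrightarrow> \<phi> (- a) = - \<phi> a"
  by (metis add.inverse_unique add.right_inverse ring_homD(1) ring_homD(3))

lemma ring_hom_diff: "ring_hom \<phi> \<Longrightarrow> \<phi> (a - b) = \<phi> a - \<phi> b"
  using ring_homD(3)[of \<phi> a "- b"] by (simp add: ring_hom_uminus)

lemma ring_hom_sum: "ring_hom \<phi> \<Longrightarrow> \<phi> (\<Sum>a\<in>A. f a) = (\<Sum>a\<in>A. \<phi> (f a))"
  by (induction A rule: infinite_finite_induct) (auto simp: ring_homD)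

lemma ring_hom_power: "ring_hom \<phi> \<Longrightarrow> \<phi> (a ^ k) = \<phi> a ^ k"
  by (induction k) (auto simp: ring_homD)

lemma ring_hom_of_nat: "ring_hom \<phi> \<Longrightarrow> \<phi> (of_nat k) = of_nat k"
  by (induction k) (auto simp: ring_homD)

lemma ring_hom_compose: "ring_hom \<phi> \<Longrightarrow> ring_hom \<psi> \<Longrightarrow> ring_hom (\<lambda>a. \<psi> (\<phi> a))"
  by (auto simp: ring_hom_def)

lemma ring_hom_of_rat [simp]: "ring_hom (of_rat :: rat \<Rightarrow> complex)"
  by (auto simp: ring_hom_def of_rat_add of_rat_mult)

lemma ring_hom_of_int [simp]: "ring_hom (of_int :: int \<Rightarrow> 'a::comm_ring_1)"
  by (auto simp: ring_hom_def)

lemma ring_hom_id [simp]: "ring_hom id" "ring_hom (\<lambda>a. a)"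
  by (auto simp: ring_hom_def)

lemma const_add: "const (a + b) = const a + (const b :: 'm::monoid_add \<Rightarrow>\<^sub>0 'a::monoid_add)"
  by (simp add: const_def single_add)

lemma const_mult: "const (a * b) = const a * (const b :: 'm::comm_monoid_add \<Rightarrow>\<^sub>0 'a::comm_semiring_0)"
  by (simp add: const_def mult_single)

lemma const_0 [simp]: "const 0 = 0"
  by (simp add: const_def)

lemma const_1 [simp]: "const 1 = 1"
  by (simp add: const_def)

lemma const_eq_0_iff [simp]: "const c = 0 \<longleftrightarrow> c = 0"
  by (metis const_def lookup_single_eq lookup_zero single_zero)

lemma ring_hom_const [simp]: "ring_hom (const :: 'a::comm_ring_1 \<Rightarrow> 'm::comm_monoid_add \<Rightarrow>\<^sub>0 'a)"
  by (auto simp: ring_hom_def const_add const_mult)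

lemma ring_hom_const_const [simp]:
  "ring_hom (\<lambda>q::'a::comm_ring_1. const (const q :: 'm::comm_monoid_add \<Rightarrow>\<^sub>0 'a) :: 'k::comm_monoid_add \<Rightarrow>\<^sub>0 _)"
  by (rule ring_hom_compose) auto

lemma sum_single_keys: "(\<Sum>m\<in>keys p. single m (lookup p m)) = p"
proof (rule poly_mapping_eqI)
  fix k
  have "lookup (\<Sum>m\<in>keys p. single m (lookup p m)) k = (\<Sum>m\<in>keys p. if m = k then lookup p k else 0)"
    by (auto simp: lookup_sum lookup_single when_def intro!: sum.cong)
  then show "lookup (\<Sum>m\<in>keys p. single m (lookup p m)) k = lookup p k"
    by (simp add: not_in_keys_iff_lookup_eq_zero)
qed

lemma poly_mapping_single_induct [case_names zero single add]:
  assumes "P 0" "\<And>m c. P (single m c)" "\<And>p q. P p \<Longrightarrow> P q \<Longrightarrow> P (p + q)"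
  shows "P (p :: 'k \<Rightarrow>\<^sub>0 'c::comm_monoid_add)"
proof -
  have "P (\<Sum>m\<in>A. single m (lookup p m))" for A
    by (induction A rule: infinite_finite_induct) (auto intro: assms)
  from this[of "keys p"] show ?thesis by (simp add: sum_single_keys)
qed

definition mev :: "('v \<Rightarrow> 'b::comm_semiring_1) \<Rightarrow> ('v \<Rightarrow>\<^sub>0 nat) \<Rightarrow> 'b" where
  "mev x m = (\<Prod>v\<in>keys m. x v ^ lookup m v)"

lemma mev_superset: "finite S \<Longrightarrow> keys m \<subseteq> S \<Longrightarrow> mev x m = (\<Prod>v\<in>S. x v ^ lookup m v)"
  unfolding mev_def by (rule prod.mono_neutral_left) (auto simp: in_keys_iff)

lemma mev_0 [simp]: "mev x 0 = 1"
  by (simp add: mev_def)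

lemma mev_add: "mev x (m + m') = mev x m * mev x m'"
proof -
  let ?S = "keys m \<union> keys m' \<union> keys (m + m')"
  have "mev x (m + m') = (\<Prod>v\<in>?S. x v ^ lookup (m + m') v)"
    by (rule mev_superset) auto
  also have "\<dots> = (\<Prod>v\<in>?S. x v ^ lookup m v) * (\<Prod>v\<in>?S. x v ^ lookup m' v)"
    by (simp add: lookup_add power_add prod.distrib)
  also have "\<dots> = mev x m * mev x m'"
    by (intro arg_cong2[where f = "(*)"] mev_superset[symmetric]) auto
  finally show ?thesis .
qed

lemma mev_single [simp]: "mev x (single v k) = x v ^ k"
  by (simp add: mev_def)

definition lmev :: "('v \<Rightarrow> 'b::field) \<Rightarrow> ('v \<Rightarrow>\<^sub>0 int) \<Rightarrow> 'b" where
  "lmev x m = (\<Prod>v\<in>keys m. x v powi lookup m v)"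

lemma lmev_superset: "finite S \<Longrightarrow> keys m \<subseteq> S \<Longrightarrow> lmev x m = (\<Prod>v\<in>S. x v powi lookup m v)"
  unfolding lmev_def by (rule prod.mono_neutral_left) (auto simp: in_keys_iff)

lemma lmev_0 [simp]: "lmev x 0 = 1"
  by (simp add: lmev_def)

lemma lmev_add:
  assumes "\<And>v. x v \<noteq> 0"
  shows "lmev x (m + m') = lmev x m * lmev x m'"
proof -
  let ?S = "keys m \<union> keys m' \<union> keys (m + m')"
  have "lmev x (m + m') = (\<Prod>v\<in>?S. x v powi lookup (m + m') v)"
    by (rule lmev_superset) auto
  also have "\<dots> = (\<Prod>v\<in>?S. x v powi lookup m v) * (\<Prod>v\<in>?S. x v powi lookup m' v)"
    using assms by (simp add: lookup_add power_int_add prod.distrib)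
  also have "\<dots> = lmev x m * lmev x m'"
    by (intro arg_cong2[where f = "(*)"] lmev_superset[symmetric]) auto
  finally show ?thesis .
qed

lemma lmev_nonzero: "(\<And>v. x v \<noteq> 0) \<Longrightarrow> lmev x m \<noteq> 0"
  by (auto simp: lmev_def prod_zero_iff)

lemma lmev_uminus:
  assumes "\<And>v. x v \<noteq> 0"
  shows "lmev x (- m) = inverse (lmev x m)"
proof -
  have "lmev x (- m) * lmev x m = 1"
    using lmev_add[OF assms, where m = "- m" and m' = m] by simp
  then show ?thesis
    by (metis inverse_unique mult.commute)
qed

lemma lmev_diff:
  assumes "\<And>v. x v \<noteq> 0"
  shows "lmev x (m - m') = lmev x m / lmev x m'"
  using lmev_add[OF assms, where m = m and m' = "- m'"] lmev_uminus[OF assms, where m = m']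
  by (simp add: divide_inverse)

lemma peval_superset:
  assumes "ring_hom \<phi>" "finite S" "keys p \<subseteq> S"
  shows "peval \<phi> x p = (\<Sum>m\<in>S. \<phi> (lookup p m) * mev x m)"
  unfolding peval_def mev_def[symmetric]
  by (rule sum.mono_neutral_left) (use assms in \<open>auto simp: in_keys_iff ring_homD\<close>)

lemma peval_0 [simp]: "peval \<phi> x 0 = 0"
  by (simp add: peval_def)

lemma peval_single:
  assumes "ring_hom \<phi>"
  shows "peval \<phi> x (single m c) = \<phi> c * mev x m"
  using peval_superset[OF assms, of "{m}" "single m c" x] by simp

lemma peval_const [simp]: "ring_hom \<phi> \<Longrightarrow> peval \<phi> x (const c) = \<phi> c"
  by (simp add: const_def peval_single)

lemma peval_1 [simp]: "ring_hom \<phi> \<Longrightarrow> peval \<phi> x 1 = 1"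
  using peval_const[of \<phi> x 1] by (simp add: ring_homD del: peval_const)

lemma peval_pvar [simp]: "ring_hom \<phi> \<Longrightarrow> peval \<phi> x (pvar v) = x v"
  by (simp add: pvar_def peval_single ring_homD)

lemma peval_add:
  assumes "ring_hom \<phi>"
  shows "peval \<phi> x (p + q) = peval \<phi> x p + peval \<phi> x q"
proof -
  let ?S = "keys p \<union> keys q \<union> keys (p + q)"
  have "peval \<phi> x (p + q) = (\<Sum>m\<in>?S. \<phi> (lookup (p + q) m) * mev x m)"
    by (rule peval_superset[OF assms]) auto
  also have "\<dots> = (\<Sum>m\<in>?S. \<phi> (lookup p m) * mev x m) + (\<Sum>m\<in>?S. \<phi> (lookup q m) * mev x m)"
    by (simp add: lookup_add ring_homD[OF assms] distrib_right sum.distrib)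
  also have "\<dots> = peval \<phi> x p + peval \<phi> x q"
    by (intro arg_cong2[where f = "(+)"] peval_superset[OF assms, symmetric]) auto
  finally show ?thesis .
qed

lemma peval_sum: "ring_hom \<phi> \<Longrightarrow> peval \<phi> x (\<Sum>a\<in>A. f a) = (\<Sum>a\<in>A. peval \<phi> x (f a))"
  by (induction A rule: infinite_finite_induct) (auto simp: peval_add)

lemma peval_mult:
  assumes "ring_hom \<phi>"
  shows "peval \<phi> x (p * q) = peval \<phi> x p * peval \<phi> x q"
proof (induction p rule: poly_mapping_single_induct)
  case (single m c)
  show ?case
  proof (induction q rule: poly_mapping_single_induct)
    case (single m' c')
    show ?case by (simp add: assms peval_single mult_single mev_add ring_homD[OF assms] mult_ac)
  qed (simp_all add: assms distrib_left peval_add)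
qed (auto simp: distrib_right peval_add assms)

lemma ring_hom_peval [simp]: "ring_hom \<phi> \<Longrightarrow> ring_hom (peval \<phi> x)"
  unfolding ring_hom_def[of "peval \<phi> x"] by (simp add: peval_add peval_mult)

lemmas peval_diff = ring_hom_diff[OF ring_hom_peval]
lemmas peval_power = ring_hom_power[OF ring_hom_peval]

lemma leval_superset:
  assumes "ring_hom \<phi>" "finite S" "keys p \<subseteq> S"
  shows "leval \<phi> x p = (\<Sum>m\<in>S. \<phi> (lookup p m) * lmev x m)"
  unfolding leval_def lmev_def[symmetric]
  by (rule sum.mono_neutral_left) (use assms in \<open>auto simp: in_keys_iff ring_homD\<close>)

lemma leval_0 [simp]: "leval \<phi> x 0 = 0"
  by (simp add: leval_def)

lemma leval_single:
  assumes "ring_hom \<phi>"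
  shows "leval \<phi> x (single m c) = \<phi> c * lmev x m"
  using leval_superset[OF assms, of "{m}" "single m c" x] by simp

lemma leval_const [simp]: "ring_hom \<phi> \<Longrightarrow> leval \<phi> x (const c) = \<phi> c"
  by (simp add: const_def leval_single)

lemma leval_1 [simp]: "ring_hom \<phi> \<Longrightarrow> leval \<phi> x 1 = 1"
  using leval_const[of \<phi> x 1] by (simp add: ring_homD del: leval_const)

lemma leval_add:
  assumes "ring_hom \<phi>"
  shows "leval \<phi> x (p + q) = leval \<phi> x p + leval \<phi> x q"
proof -
  let ?S = "keys p \<union> keys q \<union> keys (p + q)"
  have "leval \<phi> x (p + q) = (\<Sum>m\<in>?S. \<phi> (lookup (p + q) m) * lmev x m)"
    by (rule leval_superset[OF assms]) auto
  also have "\<dots> = (\<Sum>m\<in>?S. \<phi> (lookup p m) * lmev x m) + (\<Sum>m\<in>?S. \<phi> (lookup q m) * lmev x m)"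
    by (simp add: lookup_add ring_homD[OF assms] distrib_right sum.distrib)
  also have "\<dots> = leval \<phi> x p + leval \<phi> x q"
    by (intro arg_cong2[where f = "(+)"] leval_superset[OF assms, symmetric]) auto
  finally show ?thesis .
qed

lemma leval_sum: "ring_hom \<phi> \<Longrightarrow> leval \<phi> x (\<Sum>a\<in>A. f a) = (\<Sum>a\<in>A. leval \<phi> x (f a))"
  by (induction A rule: infinite_finite_induct) (auto simp: leval_add)

lemma leval_mult:
  assumes "ring_hom \<phi>" and x: "\<And>v. x v \<noteq> 0"
  shows "leval \<phi> x (p * q) = leval \<phi> x p * leval \<phi> x q"
proof (induction p rule: poly_mapping_single_induct)
  case (single m c)
  show ?case
  proof (induction q rule: poly_mapping_single_induct)
    case (single m' c')
    show ?case by (simp add: assms leval_single mult_single lmev_add ring_homD[OF assms(1)] mult_ac)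
  qed (simp_all add: assms distrib_left leval_add)
qed (auto simp: distrib_right leval_add assms)

lemma ring_hom_leval [simp]: "ring_hom \<phi> \<Longrightarrow> (\<And>v. x v \<noteq> 0) \<Longrightarrow> ring_hom (leval \<phi> x)"
  unfolding ring_hom_def[of "leval \<phi> x"] by (simp add: leval_add leval_mult)

section \<open>Indeterminates that occur in a polynomial, and induction within a given set of
  them\<close>

lemma occurring_0 [simp]: "occurring 0 = {}"
  by (simp add: occurring_def)

lemma occurring_const [simp]: "occurring (const c) = {}"
  by (auto simp: occurring_def const_def)

lemma occurring_1 [simp]: "occurring 1 = {}"
  by (metis const_1 occurring_const)

lemma occurring_pvar [simp]: "occurring (pvar v :: ('v, 'a::zero_neq_one) mpol) = {v}"
  by (auto simp: occurring_def pvar_def)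

lemma occurring_single: "occurring (single m c) \<subseteq> keys m"
  by (auto simp: occurring_def split: if_splits)

lemma finite_occurring [simp]: "finite (occurring p)"
  by (simp add: occurring_def)

lemma occurring_add: "occurring (p + q) \<subseteq> occurring p \<union> occurring q"
  using keys_add[of p q] by (auto simp: occurring_def)

lemma occurring_uminus [simp]: "occurring (- p) = occurring p"
  by (simp add: occurring_def)

lemma occurring_diff: "occurring (p - q) \<subseteq> occurring p \<union> occurring (q :: _ \<Rightarrow>\<^sub>0 _ :: ab_group_add)"
  using occurring_add[of p "- q"] by (simp add: occurring_def in_keys_iff)

lemma occurring_mult:
  "occurring (p * q) \<subseteq> occurring p \<union> occurring (q :: ('v \<Rightarrow>\<^sub>0 'e::comm_monoid_add) \<Rightarrow>\<^sub>0 'a::semiring_0)"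
proof
  fix v assume "v \<in> occurring (p * q)"
  then obtain m where m: "m \<in> keys (p * q)" "v \<in> keys m" by (auto simp: occurring_def)
  then obtain a b where "m = a + b" "a \<in> keys p" "b \<in> keys q"
    using keys_mult[of p q] by auto
  then show "v \<in> occurring p \<union> occurring q"
    using m(2) keys_add[of a b] by (auto simp: occurring_def)
qed

lemma occurring_sum: "occurring (\<Sum>a\<in>A. f a) \<subseteq> (\<Union>a\<in>A. occurring (f a))"
proof (induction A rule: infinite_finite_induct)
  case (insert a A)
  then show ?case using occurring_add[of "f a" "sum f A"] by auto
qed auto

lemma occurring_power:
  "occurring (p ^ k) \<subseteq> occurring (p :: ('v \<Rightarrow>\<^sub>0 'e::comm_monoid_add) \<Rightarrow>\<^sub>0 'a::comm_semiring_1)"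
proof (induction k)
  case 0
  show ?case by simp
next
  case (Suc k)
  then show ?case using occurring_mult[of p "p ^ k"] by auto
qed

lemma peval_cong:
  assumes "\<And>v. v \<in> occurring p \<Longrightarrow> x v = y v"
  shows "peval \<phi> x p = peval \<phi> y p"
proof -
  have "x v = y v" if "m \<in> keys p" "v \<in> keys m" for m v
    using assms that by (auto simp: occurring_def)
  then show ?thesis
    unfolding peval_def by (auto intro!: sum.cong prod.cong arg_cong2[where f = "(*)"])
qed

lemma single_eq_const_mult: "single m c = const c * single m (1 :: 'a::comm_semiring_1)"
  by (simp add: const_def mult_single)

lemma monom_induct [consumes 1, case_names zero add]:
  assumes "keys (m :: 'v \<Rightarrow>\<^sub>0 nat) \<subseteq> X"
    and zero: "P 0" and add: "\<And>v m. v \<in> X \<Longrightarrow> keys m \<subseteq> X \<Longrightarrow> P m \<Longrightarrow> P (single v 1 + m)"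
  shows "P m"
  using assms(1)
proof (induction "\<Sum>v\<in>keys m. lookup m v" arbitrary: m rule: less_induct)
  case less
  show ?case
  proof (cases "m = 0")
    case True
    then show ?thesis using zero by simp
  next
    case False
    then obtain v where v: "v \<in> keys m" by fastforce
    define m' where "m' = m - single v 1"
    have m: "m = single v 1 + m'"
      using v by (intro poly_mapping_eqI) (auto simp: m'_def lookup_add lookup_minus lookup_single when_def in_keys_iff)
    have sub: "keys m' \<subseteq> keys m"
      by (auto simp: m'_def in_keys_iff lookup_minus)
    have "(\<Sum>w\<in>keys m'. lookup m' w) = (\<Sum>w\<in>keys m. lookup m' w)"
      using sub by (intro sum.mono_neutral_left) (auto simp: in_keys_iff)
    also have "\<dots> < (\<Sum>w\<in>keys m. lookup m w)"
      using v by (intro sum_strict_mono_ex1) (auto simp: m'_def lookup_minus lookup_single when_def in_keys_iff)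
    finally have "P m'" using less sub by auto
    then have "P (single v 1 + m')" using add[of v m'] v sub less.prems by auto
    then show ?thesis using m by simp
  qed
qed

lemma single_monom_induct [consumes 1, case_names one mult]:
  assumes "keys (m :: 'v \<Rightarrow>\<^sub>0 nat) \<subseteq> X"
    and "P 1" "\<And>v q. v \<in> X \<Longrightarrow> P q \<Longrightarrow> P (pvar v * q)"
  shows "P (single m (1::'a::comm_semiring_1))"
  using assms(1)
proof (induction m rule: monom_induct)
  case zero
  show ?case using assms(2) by simp
next
  case (add v m)
  then show ?case using assms(3)[of v "single m 1"] by (simp add: pvar_def mult_single)
qed

text \<open>Adding one term of p at a time never introduces a new indeterminate, since all partial
  sums consist of terms of p; this keeps all summands and factors inside X.\<close>

lemma mpol_induct_occurring [consumes 1, case_names const pvar add mult]: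
  fixes p :: "('v, 'a::comm_semiring_1) mpol"
  assumes "occurring p \<subseteq> X"
    and "\<And>c. P (const c)" "\<And>v. v \<in> X \<Longrightarrow> P (pvar v)"
    and "\<And>p q. occurring p \<subseteq> X \<Longrightarrow> occurring q \<subseteq> X \<Longrightarrow> P p \<Longrightarrow> P q \<Longrightarrow> P (p + q)"
    and "\<And>p q. occurring p \<subseteq> X \<Longrightarrow> occurring q \<subseteq> X \<Longrightarrow> P p \<Longrightarrow> P q \<Longrightarrow> P (p * q)"
  shows "P p"
proof -
  have single: "P (single m c) \<and> occurring (single m c) \<subseteq> X" if "keys m \<subseteq> X" for m and c :: 'a
  proof -
    have "P (single m (1::'a)) \<and> occurring (single m (1::'a)) \<subseteq> X"
    proof (rule single_monom_induct[where P = "\<lambda>q. P q \<and> occurring q \<subseteq> X", OF that])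
      show "P 1 \<and> occurring (1 :: ('v, 'a) mpol) \<subseteq> X" using assms(2)[of 1] by simp
    next
      fix v and q :: "('v, 'a) mpol"
      assume *: "v \<in> X" "P q \<and> occurring q \<subseteq> X"
      then show "P (pvar v * q) \<and> occurring (pvar v * q) \<subseteq> X"
        using assms(3)[of v] assms(5)[of "pvar v" q] occurring_mult[of "pvar v" q] by auto
    qed
    then show ?thesis
      using assms(2)[of c] assms(5)[of "const c" "single m 1"] occurring_mult[of "const c" "single m (1::'a)"]
      by (subst (1 2) single_eq_const_mult) auto
  qed
  have "P (\<Sum>m\<in>A. single m (lookup p m)) \<and> occurring (\<Sum>m\<in>A. single m (lookup p m)) \<subseteq> X" if "A \<subseteq> keys p" for A
    using finite_subset[OF that finite_keys] that
  proof (induction A rule: finite_induct)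
    case empty
    show ?case using assms(2)[of 0] by simp
  next
    case (insert m A)
    have "P (single m (lookup p m)) \<and> occurring (single m (lookup p m)) \<subseteq> X"
      by (rule single) (use insert.prems assms(1) in \<open>auto simp: occurring_def\<close>)
    then show ?case
      using insert assms(4)[of "single m (lookup p m)" "\<Sum>m\<in>A. single m (lookup p m)"]
        occurring_add[of "single m (lookup p m)" "\<Sum>m\<in>A. single m (lookup p m)"]
      by auto
  qed
  from this[of "keys p"] show ?thesis by (simp add: sum_single_keys)
qed

lemmas mpol_induct = mpol_induct_occurring[OF subset_UNIV, case_names const pvar add mult]

text \<open>Comparisons of a formal substitution with its value at a complex point, and of two
  successive substitutions, go through this composition rule.\<close>

lemma peval_peval:
  assumes "ring_hom \<phi>" "ring_hom \<psi>" "ring_hom \<chi>" "\<And>c. \<psi> (\<phi> c) = \<chi> c"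
  shows "\<psi> (peval \<phi> x p) = peval \<chi> (\<lambda>v. \<psi> (x v)) p"
  by (induction p rule: mpol_induct)
    (use assms in \<open>auto simp: peval_add peval_mult ring_homD\<close>)

lemma peval_const_pvar [simp]:
  "peval const pvar (p :: ('v, 'a::comm_ring_1) mpol) = p"
  by (induction p rule: mpol_induct) (auto simp: peval_add peval_mult)

lemma occurring_peval:
  fixes x :: "'v \<Rightarrow> ('w, 'a::comm_ring_1) mpol"
  shows "occurring (peval const x p) \<subseteq> (\<Union>v\<in>occurring p. occurring (x v))"
proof -
  have "occurring (peval const x q) \<subseteq> (\<Union>v\<in>occurring p. occurring (x v))"
    if "occurring q \<subseteq> occurring p" for q
    using that
  proof (induction q rule: mpol_induct_occurring)
    case (add q1 q2)
    then show ?case using occurring_add[of "peval const x q1" "peval const x q2"] by (auto simp: peval_add)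
  next
    case (mult q1 q2)
    then show ?case using occurring_mult[of "peval const x q1" "peval const x q2"] by (auto simp: peval_mult)
  qed auto
  then show ?thesis by auto
qed

section \<open>Polynomials in one distinguished indeterminate\<close>

text \<open>The coefficients stay in the same multivariate ring although they are free of v.
  Evaluation at \<open>pvar v\<close> therefore gives back p, and degrees and coefficients become
  those of univariate polynomials over a domain. The linear order on the indeterminates is what
  makes that ring an instance of \<open>idom\<close>.\<close>

definition to_poly :: "'v \<Rightarrow> ('v::linorder, 'a::idom) mpol \<Rightarrow> ('v, 'a) mpol poly" where
  "to_poly v = peval (\<lambda>c. [:const c:]) (\<lambda>w. if w = v then [:0, 1:] else [:pvar w:])"

lemma ring_hom_const_poly [simp]: "ring_hom (\<lambda>c::'a::comm_ring_1. [:const c :: 'm::comm_monoid_add \<Rightarrow>\<^sub>0 'a:])"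
  by (auto simp: ring_hom_def const_add const_mult)

lemma ring_hom_to_poly [simp]: "ring_hom (to_poly v)"
  by (simp add: to_poly_def)

lemmas to_poly_0 [simp] = ring_homD(1)[OF ring_hom_to_poly]
lemmas to_poly_add = ring_homD(3)[OF ring_hom_to_poly]
lemmas to_poly_mult = ring_homD(4)[OF ring_hom_to_poly]
lemmas to_poly_diff = ring_hom_diff[OF ring_hom_to_poly]
lemmas to_poly_sum = ring_hom_sum[OF ring_hom_to_poly]
lemmas to_poly_power = ring_hom_power[OF ring_hom_to_poly]

lemma to_poly_const [simp]: "to_poly v (const c) = [:const c:]"
  by (simp add: to_poly_def)

lemma to_poly_pvar: "to_poly v (pvar w) = (if w = v then [:0, 1:] else [:pvar w:])"
  by (simp add: to_poly_def)

lemma poly_to_poly [simp]: "poly (to_poly v p) (pvar v) = p"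
  by (induction p rule: mpol_induct) (auto simp: to_poly_add to_poly_mult to_poly_pvar)

lemma to_poly_eq_0_iff [simp]: "to_poly v p = 0 \<longleftrightarrow> p = 0"
  by (metis poly_to_poly to_poly_0)

lemma to_poly_free:
  assumes "v \<notin> occurring p"
  shows "to_poly v p = [:p:]"
proof -
  have "occurring p \<subseteq> - {v}" using assms by auto
  then show ?thesis
    by (induction p rule: mpol_induct_occurring) (auto simp: to_poly_add to_poly_mult to_poly_pvar)
qed

lemma mev_pvar: "mev pvar m = (single m 1 :: ('v, 'a::comm_ring_1) mpol)"
  using peval_single[of const pvar m "1::'a"] by simp

lemma to_poly_single:
  "to_poly v (single m c) = monom (single (m - single v (lookup m v)) c) (lookup m v)"
proof -
  let ?k = "lookup m v"
  define m' where "m' = m - single v ?k"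
  have m: "m = single v ?k + m'"
    by (intro poly_mapping_eqI) (auto simp: m'_def lookup_add lookup_minus lookup_single when_def)
  have "v \<notin> keys m'"
    by (simp add: m'_def in_keys_iff lookup_minus)
  then have free: "to_poly v (single m' c) = [:single m' c:]"
    using occurring_single[of m' c] by (intro to_poly_free) auto
  have "pvar v ^ ?k * single m' c = single (single v ?k) 1 * single m' c"
    using mev_single[of pvar v ?k] mev_pvar[of "single v ?k"] by metis
  also have "\<dots> = single m c"
    using m by (simp add: mult_single)
  finally have "single m c = pvar v ^ ?k * single m' c" ..
  then have "to_poly v (single m c) = [:0, 1:] ^ ?k * [:single m' c:]"
    by (simp add: to_poly_mult to_poly_power to_poly_pvar free)
  also have "\<dots> = monom (single m' c) ?k"
    by (simp add: monom_altdef)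
  finally show ?thesis by (simp add: m'_def)
qed

lemma coeff_to_poly: "coeff (to_poly v p) d = coeff_in v d p"
proof -
  have "coeff (to_poly v p) d = coeff (to_poly v (\<Sum>m\<in>keys p. single m (lookup p m))) d"
    by (simp add: sum_single_keys)
  also have "\<dots> = (\<Sum>m\<in>keys p. if lookup m v = d then single (m - single v d) (lookup p m) else 0)"
    by (simp add: to_poly_sum to_poly_single coeff_sum if_distrib cong: if_cong)
  also have "\<dots> = coeff_in v d p"
    unfolding coeff_in_def by (rule sum.inter_filter[symmetric]) simp
  finally show ?thesis .
qed

text \<open>Removing the power of v is injective on the monomials of exponent d, so the terms
  collected in \<open>coeff_in\<close> never collide.\<close>

lemma lookup_coeff_in:
  assumes "lookup m v = d"
  shows "lookup (coeff_in v d p) (m - single v d) = lookup p m"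
proof -
  have eq: "m' = m" if "m' - single v d = m - single v d" "lookup m' v = d" for m'
  proof (rule poly_mapping_eqI)
    fix w
    have "lookup (m' - single v d) w = lookup (m - single v d) w" using that by simp
    then show "lookup m' w = lookup m w"
      using that(2) assms by (cases "w = v") (auto simp: lookup_minus lookup_single when_def)
  qed
  have "lookup (coeff_in v d p) (m - single v d)
      = (\<Sum>m'\<in>{m'\<in>keys p. lookup m' v = d}. if m' = m then lookup p m else 0)"
    unfolding coeff_in_def lookup_sum
    by (intro sum.cong refl) (use eq in \<open>auto simp: lookup_single when_def\<close>)
  then show ?thesis
    using assms by (simp add: sum.delta in_keys_iff)
qed

lemma degree_to_poly: "degree (to_poly v p) = degree_in v p"
proof (rule antisym)
  have fin: "finite (insert 0 ((\<lambda>m. lookup m v) ` keys p))" by simp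
  show "degree (to_poly v p) \<le> degree_in v p"
  proof (rule degree_le, intro allI impI)
    fix d assume d: "degree_in v p < d"
    have "{m \<in> keys p. lookup m v = d} = {}"
    proof (rule ccontr)
      assume "{m \<in> keys p. lookup m v = d} \<noteq> {}"
      then have "d \<in> insert 0 ((\<lambda>m. lookup m v) ` keys p)" by auto
      then have "d \<le> degree_in v p" unfolding degree_in_def by (rule Max_ge[OF fin])
      then show False using d by simp
    qed
    then show "coeff (to_poly v p) d = 0" by (simp only: coeff_to_poly coeff_in_def) simp
  qed
  have "degree_in v p \<in> insert 0 ((\<lambda>m. lookup m v) ` keys p)"
    unfolding degree_in_def by (rule Max_in[OF fin]) simp
  then show "degree_in v p \<le> degree (to_poly v p)"
  proof
    assume "degree_in v p \<in> (\<lambda>m. lookup m v) ` keys p"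
    then obtain m where m: "m \<in> keys p" "lookup m v = degree_in v p" by auto
    then have "lookup (coeff_in v (degree_in v p) p) (m - single v (degree_in v p)) \<noteq> 0"
      by (simp add: lookup_coeff_in in_keys_iff)
    then have "coeff (to_poly v p) (degree_in v p) \<noteq> 0"
      by (auto simp: coeff_to_poly)
    then show ?thesis by (rule le_degree)
  qed simp
qed

lemma occurring_coeff_in: "occurring (coeff_in v d p) \<subseteq> occurring p - {v}"
proof -
  have "keys (m - single v d) \<subseteq> occurring p - {v}" if "m \<in> keys p" "lookup m v = d" for m
    using that by (auto simp: occurring_def in_keys_iff lookup_minus lookup_single when_def split: if_splits)
  then have "occurring (single (m - single v d) (lookup p m)) \<subseteq> occurring p - {v}"
    if "m \<in> keys p" "lookup m v = d" for m
    using occurring_single[of "m - single v d" "lookup p m"] that by blast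
  then show ?thesis
    unfolding coeff_in_def using occurring_sum[of "\<lambda>m. single (m - single v d) (lookup p m)" "{m \<in> keys p. lookup m v = d}"]
    by blast
qed

lemma degree_in_pos_iff: "0 < degree_in v p \<longleftrightarrow> v \<in> occurring p"
proof
  assume "0 < degree_in v p"
  moreover have "degree_in v p \<in> insert 0 ((\<lambda>m. lookup m v) ` keys p)"
    unfolding degree_in_def by (rule Max_in) auto
  ultimately obtain m where "m \<in> keys p" "0 < lookup m v" by auto
  then show "v \<in> occurring p" by (auto simp: occurring_def in_keys_iff)
next
  assume "v \<in> occurring p"
  then obtain m where m: "m \<in> keys p" "0 < lookup m v" by (auto simp: occurring_def in_keys_iff)
  then have "lookup m v \<le> degree_in v p"
    unfolding degree_in_def by (intro Max_ge) auto
  then show "0 < degree_in v p" using m by simp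
qed

lemma degree_in_eq_0_iff: "degree_in v p = 0 \<longleftrightarrow> v \<notin> occurring p"
  using degree_in_pos_iff[of v p] by auto

lemma degree_in_mult:
  fixes p q :: "('v::linorder, 'a::idom) mpol"
  assumes "p \<noteq> 0" "q \<noteq> 0"
  shows "degree_in v (p * q) = degree_in v p + degree_in v q"
  using assms by (simp add: degree_to_poly[symmetric] to_poly_mult degree_mult_eq)

lemma occurring_mult_eq:
  fixes p q :: "('v::linorder, 'a::idom) mpol"
  assumes "p \<noteq> 0" "q \<noteq> 0"
  shows "occurring (p * q) = occurring p \<union> occurring q"
  using assms by (auto simp: degree_in_pos_iff[symmetric] degree_in_mult)

lemma lead_coeff_in_nonzero:
  fixes p :: "('v::linorder, 'a::idom) mpol"
  shows "p \<noteq> 0 \<Longrightarrow> coeff_in v (degree_in v p) p \<noteq> 0"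
  by (metis coeff_to_poly degree_to_poly leading_coeff_0_iff to_poly_eq_0_iff)

lemma degree_in_diff_less:
  fixes p q :: "('v::linorder, 'a::idom) mpol"
  assumes "degree_in v p \<le> d" "degree_in v q \<le> d" "coeff_in v d p = coeff_in v d q"
  shows "p - q = 0 \<or> degree_in v (p - q) < d"
proof -
  let ?P = "to_poly v (p - q)"
  have "degree ?P \<le> d"
    using assms(1,2) by (simp add: degree_to_poly[symmetric] to_poly_diff degree_diff_le)
  moreover have "coeff ?P d = 0"
    using assms(3) by (simp add: to_poly_diff coeff_to_poly)
  ultimately have "degree ?P < d \<or> ?P = 0"
    by (metis leading_coeff_0_iff le_neq_implies_less)
  then show ?thesis by (auto simp: degree_to_poly)
qed

lemma mpol_eq_sum_coeff_in:
  fixes p :: "('v::linorder, 'a::idom) mpol"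
  shows "p = (\<Sum>d\<le>degree_in v p. coeff_in v d p * pvar v ^ d)"
  using poly_altdef[of "to_poly v p" "pvar v"] by (simp add: coeff_to_poly degree_to_poly)

lemma dvd_coeff_in:
  fixes p q :: "('v::linorder, 'a::idom) mpol"
  assumes "p dvd q" "v \<notin> occurring p"
  shows "p dvd coeff_in v d q"
proof -
  obtain r where "q = p * r" using assms by auto
  then have "to_poly v q = smult p (to_poly v r)"
    by (simp add: to_poly_mult to_poly_free[OF assms(2)])
  then show ?thesis by (simp add: coeff_to_poly[symmetric])
qed

section \<open>Irreducible polynomials are prime\<close>

lemma is_unit_mpol_iff:
  fixes p :: "('v::linorder, 'a::field) mpol"
  shows "p dvd 1 \<longleftrightarrow> p \<noteq> 0 \<and> occurring p = {}"
proof
  assume "p dvd 1"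
  then obtain q where q: "1 = p * q" by auto
  then have "p \<noteq> 0" "q \<noteq> 0" by auto
  then show "p \<noteq> 0 \<and> occurring p = {}"
    using occurring_mult_eq[of p q] q by (metis occurring_1 sup_eq_bot_iff)
next
  assume *: "p \<noteq> 0 \<and> occurring p = {}"
  have "keys m = {}" if "m \<in> keys p" for m
    using * that by (auto simp: occurring_def)
  then have sub: "keys p \<subseteq> {0}" by auto
  then have p: "p = const (lookup p 0)"
    using * by (intro poly_mapping_eqI) (auto simp: const_def lookup_single when_def in_keys_iff)
  then have "lookup p 0 \<noteq> 0" using * by (metis const_0)
  then have "1 = p * const (inverse (lookup p 0))"
    by (subst p) (simp add: const_mult[symmetric])
  then show "p dvd 1" by (rule dvdI)
qed

lemma dvd_occurring:
  fixes p q :: "('v::linorder, 'a::idom) mpol"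
  assumes "p dvd q" "q \<noteq> 0"
  shows "occurring p \<subseteq> occurring q"
  using assms occurring_mult_eq by fastforce

text \<open>The sum of the degrees drops at a proper factor because the cofactor, not being a unit,
  contains some indeterminate.\<close>

lemma ex_irreducible_dvd:
  fixes c :: "('v::linorder, 'a::field) mpol"
  assumes "c \<noteq> 0" "\<not> c dvd 1"
  shows "\<exists>p. irreducible p \<and> p dvd c"
  using assms
proof (induction "\<Sum>v\<in>occurring c. degree_in v c" arbitrary: c rule: less_induct)
  case less
  show ?case
  proof (cases "irreducible c")
    case False
    then obtain a b where ab: "c = a * b" "\<not> a dvd 1" "\<not> b dvd 1"
      using less.prems by (auto simp: irreducible_def)
    then have nz: "a \<noteq> 0" "b \<noteq> 0" using less.prems by auto
    then obtain w where w: "w \<in> occurring b" using ab(3) is_unit_mpol_iff by auto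
    have occ: "occurring c = occurring a \<union> occurring b"
      using ab nz by (simp add: occurring_mult_eq)
    have "(\<Sum>v\<in>occurring a. degree_in v a) \<le> (\<Sum>v\<in>occurring c. degree_in v a)"
      using occ by (intro sum_mono2) auto
    also have "\<dots> < (\<Sum>v\<in>occurring c. degree_in v c)"
      using w occ nz ab(1) by (intro sum_strict_mono_ex1) (auto simp: degree_in_mult degree_in_pos_iff)
    finally obtain p where "irreducible p" "p dvd a"
      using less.hyps[of a] nz ab by auto
    then show ?thesis using ab(1) by (metis dvd_mult2)
  qed auto
qed

text \<open>Testing primality only on factors with indeterminates in X lets Gauss's lemma run by
  induction on the number of indeterminates.\<close>

definition primes_on :: "'v set \<Rightarrow> ('v::linorder, 'a::field) mpol \<Rightarrow> bool" where
  "primes_on X p \<longleftrightarrow> (\<forall>a b. occurring a \<subseteq> X \<and> occurring b \<subseteq> X \<and> p dvd a * b \<longrightarrow> p dvd a \<or> p dvd b)"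

text \<open>Gauss's argument for primitive polynomials: in the product, look at the coefficient at i
  + j, where i and j belong to the first coefficients that p does not divide.\<close>

lemma primes_on_insert:
  fixes p :: "('v::linorder, 'a::field) mpol"
  assumes p: "primes_on X p" "v \<notin> occurring p" "v \<notin> X"
  shows "primes_on (insert v X) p"
  unfolding primes_on_def
proof (intro allI impI)
  fix a b assume ab: "occurring a \<subseteq> insert v X \<and> occurring b \<subseteq> insert v X \<and> p dvd a * b"
  let ?A = "\<lambda>i. coeff_in v i a" and ?B = "\<lambda>i. coeff_in v i b"
  have all: "p dvd c" if "\<And>i. p dvd coeff_in v i c" for c
    by (subst mpol_eq_sum_coeff_in[of c v]) (intro dvd_sum dvd_mult2 that)
  show "p dvd a \<or> p dvd b"
  proof (rule ccontr)
    assume "\<not> (p dvd a \<or> p dvd b)"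
    then have ex: "\<exists>i. \<not> p dvd ?A i" "\<exists>i. \<not> p dvd ?B i" using all by blast+
    define i where "i = (LEAST i. \<not> p dvd ?A i)"
    define j where "j = (LEAST i. \<not> p dvd ?B i)"
    have i: "\<not> p dvd ?A i" "\<And>k. k < i \<Longrightarrow> p dvd ?A k"
      unfolding i_def using LeastI_ex[OF ex(1)] not_less_Least by blast+
    have j: "\<not> p dvd ?B j" "\<And>k. k < j \<Longrightarrow> p dvd ?B k"
      unfolding j_def using LeastI_ex[OF ex(2)] not_less_Least by blast+
    have "coeff_in v (i + j) (a * b) = (\<Sum>k\<le>i + j. ?A k * ?B (i + j - k))"
      by (simp add: coeff_to_poly[symmetric] to_poly_mult coeff_mult)
    also have "\<dots> = ?A i * ?B j + (\<Sum>k\<in>{..i + j} - {i}. ?A k * ?B (i + j - k))"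
      by (subst sum.remove[of _ i]) auto
    finally have eq: "?A i * ?B j = coeff_in v (i + j) (a * b) - (\<Sum>k\<in>{..i + j} - {i}. ?A k * ?B (i + j - k))"
      by simp
    have "p dvd (\<Sum>k\<in>{..i + j} - {i}. ?A k * ?B (i + j - k))"
    proof (rule dvd_sum)
      fix k assume k: "k \<in> {..i + j} - {i}"
      show "p dvd ?A k * ?B (i + j - k)"
      proof (cases "k < i")
        case False
        then have "i + j - k < j" using k by auto
        then show ?thesis using j(2) by auto
      qed (use i(2) in auto)
    qed
    moreover have "p dvd coeff_in v (i + j) (a * b)"
      using ab p(2) by (intro dvd_coeff_in) auto
    ultimately have "p dvd ?A i * ?B j" unfolding eq by (rule dvd_diff[rotated])
    moreover have "occurring (?A i) \<subseteq> X" "occurring (?B j) \<subseteq> X"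
      using occurring_coeff_in[of v i a] occurring_coeff_in[of v j b] ab by auto
    ultimately show False using p(1) i(1) j(1) by (auto simp: primes_on_def)
  qed
qed

lemma pseudo_division:
  fixes h w :: "('v::linorder, 'a::idom) mpol"
  assumes "h \<noteq> 0" "occurring h \<subseteq> Y" "occurring w \<subseteq> Y" "v \<in> Y"
  shows "\<exists>e q r. occurring q \<subseteq> Y \<and> occurring r \<subseteq> Y \<and>
    coeff_in v (degree_in v h) h ^ e * w = q * h + r \<and> (r = 0 \<or> degree_in v r < degree_in v h)"
  using assms(3)
proof (induction "degree_in v w" arbitrary: w rule: less_induct)
  case less
  let ?k = "degree_in v h" and ?d = "degree_in v w"
  let ?I = "coeff_in v ?k h" and ?J = "coeff_in v ?d w * pvar v ^ (?d - ?k)"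
  have occ: "occurring ?I \<subseteq> Y" "occurring ?J \<subseteq> Y"
    using occurring_coeff_in[of v ?k h] occurring_coeff_in[of v ?d w] assms(2,4) less.prems
      occurring_mult[of "coeff_in v ?d w" "pvar v ^ (?d - ?k)"] occurring_power[of "pvar v" "?d - ?k"]
    by (auto simp: subset_iff)
  show ?case
  proof (cases "w = 0 \<or> ?d < ?k")
    case True
    then show ?thesis using less.prems by (intro exI[of _ 0] exI[of _ w]) auto
  next
    case False
    define w' where "w' = ?I * w - ?J * h"
    have occ': "occurring w' \<subseteq> Y"
      unfolding w'_def
      using occ less.prems assms(2) occurring_diff[of "?I * w" "?J * h"] occurring_mult[of ?I w] occurring_mult[of ?J h]
      by blast
    have tI: "to_poly v ?I = [:?I:]" "to_poly v (coeff_in v ?d w) = [:coeff_in v ?d w:]"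
      using occurring_coeff_in[of v ?k h] occurring_coeff_in[of v ?d w] by (auto intro!: to_poly_free)
    have X: "[:0, 1:] ^ n = monom (1 :: ('v, 'a) mpol) n" for n
      by (simp add: monom_altdef)
    have tJ: "to_poly v ?J = monom (coeff_in v ?d w) (?d - ?k)"
      by (simp add: to_poly_mult to_poly_power to_poly_pvar tI X smult_monom)
    have "w' = 0 \<or> degree_in v w' < ?d"
      unfolding w'_def
    proof (rule degree_in_diff_less)
      show "degree_in v (?I * w) \<le> ?d"
        using False degree_in_mult[of ?I w v] lead_coeff_in_nonzero[OF assms(1), of v]
          degree_in_eq_0_iff[of v ?I] occurring_coeff_in[of v ?k h] by auto
      show "degree_in v (?J * h) \<le> ?d"
        unfolding degree_to_poly[of v "?J * h", symmetric] to_poly_mult[of v ?J h] tJ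
        using False degree_mult_le[of "monom (coeff_in v ?d w) (?d - ?k)" "to_poly v h"]
          degree_monom_le[of "coeff_in v ?d w" "?d - ?k"]
        by (simp add: degree_to_poly) linarith
      show "coeff_in v ?d (?I * w) = coeff_in v ?d (?J * h)"
      proof -
        have "coeff_in v ?d (?J * h) = coeff (monom (coeff_in v ?d w) (?d - ?k) * to_poly v h) ?d"
          by (simp add: coeff_to_poly[symmetric, where p = "?J * h"] to_poly_mult[of v ?J h] tJ)
        also have "\<dots> = coeff_in v ?d w * ?I"
          using False by (simp add: coeff_monom_mult coeff_to_poly)
        also have "\<dots> = coeff_in v ?d (?I * w)"
          by (simp add: coeff_to_poly[symmetric, where p = "?I * w"] to_poly_mult[of v ?I w] tI(1) coeff_to_poly)
        finally show ?thesis ..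
      qed
    qed
    then have "\<exists>e q r. occurring q \<subseteq> Y \<and> occurring r \<subseteq> Y \<and> ?I ^ e * w' = q * h + r \<and>
        (r = 0 \<or> degree_in v r < ?k)"
    proof
      assume "w' = 0"
      then show ?thesis by (intro exI[of _ 0]) auto
    qed (use less.hyps occ' in blast)
    then obtain e q r where *: "occurring q \<subseteq> Y" "occurring r \<subseteq> Y" "?I ^ e * w' = q * h + r"
      "r = 0 \<or> degree_in v r < ?k" by blast
    have "?I ^ Suc e * w = (?I ^ e * ?J + q) * h + r"
      using *(3) by (simp add: w'_def algebra_simps)
    moreover have "occurring (?I ^ e * ?J + q) \<subseteq> Y"
      using *(1) occ occurring_add[of "?I ^ e * ?J" q] occurring_mult[of "?I ^ e" ?J] occurring_power[of ?I e]
      by blast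
    ultimately show ?thesis using * by blast
  qed
qed

text \<open>The irreducible factors of c are removed one by one. Each is prime by assumption and
  divides q or h; those taken from h are collected in d.\<close>

lemma cancel_content:
  fixes c p q h :: "('v::linorder, 'a::field) mpol"
  assumes pr: "\<And>\<pi> :: ('v, 'a) mpol. irreducible \<pi> \<Longrightarrow> occurring \<pi> \<subseteq> X \<Longrightarrow> primes_on Y \<pi>" and "X \<subseteq> Y"
    and "c \<noteq> 0" "occurring c \<subseteq> X" "p \<noteq> 0" "occurring q \<subseteq> Y" "occurring h \<subseteq> Y" "c * p = q * h"
  shows "\<exists>q' h' d. p = q' * h' \<and> h = d * h' \<and> d \<noteq> 0 \<and> occurring d \<subseteq> X"
  using assms(3-)
proof (induction "\<Sum>v\<in>occurring c. degree_in v c" arbitrary: c q h rule: less_induct)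
  case less
  show ?case
  proof (cases "c dvd 1")
    case True
    then obtain e where "1 = c * e" by auto
    then have "p = (e * q) * h" using less.prems(6)
      by (metis (no_types, opaque_lifting) mult.assoc mult.commute mult_1)
    then show ?thesis by (intro exI[of _ "e * q"] exI[of _ h] exI[of _ 1]) auto
  next
    case False
    then obtain \<pi> c' where \<pi>: "irreducible \<pi>" "c = \<pi> * c'"
      using ex_irreducible_dvd less.prems(1) by blast
    then have nz: "\<pi> \<noteq> 0" "c' \<noteq> 0" "q \<noteq> 0" "h \<noteq> 0" using less.prems by auto
    have occ: "occurring c = occurring \<pi> \<union> occurring c'"
      using \<pi> nz by (simp add: occurring_mult_eq)
    then have occX: "occurring \<pi> \<subseteq> X" "occurring c' \<subseteq> X" using less.prems by auto
    have "\<not> \<pi> dvd 1" using \<pi>(1) by (rule irreducible_not_unit)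
    then obtain w where w: "w \<in> occurring \<pi>" using nz is_unit_mpol_iff by auto
    have "(\<Sum>v\<in>occurring c'. degree_in v c') \<le> (\<Sum>v\<in>occurring c. degree_in v c')"
      using occ by (intro sum_mono2) auto
    also have "\<dots> < (\<Sum>v\<in>occurring c. degree_in v c)"
      using w occ nz \<pi>(2) by (intro sum_strict_mono_ex1) (auto simp: degree_in_mult degree_in_pos_iff)
    finally have lt: "(\<Sum>v\<in>occurring c'. degree_in v c') < (\<Sum>v\<in>occurring c. degree_in v c)" .
    have "\<pi> dvd q * h" using less.prems(6) \<pi>(2) by (metis dvd_triv_left mult.assoc)
    then have "\<pi> dvd q \<or> \<pi> dvd h"
      using pr[OF \<pi>(1) occX(1)] less.prems by (auto simp: primes_on_def)
    then show ?thesis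
    proof
      assume "\<pi> dvd q"
      then obtain q0 where q0: "q = \<pi> * q0" by auto
      then have "q0 \<noteq> 0" using nz by auto
      then have "occurring q0 \<subseteq> Y" using q0 less.prems(4) nz by (simp add: occurring_mult_eq)
      moreover have "c' * p = q0 * h" using less.prems(6) nz by (simp add: q0 \<pi>(2) mult.assoc)
      ultimately show ?thesis using less.hyps[OF lt nz(2) occX(2) less.prems(3)] less.prems by blast
    next
      assume "\<pi> dvd h"
      then obtain h0 where h0: "h = \<pi> * h0" by auto
      then have "h0 \<noteq> 0" using nz by auto
      then have "occurring h0 \<subseteq> Y" using h0 less.prems(5) nz by (simp add: occurring_mult_eq)
      moreover have "c' * p = q * h0" using less.prems(6) nz by (simp add: h0 \<pi>(2) mult_ac)
      ultimately obtain q' h' d where *: "p = q' * h'" "h0 = d * h'" "d \<noteq> 0" "occurring d \<subseteq> X"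
        using less.hyps[OF lt nz(2) occX(2) less.prems(3)] less.prems by blast
      then show ?thesis using h0 nz occX
        by (intro exI[of _ q'] exI[of _ h'] exI[of _ "\<pi> * d"]) (auto simp: mult_ac occurring_mult_eq)
    qed
  qed
qed

text \<open>An irreducible factor of c divides p times the cofactor. It cannot divide p, which is
  irreducible and has an indeterminate outside X, so it cancels from the cofactor.\<close>

lemma cancel_content_dvd:
  fixes c p f :: "('v::linorder, 'a::field) mpol"
  assumes pr: "\<And>\<pi> :: ('v, 'a) mpol. irreducible \<pi> \<Longrightarrow> occurring \<pi> \<subseteq> X \<Longrightarrow> primes_on Y \<pi>" and "X \<subseteq> Y"
    and p: "irreducible p" "\<not> occurring p \<subseteq> X" "occurring p \<subseteq> Y" and f: "occurring f \<subseteq> Y"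
    and "c \<noteq> 0" "occurring c \<subseteq> X" "p dvd c * f"
  shows "p dvd f"
  using assms(7-)
proof (induction "\<Sum>v\<in>occurring c. degree_in v c" arbitrary: c rule: less_induct)
  case less
  show ?case
  proof (cases "c dvd 1 \<or> f = 0")
    case True
    then show ?thesis
    proof
      assume "c dvd 1"
      then have "f dvd c * f * 1" "c * f dvd f" by (auto simp: mult_dvd_mono dest: mult_dvd_mono[of c 1 f f])
      then show ?thesis using less.prems(3) dvd_trans by blast
    qed auto
  next
    case False
    then obtain \<pi> c' where \<pi>: "irreducible \<pi>" "c = \<pi> * c'"
      using ex_irreducible_dvd less.prems(1) by blast
    then have nz: "\<pi> \<noteq> 0" "c' \<noteq> 0" "f \<noteq> 0" using less.prems False by auto
    obtain s where s: "c * f = p * s" using less.prems by auto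
    then have nzs: "s \<noteq> 0" "p \<noteq> 0" using nz \<pi>(2) by auto
    have occ: "occurring c = occurring \<pi> \<union> occurring c'"
      using \<pi> nz by (simp add: occurring_mult_eq)
    then have occX: "occurring \<pi> \<subseteq> X" "occurring c' \<subseteq> X" using less.prems by auto
    have nu: "\<not> \<pi> dvd 1" using \<pi>(1) by (rule irreducible_not_unit)
    then obtain w where w: "w \<in> occurring \<pi>" using nz is_unit_mpol_iff by auto
    have "(\<Sum>v\<in>occurring c'. degree_in v c') \<le> (\<Sum>v\<in>occurring c. degree_in v c')"
      using occ by (intro sum_mono2) auto
    also have "\<dots> < (\<Sum>v\<in>occurring c. degree_in v c)"
      using w occ nz \<pi>(2) by (intro sum_strict_mono_ex1) (auto simp: degree_in_mult degree_in_pos_iff)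
    finally have lt: "(\<Sum>v\<in>occurring c'. degree_in v c') < (\<Sum>v\<in>occurring c. degree_in v c)" .
    have "occurring (p * s) \<subseteq> Y"
      using s less.prems assms(2) f occurring_mult[of c f] by auto
    then have "occurring s \<subseteq> Y" using nzs by (simp add: occurring_mult_eq)
    moreover have "\<pi> dvd p * s" using s \<pi>(2) by (metis dvd_triv_left mult.assoc)
    ultimately have "\<pi> dvd p \<or> \<pi> dvd s"
      using pr[OF \<pi>(1) occX(1)] p(3) by (auto simp: primes_on_def)
    moreover have "\<not> \<pi> dvd p"
    proof
      assume "\<pi> dvd p"
      then obtain t where t: "p = \<pi> * t" by auto
      then have "t dvd 1" using p(1) nu by (auto dest: irreducibleD)
      then have "t \<noteq> 0" "occurring t = {}" using is_unit_mpol_iff by auto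
      then have "occurring p = occurring \<pi>" using t nz by (simp add: occurring_mult_eq)
      then show False using p(2) occX by auto
    qed
    ultimately obtain s' where "s = \<pi> * s'" by auto
    then have "c' * f = p * s'" using s nz by (simp add: \<pi>(2) mult_ac)
    then show ?thesis using less.hyps[OF lt nz(2) occX(2)] by auto
  qed
qed

text \<open>Over the fraction field of the coefficients, p and f have a greatest common divisor of
  the form a p + b f. It is represented without denominators by a nonzero combination h of least
  degree in v.\<close>

lemma irreducible_imp_primes_on:
  fixes p :: "('v::linorder, 'a::field) mpol"
  assumes "finite X" "irreducible p" "occurring p \<subseteq> X"
  shows "primes_on X p"
  using assms
proof (induction X arbitrary: p rule: finite_induct)
  case empty
  then have "p \<noteq> 0" "\<not> p dvd 1" using irreducible_not_unit by (auto simp: irreducible_def)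
  then show ?case using is_unit_mpol_iff empty by auto
next
  case (insert v X)
  let ?Y = "insert v X"
  have pr: "primes_on ?Y \<pi>" if "irreducible \<pi>" "occurring \<pi> \<subseteq> X" for \<pi> :: "('v, 'a) mpol"
    using primes_on_insert[OF insert.IH[OF that]] that insert.hyps by auto
  show ?case
  proof (cases "occurring p \<subseteq> X")
    case False
    have pnz: "p \<noteq> 0" using insert.prems by (auto simp: irreducible_def)
    show ?thesis
      unfolding primes_on_def
    proof (intro allI impI, rule ccontr)
      fix f g assume *: "occurring f \<subseteq> ?Y \<and> occurring g \<subseteq> ?Y \<and> p dvd f * g"
        and nd: "\<not> (p dvd f \<or> p dvd g)"
      define I where "I = {a * p + b * f | a b. occurring a \<subseteq> ?Y \<and> occurring b \<subseteq> ?Y} - {0}"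
      have "p \<in> I"
      proof -
        have "p = 1 * p + 0 * f" "occurring (1 :: ('v, 'a) mpol) \<subseteq> ?Y" "occurring (0 :: ('v, 'a) mpol) \<subseteq> ?Y"
          by auto
        then show ?thesis unfolding I_def using pnz by blast
      qed
      define h where "h = arg_min (degree_in v) (\<lambda>h. h \<in> I)"
      have h: "h \<in> I" "\<And>g. g \<in> I \<Longrightarrow> degree_in v h \<le> degree_in v g"
        unfolding h_def using arg_min_natI[of "\<lambda>h. h \<in> I", OF \<open>p \<in> I\<close>] arg_min_nat_le[of "\<lambda>h. h \<in> I"] by blast+
      obtain a b where ab: "h = a * p + b * f" "occurring a \<subseteq> ?Y" "occurring b \<subseteq> ?Y" "h \<noteq> 0"
        using h(1) by (auto simp: I_def)
      have occh: "occurring h \<subseteq> ?Y"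
        unfolding ab(1) using ab * insert.prems occurring_add[of "a * p" "b * f"] occurring_mult[of a p] occurring_mult[of b f]
        by blast
      let ?lc = "coeff_in v (degree_in v h) h"
      have lc: "?lc ^ e \<noteq> 0" "occurring (?lc ^ e) \<subseteq> X" for e
        using lead_coeff_in_nonzero[OF ab(4)] occurring_power[of ?lc e] occurring_coeff_in[of v "degree_in v h" h] occh
        by auto
      \<comment> \<open>Pseudo-remainders are again combinations of p and f, so minimality makes
        them vanish: h divides every combination up to a power of its leading coefficient, which is
        free of v.\<close>
      have div: "\<exists>e q. occurring q \<subseteq> ?Y \<and> ?lc ^ e * w = q * h"
        if w: "w = a' * p + b' * f" "occurring a' \<subseteq> ?Y" "occurring b' \<subseteq> ?Y" for w a' b'
      proof -
        have occw: "occurring w \<subseteq> ?Y"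
          unfolding w(1) using w * insert.prems occurring_add[of "a' * p" "b' * f"] occurring_mult[of a' p] occurring_mult[of b' f]
          by blast
        obtain e q r where eqr: "occurring q \<subseteq> ?Y" "occurring r \<subseteq> ?Y" "?lc ^ e * w = q * h + r"
          "r = 0 \<or> degree_in v r < degree_in v h"
          using pseudo_division[OF ab(4) occh occw, of v] by auto
        have "r = (?lc ^ e * a' - q * a) * p + (?lc ^ e * b' - q * b) * f"
          using eqr(3) by (simp add: w(1) ab(1) algebra_simps)
        moreover have "occurring (?lc ^ e * a' - q * a) \<subseteq> ?Y" "occurring (?lc ^ e * b' - q * b) \<subseteq> ?Y"
          using lc(2)[of e] w(2,3) eqr(1) ab(2,3)
            occurring_diff[of "?lc ^ e * a'" "q * a"] occurring_mult[of "?lc ^ e" a'] occurring_mult[of q a]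
            occurring_diff[of "?lc ^ e * b'" "q * b"] occurring_mult[of "?lc ^ e" b'] occurring_mult[of q b]
          by blast+
        ultimately have "r = 0 \<or> r \<in> I" unfolding I_def by blast
        then have "r = 0" using h(2) eqr(4) by fastforce
        then show ?thesis using eqr by auto
      qed
      obtain e q where q: "occurring q \<subseteq> ?Y" "?lc ^ e * p = q * h"
        using div[of p 1 0] by auto
      obtain e2 q2 where q2: "occurring q2 \<subseteq> ?Y" "?lc ^ e2 * f = q2 * h"
        using div[of f 0 1] by auto
      obtain q' h' d where d: "p = q' * h'" "h = d * h'" "d \<noteq> 0" "occurring d \<subseteq> X"
        using cancel_content[OF pr _ lc pnz q(1) occh q(2)] by blast
      have c2: "p dvd k" if "c \<noteq> 0" "occurring c \<subseteq> X" "p dvd c * k" "occurring k \<subseteq> ?Y" for c k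
        by (rule cancel_content_dvd[OF pr _ insert.prems(1) False insert.prems(2) that(4,1,2,3)]) auto
      have "q' dvd 1 \<or> h' dvd 1" using insert.prems(1) d(1) by (auto dest: irreducibleD)
      then show False
      proof
        assume "q' dvd 1"
        then have "p dvd h'" using d(1) by (metis dvd_triv_left dvd_mult_unit_iff' dvd_refl mult_dvd_mono mult_1 mult_unit_dvd_iff')
        then have "p dvd ?lc ^ e2 * f" using q2(2) d(2) by simp
        then show False using c2[OF lc] * nd by blast
      next
        assume "h' dvd 1"
        then obtain u where u: "1 = h' * u" by auto
        \<comment> \<open>Now h is free of v up to a unit: d lies in the ideal of p and f, so p
          divides d g and hence g.\<close>
        have "d = h * u" using d(2) u by (metis mult.assoc mult.right_neutral)
        then have "d * g = (a * g * u) * p + (b * u) * (f * g)"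
          by (simp add: ab(1) algebra_simps)
        then have "p dvd d * g" using * by (metis dvd_add dvd_mult dvd_refl)
        then show False using c2[OF d(3,4)] * nd by blast
      qed
    qed
  qed (use pr insert.prems in auto)
qed

lemma irreducible_imp_prime_elem_mpol:
  fixes p :: "('v::linorder, 'a::field) mpol"
  assumes "irreducible p"
  shows "prime_elem p"
proof (rule prime_elemI)
  fix a b assume "p dvd a * b"
  then show "p dvd a \<or> p dvd b"
    using irreducible_imp_primes_on[of "occurring p \<union> occurring a \<union> occurring b", OF _ assms]
    by (auto simp: primes_on_def)
qed (use assms irreducible_not_unit in \<open>auto simp: irreducible_def\<close>)

section \<open>The derivations\<close>

text \<open>The derivations are sums over \<open>keys\<close>, which is not additive; this lifts
  additivity in the coefficient to additivity in the polynomial.\<close>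

lemma linear_extension_add:
  assumes "\<And>m. T m 0 = 0" "\<And>m a b. T m (a + b) = T m a + (T m b :: 'b::comm_monoid_add)"
  shows "(\<Sum>m\<in>keys (p + q). T m (lookup (p + q) m))
    = (\<Sum>m\<in>keys p. T m (lookup p m)) + (\<Sum>m\<in>keys q. T m (lookup q m))"
proof -
  let ?S = "keys p \<union> keys q \<union> keys (p + q)"
  have sup: "(\<Sum>m\<in>keys r. T m (lookup r m)) = (\<Sum>m\<in>?S. T m (lookup r m))" if "keys r \<subseteq> ?S" for r
    using that by (intro sum.mono_neutral_left) (auto simp: in_keys_iff assms)
  have "(\<Sum>m\<in>?S. T m (lookup (p + q) m)) = (\<Sum>m\<in>?S. T m (lookup p m)) + (\<Sum>m\<in>?S. T m (lookup q m))"
    by (simp add: lookup_add assms sum.distrib)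
  then show ?thesis by (subst (1 2 3) sup) auto
qed

definition dterm :: "(avar \<Rightarrow>\<^sub>0 nat) \<Rightarrow> rat \<Rightarrow> dpol" where
  "dterm m c = (\<Sum>v\<in>keys m. single (m - single v 1 + single (a_next v) 1) (of_nat (lookup m v) * c))"

lemma dderiv_dterm: "dderiv p = (\<Sum>m\<in>keys p. dterm m (lookup p m))"
  by (simp add: dderiv_def dterm_def)

lemma dterm_0 [simp]: "dterm m 0 = 0"
  by (simp add: dterm_def)

lemma dterm_add: "dterm m (a + b) = dterm m a + dterm m b"
  by (simp add: dterm_def distrib_left single_add sum.distrib)

lemma dterm_superset:
  assumes "finite S" "keys m \<subseteq> S"
  shows "dterm m c = (\<Sum>v\<in>S. single (m - single v 1 + single (a_next v) 1) (of_nat (lookup m v) * c))"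
  unfolding dterm_def by (rule sum.mono_neutral_left) (use assms in \<open>auto simp: in_keys_iff\<close>)

lemma dderiv_0 [simp]: "dderiv 0 = 0"
  by (simp add: dderiv_def)

lemma dderiv_add: "dderiv (p + q) = dderiv p + dderiv q"
  unfolding dderiv_dterm by (rule linear_extension_add) (auto simp: dterm_add)

lemma dderiv_single: "dderiv (single m c) = dterm m c"
  by (cases "c = 0") (auto simp: dderiv_dterm)

text \<open>Exponents are natural numbers, so subtraction is truncated and v has to divide m. Where
  it does not, the corresponding term of a derivative has coefficient 0.\<close>

lemma minus_single_add:
  assumes "v \<in> keys (m :: 'v \<Rightarrow>\<^sub>0 nat)"
  shows "m - single v 1 + t + m' = m + m' - single v 1 + t" "m' + (m - single v 1 + t) = m' + m - single v 1 + t"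
  using assms by (auto intro!: poly_mapping_eqI simp: lookup_add lookup_minus lookup_single when_def in_keys_iff)

lemma dterm_mult:
  "dterm (m + m') (c * c') = dterm m c * single m' c' + single m c * dterm m' c'"
proof -
  let ?S = "keys m \<union> keys m' \<union> keys (m + m')"
  let ?t = "\<lambda>m v. m - single v 1 + single (a_next v) (1::nat)"
  have 1: "single (?t m v) (of_nat (lookup m v) * c) * single m' c'
      = single (?t (m + m') v) (of_nat (lookup m v) * (c * c'))" for v
  proof (cases "v \<in> keys m")
    case True
    have *: "?t m v + m' = ?t (m + m') v"
      by (rule minus_single_add(1)[OF True])
    show ?thesis by (simp only: mult_single * mult.assoc)
  qed (simp add: in_keys_iff)
  have 2: "single m c * single (?t m' v) (of_nat (lookup m' v) * c')
      = single (?t (m + m') v) (of_nat (lookup m' v) * (c * c'))" for v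
  proof (cases "v \<in> keys m'")
    case True
    have *: "m + ?t m' v = ?t (m + m') v"
      by (rule minus_single_add(2)[OF True])
    show ?thesis by (simp only: mult_single * mult.left_commute)
  qed (simp add: in_keys_iff)
  have "dterm (m + m') (c * c') = (\<Sum>v\<in>?S. single (?t (m + m') v) (of_nat (lookup (m + m') v) * (c * c')))"
    by (rule dterm_superset) auto
  also have "\<dots> = (\<Sum>v\<in>?S. single (?t m v) (of_nat (lookup m v) * c) * single m' c')
      + (\<Sum>v\<in>?S. single m c * single (?t m' v) (of_nat (lookup m' v) * c'))"
    unfolding 1 2 by (simp add: lookup_add distrib_right single_add sum.distrib)
  also have "\<dots> = (\<Sum>v\<in>?S. single (?t m v) (of_nat (lookup m v) * c)) * single m' c'
      + single m c * (\<Sum>v\<in>?S. single (?t m' v) (of_nat (lookup m' v) * c'))"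
    by (simp add: sum_distrib_left sum_distrib_right)
  also have "\<dots> = dterm m c * single m' c' + single m c * dterm m' c'"
    by (intro arg_cong2[where f = "(+)"] arg_cong2[where f = "(*)"] refl dterm_superset[symmetric]) auto
  finally show ?thesis .
qed

lemma dderiv_mult: "dderiv (p * q) = dderiv p * q + p * dderiv q"
proof (induction p rule: poly_mapping_single_induct)
  case (single m c)
  show ?case
  proof (induction q rule: poly_mapping_single_induct)
    case (single m' c')
    show ?case by (simp add: mult_single dderiv_single dterm_mult)
  qed (simp_all add: dderiv_add distrib_left)
qed (simp_all add: dderiv_add distrib_right)

lemma dderiv_const [simp]: "dderiv (const c) = 0"
  by (simp add: const_def dderiv_single dterm_def)

lemma dderiv_pvar [simp]: "dderiv (pvar v) = pvar (a_next v)"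
  by (simp add: pvar_def dderiv_single dterm_def)

lemma dderiv_pow_pvar: "(dderiv ^^ k) (pvar (i, m, d)) = pvar (i, m, d + k)"
  by (induction k) auto

lemma occurring_dderiv: "occurring (dderiv p) \<subseteq> occurring p \<union> a_next ` occurring p"
proof -
  have "occurring (dderiv q) \<subseteq> occurring p \<union> a_next ` occurring p" if "occurring q \<subseteq> occurring p" for q
    using that
  proof (induction q rule: mpol_induct_occurring)
    case (add p q)
    then show ?case using occurring_add[of "dderiv p" "dderiv q"] by (auto simp: dderiv_add)
  next
    case (mult q1 q2)
    then show ?case
      using occurring_add[of "dderiv q1 * q2" "q1 * dderiv q2"] occurring_mult[of "dderiv q1" q2]
        occurring_mult[of q1 "dderiv q2"] unfolding dderiv_mult by blast
  qed auto
  then show ?thesis by auto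
qed

text \<open>A monomial in which one factor (i, k, d) has been replaced by its derivative comes from
  only one monomial of Q, since Q does not contain (i, k, d + 1); so it cannot cancel.\<close>

lemma dderiv_top_order:
  assumes occ: "(i, k, d) \<in> occurring Q" and top: "\<And>d'. d < d' \<Longrightarrow> (i, k, d') \<notin> occurring Q"
  shows "(i, k, Suc d) \<in> occurring (dderiv Q)"
    and "\<And>d'. Suc d < d' \<Longrightarrow> (i, k, d') \<notin> occurring (dderiv Q)"
proof -
  let ?w = "(i, k, d)" and ?w' = "(i, k, Suc d)"
  let ?t = "\<lambda>m v. m - single v 1 + single (a_next v) (1::nat)"
  obtain m0 where m0: "m0 \<in> keys Q" "?w \<in> keys m0" using occ by (auto simp: occurring_def)
  have no: "lookup m ?w' = 0" if "m \<in> keys Q" for m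
    using top[of "Suc d"] that by (auto simp: occurring_def in_keys_iff)
  have eq: "v = ?w \<and> m = m0" if "m \<in> keys Q" "v \<in> keys m" "?t m v = ?t m0 ?w" for m v
  proof -
    have "lookup (?t m v) ?w' = lookup (?t m0 ?w) ?w'" using that by simp
    then have "a_next v = ?w'"
      using no[OF that(1)] by (auto simp: lookup_add lookup_minus lookup_single when_def split: if_splits)
    then have v: "v = ?w" by (cases v) auto
    have "m = m0"
    proof (rule poly_mapping_eqI)
      fix x
      have "lookup (?t m ?w) x = lookup (?t m0 ?w) x" using that(3) v by simp
      then show "lookup m x = lookup m0 x"
        using that(2) v m0(2) by (auto simp: lookup_add lookup_minus lookup_single when_def in_keys_iff split: if_splits)
    qed
    then show ?thesis using v by simp
  qed
  have "lookup (dderiv Q) (?t m0 ?w) = (\<Sum>m\<in>keys Q. \<Sum>v\<in>keys m. of_nat (lookup m v) * lookup Q m when ?t m v = ?t m0 ?w)"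
    by (simp add: dderiv_def lookup_sum lookup_single)
  also have "\<dots> = (\<Sum>m\<in>keys Q. \<Sum>v\<in>keys m. if v = ?w then (if m = m0 then of_nat (lookup m0 ?w) * lookup Q m0 else 0) else 0)"
    by (intro sum.cong refl) (use eq in \<open>auto simp: when_def\<close>)
  also have "\<dots> = (\<Sum>m\<in>keys Q. if m = m0 then of_nat (lookup m0 ?w) * lookup Q m0 else 0)"
    by (intro sum.cong refl) (use m0 in \<open>auto simp: sum.delta\<close>)
  also have "\<dots> = of_nat (lookup m0 ?w) * lookup Q m0"
    using m0 by (simp add: sum.delta)
  also have "\<dots> \<noteq> 0" using m0 by (auto simp: in_keys_iff)
  finally have "?t m0 ?w \<in> keys (dderiv Q)" by (simp add: in_keys_iff)
  moreover have "?w' \<in> keys (?t m0 ?w)"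
    by (auto simp: in_keys_iff lookup_add lookup_single)
  ultimately show "?w' \<in> occurring (dderiv Q)" by (auto simp: occurring_def)
next
  fix d' assume "Suc d < d'"
  then show "(i, k, d') \<notin> occurring (dderiv Q)"
    using occurring_dderiv[of Q] top[of d'] top[of "d' - 1"] by auto
qed

lemma dderiv_pow_top_order:
  assumes "(i, k, d) \<in> occurring Q" "\<And>d'. d < d' \<Longrightarrow> (i, k, d') \<notin> occurring Q"
  shows "(i, k, d + j) \<in> occurring ((dderiv ^^ j) Q) \<and> (\<forall>d'. d + j < d' \<longrightarrow> (i, k, d') \<notin> occurring ((dderiv ^^ j) Q))"
proof (induction j)
  case (Suc j)
  then show ?case using dderiv_top_order[of i k "d + j" "(dderiv ^^ j) Q"] by auto
qed (use assms in auto)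

section \<open>The derivation of Laurent polynomials, split into its action on coefficients and on
  monomials\<close>

definition lterm :: "(uvar \<Rightarrow>\<^sub>0 int) \<Rightarrow> dpol \<Rightarrow> dlpol" where
  "lterm m c = (\<Sum>v\<in>keys m. single (m - single v 1 + single (u_next v) 1) (of_int (lookup m v) * c))"

lemma lterm_0 [simp]: "lterm m 0 = 0"
  by (simp add: lterm_def)

lemma lterm_add: "lterm m (a + b) = lterm m a + lterm m b"
  by (simp add: lterm_def distrib_left single_add sum.distrib)

lemma lterm_superset:
  assumes "finite S" "keys m \<subseteq> S"
  shows "lterm m c = (\<Sum>v\<in>S. single (m - single v 1 + single (u_next v) 1) (of_int (lookup m v) * c))"
  unfolding lterm_def by (rule sum.mono_neutral_left) (use assms in \<open>auto simp: in_keys_iff\<close>)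

lemma lterm_mult:
  "lterm (m + m') (c * c') = lterm m c * single m' c' + single m c * lterm m' c'"
proof -
  let ?S = "keys m \<union> keys m' \<union> keys (m + m')"
  let ?t = "\<lambda>m v. m - single v 1 + single (u_next v) (1::int)"
  have 1: "single (?t m v) (of_int (lookup m v) * c) * single m' c'
      = single (?t (m + m') v) (of_int (lookup m v) * (c * c'))" for v
    by (simp add: mult_single algebra_simps)
  have 2: "single m c * single (?t m' v) (of_int (lookup m' v) * c')
      = single (?t (m + m') v) (of_int (lookup m' v) * (c * c'))" for v
    by (simp add: mult_single algebra_simps)
  have "lterm (m + m') (c * c') = (\<Sum>v\<in>?S. single (?t (m + m') v) (of_int (lookup (m + m') v) * (c * c')))"
    by (rule lterm_superset) auto
  also have "\<dots> = (\<Sum>v\<in>?S. single (?t m v) (of_int (lookup m v) * c) * single m' c')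
      + (\<Sum>v\<in>?S. single m c * single (?t m' v) (of_int (lookup m' v) * c'))"
    unfolding 1 2 by (simp add: lookup_add distrib_right single_add sum.distrib)
  also have "\<dots> = (\<Sum>v\<in>?S. single (?t m v) (of_int (lookup m v) * c)) * single m' c'
      + single m c * (\<Sum>v\<in>?S. single (?t m' v) (of_int (lookup m' v) * c'))"
    by (simp add: sum_distrib_left sum_distrib_right)
  also have "\<dots> = lterm m c * single m' c' + single m c * lterm m' c'"
    by (intro arg_cong2[where f = "(+)"] arg_cong2[where f = "(*)"] refl lterm_superset[symmetric]) auto
  finally show ?thesis .
qed

definition cderiv :: "dlpol \<Rightarrow> dlpol" where
  "cderiv f = (\<Sum>m\<in>keys f. single m (dderiv (lookup f m)))"

text \<open>This part treats the coefficients as constants. Iterated on a monomial it yields the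
  derivatives of that monomial, which have rational coefficients.\<close>

definition mderiv :: "dlpol \<Rightarrow> dlpol" where
  "mderiv f = (\<Sum>m\<in>keys f. lterm m (lookup f m))"

lemma lderiv_eq: "lderiv f = cderiv f + mderiv f"
  by (simp add: lderiv_def cderiv_def mderiv_def lterm_def sum.distrib)

lemma cderiv_0 [simp]: "cderiv 0 = 0" by (simp add: cderiv_def)
lemma mderiv_0 [simp]: "mderiv 0 = 0" by (simp add: mderiv_def)
lemma lderiv_0 [simp]: "lderiv 0 = 0" by (simp add: lderiv_eq)

lemma cderiv_add: "cderiv (f + g) = cderiv f + cderiv g"
  unfolding cderiv_def
  by (rule linear_extension_add[where T = "\<lambda>m c. single m (dderiv c)"]) (auto simp: dderiv_add single_add)

lemma mderiv_add: "mderiv (f + g) = mderiv f + mderiv g"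
  unfolding mderiv_def by (rule linear_extension_add) (auto simp: lterm_add)

lemma lderiv_add: "lderiv (f + g) = lderiv f + lderiv g"
  by (simp add: lderiv_eq cderiv_add mderiv_add)

lemma cderiv_single: "cderiv (single m c) = single m (dderiv c)"
  by (cases "c = 0") (auto simp: cderiv_def)

lemma mderiv_single: "mderiv (single m c) = lterm m c"
  by (cases "c = 0") (auto simp: mderiv_def)

lemma cderiv_mult: "cderiv (f * g) = cderiv f * g + f * cderiv g"
proof (induction f rule: poly_mapping_single_induct)
  case (single m c)
  show ?case
  proof (induction g rule: poly_mapping_single_induct)
    case (single m' c')
    show ?case by (simp add: mult_single cderiv_single dderiv_mult single_add)
  qed (simp_all add: cderiv_add distrib_left)
qed (simp_all add: cderiv_add distrib_right)

lemma mderiv_mult: "mderiv (f * g) = mderiv f * g + f * mderiv g"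
proof (induction f rule: poly_mapping_single_induct)
  case (single m c)
  show ?case
  proof (induction g rule: poly_mapping_single_induct)
    case (single m' c')
    show ?case by (simp add: mult_single mderiv_single lterm_mult)
  qed (simp_all add: mderiv_add distrib_left)
qed (simp_all add: mderiv_add distrib_right)

lemma lderiv_mult: "lderiv (f * g) = lderiv f * g + f * lderiv g"
  by (simp add: lderiv_eq cderiv_mult mderiv_mult algebra_simps)

section \<open>Ritt reduction by an irreducible polynomial\<close>

lemma strict_linear_order_asym:
  "strict_linear_order_on A r \<Longrightarrow> (v, w) \<in> r \<Longrightarrow> (w, v) \<notin> r"
  unfolding strict_linear_order_on_def by (meson irreflD transD)

lemma leader_eqI:
  assumes "strict_linear_order_on (A_derivs n l) r" "v \<in> occurring R" "\<And>w. w \<in> occurring R - {v} \<Longrightarrow> (w, v) \<in> r"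
  shows "leader r R = v"
  unfolding leader_def
proof (rule the_equality)
  show "v \<in> occurring R \<and> (\<forall>w\<in>occurring R - {v}. (w, v) \<in> r)" using assms by auto
next
  fix x assume x: "x \<in> occurring R \<and> (\<forall>w\<in>occurring R - {x}. (w, x) \<in> r)"
  show "x = v"
  proof (rule ccontr)
    assume "x \<noteq> v"
    then have "(v, x) \<in> r" "(x, v) \<in> r" using x assms(2,3) by auto
    then show False
      using strict_linear_order_asym[OF assms(1)] by blast
  qed
qed

lemma ex_leader:
  assumes r: "strict_linear_order_on (A_derivs n l) r" and R: "occurring R \<subseteq> A_derivs n l" "occurring R \<noteq> {}"
  shows "\<exists>v\<in>occurring R. \<forall>w\<in>occurring R - {v}. (w, v) \<in> r"
proof -
  have "\<exists>v\<in>S. \<forall>w\<in>S - {v}. (w, v) \<in> r" if "finite S" "S \<noteq> {}" "S \<subseteq> A_derivs n l" for S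
    using that
  proof (induction S rule: finite_ne_induct)
    case (insert x S)
    then obtain v where v: "v \<in> S" "\<forall>w\<in>S - {v}. (w, v) \<in> r" by auto
    have "(x, v) \<in> r \<or> (v, x) \<in> r"
      using r insert v by (auto simp: strict_linear_order_on_def total_on_def)
    then show ?case
    proof
      assume "(v, x) \<in> r"
      then have "(w, x) \<in> r" if "w \<in> S" for w
        using v(2) that r by (cases "w = v") (auto simp: strict_linear_order_on_def dest: transD)
      then show ?thesis by (intro bexI[of _ x]) auto
    qed (use v in auto)
  qed auto
  then show ?thesis using R by auto
qed

lemma a_next_pow: "(a_next ^^ k) (i, m, d) = (i, m, d + k)"
  by (induction k) auto

lemma ranking_less_pow:
  assumes "ranking n l r" "(i, m, d) \<in> A_derivs n l" "0 < k"
  shows "((i, m, d), (i, m, d + k)) \<in> r"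
  using assms(3)
proof (induction k)
  case (Suc k)
  have "(i, m, d + k) \<in> A_derivs n l" using assms(2) by (auto simp: A_derivs_def)
  then have "((i, m, d + k), (i, m, d + Suc k)) \<in> r" using assms(1) by (auto simp: ranking_def)
  then show ?case
    using Suc assms(1) by (cases "k = 0") (auto simp: ranking_def strict_linear_order_on_def dest: transD)
qed simp

text \<open>One step with k = 0 turns R into 0, and 0 is reduced because every derivative of R has
  positive degree in its leader. This is how R is seen to lie in the elimination ideal.\<close>

lemma self_in_sat:
  assumes R: "R \<in> D_ring n l" "occurring R \<noteq> {}"
  shows "R \<in> sat n l R"
  unfolding sat_def
proof (intro CollectI conjI allI impI R(1))
  fix r assume "elimination_ranking n l r"
  then have rk: "ranking n l r" and lin: "strict_linear_order_on (A_derivs n l) r"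
    by (auto simp: elimination_ranking_def ranking_def)
  have sub: "occurring R \<subseteq> A_derivs n l" using R by (auto simp: D_ring_def)
  obtain i m d where v: "(i, m, d) \<in> occurring R" "\<And>w. w \<in> occurring R - {(i, m, d)} \<Longrightarrow> (w, (i, m, d)) \<in> r"
    using ex_leader[OF lin sub R(2)] by auto
  have lead: "leader r R = (i, m, d)" by (rule leader_eqI[OF lin v])
  have top: "(i, m, d') \<notin> occurring R" if "d < d'" for d'
  proof
    assume *: "(i, m, d') \<in> occurring R"
    then have "((i, m, d'), (i, m, d)) \<in> r" using v(2) that by auto
    moreover have "((i, m, d), (i, m, d')) \<in> r"
      using ranking_less_pow[OF rk, of i m d "d' - d"] v(1) sub that by auto
    ultimately show False using strict_linear_order_asym[OF lin] by blast
  qed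
  have pos: "0 < degree_in (i, m, d + k) ((dderiv ^^ k) R)" for k
    using dderiv_pow_top_order[OF v(1) top, of k] by (auto simp: degree_in_pos_iff)
  have no0: "\<nexists>h. ritt_step r R 0 h"
  proof -
    have "degree_in v (0 :: dpol) = 0" for v by (simp add: degree_in_def)
    then show ?thesis
      using pos by (auto simp: ritt_step_def divisible_at_def lead a_next_pow Let_def)
  qed
  have "ritt_step r R R 0"
    unfolding ritt_step_def
  proof (intro exI[of _ 0] conjI allI impI)
    fix k' :: nat assume "0 < k'"
    then show "\<not> divisible_at r R R k'"
      using pos[of k'] top[of "d + k'"] degree_in_eq_0_iff[of "(i, m, d + k')" R]
      by (simp add: divisible_at_def lead a_next_pow Let_def)
  qed (auto simp: divisible_at_def Let_def)
  then show "diff_remainder r R R 0" using no0 by (auto simp: diff_remainder_def)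
qed

fun ranking_key :: "nat \<times> nat \<Rightarrow> avar \<Rightarrow> nat \<times> avar" where
  "ranking_key q (i, k, d) = (if (i, k) = q then 1 else 0, i, k, d)"

text \<open>An elimination ranking in which the derivatives of \<open>\<aa>\<^sub>i\<^sub>,\<^sub>k\<close>, where \<open>q = (i, k)\<close>, are above all
  others, so that the leader of \<open>R\<close> is its highest derivative of \<open>\<aa>\<^sub>i\<^sub>,\<^sub>k\<close>.\<close>

definition top_ranking :: "nat \<Rightarrow> (nat \<Rightarrow> nat) \<Rightarrow> nat \<times> nat \<Rightarrow> avar rel" where
  "top_ranking n l q = {(v, w). v \<in> A_derivs n l \<and> w \<in> A_derivs n l \<and> ranking_key q v < ranking_key q w}"

lemma elimination_ranking_top_ranking: "elimination_ranking n l (top_ranking n l q)"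
proof -
  have inj: "v = w" if "ranking_key q v = ranking_key q w" for v w
    using that by (cases v; cases w) auto
  have "trans (top_ranking n l q)"
    unfolding top_ranking_def trans_def using less_trans by blast
  moreover have "irrefl (top_ranking n l q)"
    by (auto simp: top_ranking_def irrefl_def)
  moreover have "total_on (A_derivs n l) (top_ranking n l q)"
    unfolding top_ranking_def total_on_def using inj neqE by blast
  moreover have "(v, a_next v) \<in> top_ranking n l q" if "v \<in> A_derivs n l" for v
    using that by (cases v) (auto simp: top_ranking_def A_derivs_def)
  moreover have "(a_next v, a_next w) \<in> top_ranking n l q" if "(v, w) \<in> top_ranking n l q" for v w
    using that by (cases v; cases w) (auto simp: top_ranking_def A_derivs_def split: if_splits)
  moreover have "((i, k, d), (j, s, e)) \<in> top_ranking n l q"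
    if "((i, k, 0), (j, s, 0)) \<in> top_ranking n l q" for i k j s d e
    using that by (auto simp: top_ranking_def A_derivs_def split: if_splits)
  ultimately show ?thesis
    by (auto simp: elimination_ranking_def ranking_def strict_linear_order_on_def)
qed

text \<open>With the derivatives of (i, m) on top, f and all its successors in the reduction contain
  no proper derivative of the leader of R, so only multiples of R are subtracted. Thus R divides a
  power of its initial times f, and the prime R does not divide its initial.\<close>

lemma sat_low_order_dvd:
  assumes R: "irreducible R" "R \<in> D_ring n l" "(i, m, d) \<in> occurring R"
    and top: "\<And>d'. d < d' \<Longrightarrow> (i, m, d') \<notin> occurring R"
    and f: "f \<in> sat n l R" and low: "\<And>d'. d < d' \<Longrightarrow> (i, m, d') \<notin> occurring f"
  shows "R dvd f"
proof -
  let ?r = "top_ranking n l (i, m)"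
  have sub: "occurring R \<subseteq> A_derivs n l" using R by (auto simp: D_ring_def)
  have lin: "strict_linear_order_on (A_derivs n l) ?r"
    using elimination_ranking_top_ranking by (auto simp: elimination_ranking_def ranking_def)
  have lead: "leader ?r R = (i, m, d)"
  proof (rule leader_eqI[OF lin R(3)])
    fix w assume w: "w \<in> occurring R - {(i, m, d)}"
    obtain j s e where w': "w = (j, s, e)" by (cases w)
    have "e < d" if "(j, s) = (i, m)"
      using top[of e] w that unfolding w' by (cases "e < d") (auto simp: not_less le_less)
    then show "(w, (i, m, d)) \<in> ?r"
      using w sub R(3) by (auto simp: w' top_ranking_def split: if_splits)
  qed
  have pos: "0 < degree_in (i, m, d + k) ((dderiv ^^ k) R)" for k
    using dderiv_pow_top_order[OF R(3) top, of k] by (auto simp: degree_in_pos_iff)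
  let ?I = "coeff_in (i, m, d) (degree_in (i, m, d) R) R"
  have "diff_remainder ?r R f 0"
    using f elimination_ranking_top_ranking by (auto simp: sat_def)
  then have "(ritt_step ?r R)\<^sup>*\<^sup>* f 0" by (simp add: diff_remainder_def)
  then have "\<exists>N. R dvd ?I ^ N * f"
    using low
  proof (induction rule: converse_rtranclp_induct)
    case (step f g)
    obtain k where k: "divisible_at ?r R f k"
      and g: "g = (let v = (a_next ^^ k) (leader ?r R); Q = (dderiv ^^ k) R;
             e = degree_in v Q; d = degree_in v f
         in coeff_in v e Q * f - coeff_in v d f * pvar v ^ (d - e) * Q)"
      using step(1) by (auto simp: ritt_step_def Let_def)
    have "0 < degree_in (i, m, d + k) f"
      using k pos[of k] by (simp add: divisible_at_def lead a_next_pow Let_def)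
    then have "k = 0"
      using step.prems[of "d + k"] by (auto simp: degree_in_pos_iff intro: ccontr)
    define J where "J = coeff_in (i, m, d) (degree_in (i, m, d) f) f
      * pvar (i, m, d) ^ (degree_in (i, m, d) f - degree_in (i, m, d) R)"
    have g': "g = ?I * f - J * R"
      using g \<open>k = 0\<close> by (simp add: lead Let_def J_def)
    have "(i, m, d') \<notin> occurring g" if "d < d'" for d'
    proof -
      have "occurring J \<subseteq> occurring f \<union> {(i, m, d)}"
        unfolding J_def
        using occurring_mult[of "coeff_in (i, m, d) (degree_in (i, m, d) f) f"
            "pvar (i, m, d) ^ (degree_in (i, m, d) f - degree_in (i, m, d) R)"]
          occurring_power[of "pvar (i, m, d)" "degree_in (i, m, d) f - degree_in (i, m, d) R"]
          occurring_coeff_in[of "(i, m, d)" "degree_in (i, m, d) f" f] by auto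
      moreover have "occurring ?I \<subseteq> occurring R"
        using occurring_coeff_in[of "(i, m, d)" "degree_in (i, m, d) R" R] by auto
      ultimately have "occurring g \<subseteq> occurring f \<union> occurring R \<union> {(i, m, d)}"
        unfolding g' using occurring_diff[of "?I * f" "J * R"] occurring_mult[of ?I f] occurring_mult[of J R]
        by blast
      then show ?thesis using that top step.prems by auto
    qed
    then obtain N where N: "R dvd ?I ^ N * g" using step.IH by blast
    have "?I ^ Suc N * f = ?I ^ N * g + (?I ^ N * J) * R"
      by (simp add: g' algebra_simps)
    then have "R dvd ?I ^ Suc N * f" using N by (metis dvd_add dvd_triv_right)
    then show ?case by blast
  qed auto
  then obtain N where N: "R dvd ?I ^ N * f" by blast
  have prime: "prime_elem R" by (rule irreducible_imp_prime_elem_mpol[OF R(1)])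
  have "\<not> R dvd ?I"
  proof
    assume "R dvd ?I"
    moreover have "?I \<noteq> 0" using prime by (intro lead_coeff_in_nonzero) auto
    ultimately have "occurring R \<subseteq> occurring ?I" by (rule dvd_occurring)
    then show False using R(3) occurring_coeff_in[of "(i, m, d)" "degree_in (i, m, d) R" R] by auto
  qed
  then show ?thesis
    using N prime by (auto simp: prime_elem_dvd_mult_iff dest: prime_elem_dvd_power)
qed

text \<open>Over a domain the indeterminates of a factor occur in the product, so factors and
  inverses never leave \<open>D_ring\<close>, and irreducibility holds in the ambient ring.\<close>

lemma irreducible_in_D_ring:
  assumes "irreducible_in (D_ring n l) R"
  shows "irreducible R" "occurring R \<noteq> {}"
proof -
  have R: "R \<in> D_ring n l" "R \<noteq> 0" using assms by (auto simp: irreducible_in_def)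
  have unit: "q \<in> D_ring n l" if "p * q = 1" for p q :: dpol
    using that is_unit_mpol_iff[of q] by (auto simp: D_ring_def) (metis dvd_triv_right emptyE)
  have nu: "\<not> R dvd 1"
  proof
    assume "R dvd 1"
    then obtain q where "R * q = 1" by (metis dvdE)
    then show False using unit assms by (auto simp: irreducible_in_def)
  qed
  then show "occurring R \<noteq> {}" using R is_unit_mpol_iff by auto
  show "irreducible R"
  proof (rule irreducibleI)
    fix a b assume ab: "R = a * b"
    then have nz: "a \<noteq> 0" "b \<noteq> 0" using R by auto
    then have "occurring R = occurring a \<union> occurring b" using ab by (simp add: occurring_mult_eq)
    then have "a \<in> D_ring n l" "b \<in> D_ring n l" using R by (auto simp: D_ring_def)
    then show "a dvd 1 \<or> b dvd 1"
      using assms ab by (auto simp: irreducible_in_def) (metis dvdI)+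
  qed (use R nu in auto)
qed

section \<open>Nonvanishing of nonzero polynomials\<close>

text \<open>Choose the other coordinates so that the leading coefficient in v survives; then v only
  has to avoid finitely many roots and 0. Nonzero coordinates make the point usable on the
  torus.\<close>

lemma ex_nonroot:
  fixes \<phi> :: "'a::idom \<Rightarrow> complex" and p :: "('v::linorder, 'a) mpol"
  assumes \<phi>: "ring_hom \<phi>" "\<And>c. \<phi> c = 0 \<Longrightarrow> c = 0" and "p \<noteq> 0"
  shows "\<exists>x. (\<forall>v. x v \<noteq> 0) \<and> peval \<phi> x p \<noteq> 0"
  using assms(3)
proof (induction "card (occurring p)" arbitrary: p rule: less_induct)
  case less
  show ?case
  proof (cases "occurring p = {}")
    case True
    then have "keys p \<subseteq> {0}" by (auto simp: occurring_def)
    then have p: "p = const (lookup p 0)"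
      by (intro poly_mapping_eqI) (auto simp: const_def lookup_single when_def in_keys_iff)
    then have "lookup p 0 \<noteq> 0" using less.prems by (metis const_0)
    then have "peval \<phi> (\<lambda>_. 1) p \<noteq> 0" using \<phi> by (subst p) auto
    then show ?thesis by (intro exI[of _ "\<lambda>_. 1"]) auto
  next
    case False
    then obtain v where v: "v \<in> occurring p" by auto
    let ?d = "degree_in v p"
    let ?c = "coeff_in v ?d p"
    have "card (occurring ?c) < card (occurring p)"
      using v occurring_coeff_in[of v ?d p] by (intro psubset_card_mono) auto
    then obtain x where x: "\<forall>v. x v \<noteq> 0" "peval \<phi> x ?c \<noteq> 0"
      using less.hyps lead_coeff_in_nonzero[OF less.prems] by blast
    define P where "P = (\<Sum>d\<le>?d. monom (peval \<phi> x (coeff_in v d p)) d)"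
    have "coeff P ?d = peval \<phi> x ?c"
      by (simp add: P_def coeff_sum)
    then have "P \<noteq> 0" using x by auto
    then have "finite ({t. poly P t = 0} \<union> {0})" by (auto simp: poly_roots_finite)
    then obtain t where "t \<notin> {t. poly P t = 0} \<union> {0}"
      using ex_new_if_finite[OF infinite_UNIV_char_0] by blast
    then have t: "poly P t \<noteq> 0" "t \<noteq> 0" by auto
    have "peval \<phi> (x(v := t)) p = (\<Sum>d\<le>?d. peval \<phi> (x(v := t)) (coeff_in v d p) * t ^ d)"
      by (subst mpol_eq_sum_coeff_in[of p v]) (simp add: \<phi> peval_sum peval_mult peval_power)
    also have "\<dots> = (\<Sum>d\<le>?d. peval \<phi> x (coeff_in v d p) * t ^ d)"
      using occurring_coeff_in[of v _ p] by (intro sum.cong arg_cong2[where f = "(*)"] peval_cong refl) auto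
    also have "\<dots> = poly P t" by (simp add: P_def poly_sum poly_monom)
    finally show ?thesis using x t by (intro exI[of _ "x(v := t)"]) auto
  qed
qed

definition ev :: "(avar \<Rightarrow> complex) \<Rightarrow> (uvar \<Rightarrow> complex) \<Rightarrow> dlpol \<Rightarrow> complex" where
  "ev x u = leval (peval of_rat x) u"

context
  fixes u :: "uvar \<Rightarrow> complex"
  assumes u: "\<And>v. u v \<noteq> 0"
begin

lemma ring_hom_ev: "ring_hom (ev x u)"
  using u by (simp add: ev_def)

lemmas ev_add = ring_homD(3)[OF ring_hom_ev]
lemmas ev_mult = ring_homD(4)[OF ring_hom_ev]
lemmas ev_uminus = ring_hom_uminus[OF ring_hom_ev]
lemmas ev_sum = ring_hom_sum[OF ring_hom_ev]

lemma ev_single: "ev x u (single m c) = peval of_rat x c * lmev u m"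
  by (simp add: ev_def leval_single)

lemma ev_const: "ev x u (const c) = peval of_rat x c"
  by (simp add: ev_def)

end

lemma ev_eq_sum: "ev x u Q = (\<Sum>m\<in>keys Q. peval of_rat x (lookup Q m) * lmev u m)"
  unfolding ev_def by (rule leval_superset) auto

lemma of_rat_inj: "(of_rat q :: complex) = 0 \<Longrightarrow> q = 0"
  by simp

text \<open>First x is chosen so that one coefficient survives. The shift by s then clears all
  negative exponents and keeps distinct monomials distinct, which leaves an ordinary polynomial in
  u.\<close>

lemma ex_nonroot_Laurent:
  assumes "Q \<noteq> 0"
  shows "\<exists>x u. (\<forall>v. u v \<noteq> 0) \<and> ev x u Q \<noteq> 0"
proof -
  obtain m0 where m0: "m0 \<in> keys Q" using assms by (meson all_not_in_conv keys_eq_empty)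
  obtain x :: "avar \<Rightarrow> complex" where x: "peval of_rat x (lookup Q m0) \<noteq> 0"
    using ex_nonroot[OF ring_hom_of_rat of_rat_inj, of "lookup Q m0"] m0 by (auto simp: in_keys_iff)
  define s where "s = (\<Sum>m\<in>keys Q. \<Sum>v\<in>keys m. single v (nat \<bar>lookup m v\<bar>))"
  have s: "lookup s v = (\<Sum>m\<in>keys Q. nat \<bar>lookup m v\<bar>)" for v
  proof -
    have "(\<Sum>w\<in>keys m. lookup (single w (nat \<bar>lookup m w\<bar>)) v) = nat \<bar>lookup m v\<bar>" for m :: "uvar \<Rightarrow>\<^sub>0 int"
    proof -
      have "(\<Sum>w\<in>keys m. lookup (single w (nat \<bar>lookup m w\<bar>)) v) = (\<Sum>w\<in>keys m. if w = v then nat \<bar>lookup m v\<bar> else 0)"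
        by (intro sum.cong) (auto simp: lookup_single when_def)
      then show ?thesis by (auto simp: in_keys_iff)
    qed
    then show ?thesis by (simp add: s_def lookup_sum)
  qed
  define sh where "sh m = Poly_Mapping.map nat (m + Poly_Mapping.map int s)" for m :: "uvar \<Rightarrow>\<^sub>0 int"
  have lmap: "lookup (Poly_Mapping.map int s) v = int (lookup s v)" for v
    by (simp add: map.rep_eq when_def)
  have le: "0 \<le> lookup m v + int (lookup s v)" if "m \<in> keys Q" for m v
  proof -
    have "nat \<bar>lookup m v\<bar> \<le> lookup s v"
      unfolding s using that by (intro member_le_sum) auto
    then show ?thesis by linarith
  qed
  have sh: "int (lookup (sh m) v) = lookup m v + int (lookup s v)" if "m \<in> keys Q" for m v
    using le[OF that, of v] by (auto simp: sh_def map.rep_eq when_def lookup_add lmap)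
  have inj: "inj_on sh (keys Q)"
  proof (rule inj_onI, rule poly_mapping_eqI)
    fix m m' v assume "m \<in> keys Q" "m' \<in> keys Q" "sh m = sh m'"
    then show "lookup m v = lookup m' v" using sh[of m v] sh[of m' v] by simp
  qed
  define p where "p = (\<Sum>m\<in>keys Q. single (sh m) (peval of_rat x (lookup Q m)))"
  have "lookup p (sh m0) = (\<Sum>m\<in>keys Q. if m = m0 then peval of_rat x (lookup Q m0) else 0)"
    unfolding p_def lookup_sum
    by (intro sum.cong refl) (use inj m0 in \<open>auto simp: lookup_single when_def dest: inj_onD\<close>)
  then have "lookup p (sh m0) \<noteq> 0" using m0 x by simp
  then have "p \<noteq> 0" by auto
  then obtain u :: "uvar \<Rightarrow> complex" where u: "\<And>v. u v \<noteq> 0" "peval id u p \<noteq> 0"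
    using ex_nonroot[of "id :: complex \<Rightarrow> complex" p] by auto
  have mon: "mev u (sh m) = lmev u m * mev u s" if "m \<in> keys Q" for m
  proof -
    let ?S = "keys m \<union> keys s \<union> keys (sh m)"
    have "mev u (sh m) = (\<Prod>v\<in>?S. u v ^ lookup (sh m) v)" by (rule mev_superset) auto
    also have "\<dots> = (\<Prod>v\<in>?S. u v powi lookup m v * u v ^ lookup s v)"
    proof (rule prod.cong)
      fix v
      have "u v ^ lookup (sh m) v = u v powi (lookup m v + int (lookup s v))"
        by (simp add: sh[OF that, symmetric])
      then show "u v ^ lookup (sh m) v = u v powi lookup m v * u v ^ lookup s v"
        using u(1)[of v] by (simp add: power_int_add)
    qed simp
    also have "\<dots> = (\<Prod>v\<in>?S. u v powi lookup m v) * (\<Prod>v\<in>?S. u v ^ lookup s v)"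
      by (rule prod.distrib)
    also have "\<dots> = lmev u m * mev u s"
      by (intro arg_cong2[where f = "(*)"] lmev_superset[symmetric] mev_superset[symmetric]) auto
    finally show ?thesis .
  qed
  have "peval id u p = ev x u Q * mev u s"
    by (simp add: p_def peval_sum peval_single ev_eq_sum mon sum_distrib_left mult_ac)
  then show ?thesis using u by (intro exI[of _ x] exI[of _ u]) auto
qed

section \<open>Derivatives of the generic polynomials\<close>

lemma lookup_cderiv: "lookup (cderiv f) m = dderiv (lookup f m)"
proof -
  have "lookup (cderiv f) m = (\<Sum>m'\<in>keys f. if m' = m then dderiv (lookup f m) else 0)"
    unfolding cderiv_def lookup_sum by (intro sum.cong) (auto simp: lookup_single when_def)
  then show ?thesis by (auto simp: in_keys_iff)
qed

definition const_coeffs :: "dlpol \<Rightarrow> bool" where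
  "const_coeffs f \<longleftrightarrow> (\<forall>m. \<exists>q. lookup f m = const q)"

lemma const_coeffs_add: "const_coeffs f \<Longrightarrow> const_coeffs g \<Longrightarrow> const_coeffs (f + g)"
  unfolding const_coeffs_def lookup_add by (metis const_add)

lemma const_coeffs_0: "const_coeffs 0"
  unfolding const_coeffs_def by (metis const_0 lookup_zero)

lemma const_coeffs_sum: "(\<And>a. a \<in> A \<Longrightarrow> const_coeffs (f a)) \<Longrightarrow> const_coeffs (\<Sum>a\<in>A. f a)"
  by (induction A rule: infinite_finite_induct) (auto intro: const_coeffs_add const_coeffs_0)

lemma const_coeffs_single: "const_coeffs (single m (const q))"
  unfolding const_coeffs_def lookup_single when_def by (metis const_0)

lemma const_of_int: "const (of_int z * q) = (of_int z * const q :: dpol)"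
  by (metis const_mult const_def single_of_int)

lemma const_coeffs_mderiv: "const_coeffs f \<Longrightarrow> const_coeffs (mderiv f)"
  unfolding mderiv_def lterm_def
proof (intro const_coeffs_sum)
  fix m v assume "const_coeffs f"
  then obtain q where "lookup f m = const q" by (auto simp: const_coeffs_def)
  then show "const_coeffs (single (m - single v 1 + single (u_next v) 1) (of_int (lookup m v) * lookup f m))"
    by (metis const_of_int const_coeffs_single)
qed

section \<open>Leibniz's formula and the supports of the derivatives\<close>

definition mpow :: "(nat \<Rightarrow> nat \<Rightarrow> (uvar \<Rightarrow>\<^sub>0 int)) \<Rightarrow> nat \<Rightarrow> nat \<Rightarrow> nat \<Rightarrow> dlpol" where
  "mpow M i m j = (mderiv ^^ j) (single (M i m) 1)"

definition mcoeff :: "(nat \<Rightarrow> nat \<Rightarrow> (uvar \<Rightarrow>\<^sub>0 int)) \<Rightarrow> nat \<Rightarrow> nat \<Rightarrow> nat \<Rightarrow> (uvar \<Rightarrow>\<^sub>0 int) \<Rightarrow> rat" where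
  "mcoeff M i m j \<mu> = (SOME q. lookup (mpow M i m j) \<mu> = const q)"

lemma const_coeffs_mpow: "const_coeffs (mpow M i m j)"
proof (induction j)
  case 0
  show ?case using const_coeffs_single[of "M i m" 1] by (simp add: mpow_def)
qed (auto simp: mpow_def intro: const_coeffs_mderiv)

lemma lookup_mpow: "lookup (mpow M i m j) \<mu> = const (mcoeff M i m j \<mu>)"
  using const_coeffs_mpow[of M i m j] unfolding const_coeffs_def mcoeff_def by (metis (mono_tags) someI_ex)

lemma const_inject: "const a = const b \<longleftrightarrow> a = b"
  by (metis const_def lookup_single_eq)

lemma mcoeff_0: "mcoeff M i m 0 \<mu> = (if \<mu> = M i m then 1 else 0)"
proof -
  have "const (mcoeff M i m 0 \<mu>) = (const (if \<mu> = M i m then 1 else 0) :: dpol)"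
    unfolding lookup_mpow[symmetric] by (auto simp: mpow_def lookup_single when_def)
  then show ?thesis by (simp only: const_inject)
qed

lemma cderiv_mpow [simp]: "cderiv (mpow M i m j) = 0"
  by (intro poly_mapping_eqI) (simp add: lookup_cderiv lookup_mpow)

definition der_F :: "(nat \<Rightarrow> nat) \<Rightarrow> (nat \<Rightarrow> nat \<Rightarrow> (uvar \<Rightarrow>\<^sub>0 int)) \<Rightarrow> nat \<Rightarrow> nat \<Rightarrow> dlpol" where
  "der_F l M i k = (lderiv ^^ k) (gen_F l M i)"

lemma lderiv_pvar_mpow:
  "lderiv (const (pvar (i', m', d)) * mpow M i m j)
    = const (pvar (i', m', Suc d)) * mpow M i m j + const (pvar (i', m', d)) * mpow M i m (Suc j)"
proof -
  have "cderiv (const p) = const (dderiv p)" "mderiv (const p) = 0" for p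
    by (simp_all add: const_def cderiv_single mderiv_single lterm_def)
  then show ?thesis
    by (simp add: lderiv_eq cderiv_mult mderiv_mult) (simp add: mpow_def)
qed

lemma lderiv_sum: "lderiv (\<Sum>a\<in>A. f a) = (\<Sum>a\<in>A. lderiv (f a))"
  by (induction A rule: infinite_finite_induct) (auto simp: lderiv_add)

lemma lderiv_of_nat_mult: "lderiv (of_nat k * f) = of_nat k * lderiv f"
  by (induction k) (auto simp: lderiv_add algebra_simps)

text \<open>Pascal's rule in the form in which differentiating a Leibniz sum needs it: x a j stands
  for the product of the a-th derivative of one factor and the j-th derivative of the other.\<close>

lemma sum_Pascal:
  fixes x :: "nat \<Rightarrow> nat \<Rightarrow> 'a::comm_ring_1"
  shows "(\<Sum>j\<le>k. of_nat (k choose j) * (x (Suc (k - j)) j + x (k - j) (Suc j)))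
    = (\<Sum>j\<le>Suc k. of_nat (Suc k choose j) * x (Suc k - j) j)"
proof -
  have "(\<Sum>j\<le>Suc k. of_nat (Suc k choose j) * x (Suc k - j) j)
      = x (Suc k) 0 + (\<Sum>j\<le>k. (of_nat (k choose j) + of_nat (k choose Suc j)) * x (k - j) (Suc j))"
    by (subst sum.atMost_Suc_shift) simp
  also have "\<dots> = (\<Sum>j\<le>k. of_nat (k choose j) * x (k - j) (Suc j))
      + (x (Suc k) 0 + (\<Sum>j\<le>k. of_nat (k choose Suc j) * x (k - j) (Suc j)))"
    by (simp add: distrib_right sum.distrib)
  also have "x (Suc k) 0 + (\<Sum>j\<le>k. of_nat (k choose Suc j) * x (k - j) (Suc j))
      = (\<Sum>j\<le>Suc k. of_nat (k choose j) * x (Suc k - j) j)"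
    by (subst sum.atMost_Suc_shift) simp
  also have "\<dots> = (\<Sum>j\<le>k. of_nat (k choose j) * x (Suc (k - j)) j)"
    by (simp add: Suc_diff_le binomial_eq_0)
  finally show ?thesis by (simp add: distrib_left sum.distrib add.commute)
qed

lemma der_F_eq:
  "der_F l M i k = (\<Sum>m\<le>l i. \<Sum>j\<le>k. of_nat (k choose j) * (const (pvar (i, m, k - j)) * mpow M i m j))"
proof (induction k)
  case 0
  show ?case by (simp add: der_F_def gen_F_def mpow_def const_def mult_single)
next
  case (Suc k)
  have "der_F l M i (Suc k) = lderiv (der_F l M i k)" by (simp add: der_F_def)
  also have "\<dots> = (\<Sum>m\<le>l i. \<Sum>j\<le>k. of_nat (k choose j)
      * (const (pvar (i, m, Suc (k - j))) * mpow M i m j + const (pvar (i, m, k - j)) * mpow M i m (Suc j)))"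
    by (simp only: Suc lderiv_sum lderiv_of_nat_mult lderiv_pvar_mpow)
  also have "\<dots> = (\<Sum>m\<le>l i. \<Sum>j\<le>Suc k. of_nat (Suc k choose j) * (const (pvar (i, m, Suc k - j)) * mpow M i m j))"
    by (rule sum.cong[OF refl]) (rule sum_Pascal[where x = "\<lambda>a j. const (pvar (i, _, a)) * mpow M i _ j"])
  finally show ?case .
qed

lemma lookup_const_mult: "lookup (const c * f) m = c * lookup f m"
  for f :: "'m::comm_monoid_add \<Rightarrow>\<^sub>0 'a::comm_semiring_1"
proof (induction f rule: poly_mapping_single_induct)
  case (single m' c')
  show ?case by (auto simp: const_def mult_single lookup_single when_def)
qed (simp_all add: distrib_left lookup_add)

lemma lookup_der_F:
  "lookup (der_F l M i k) \<mu>
    = (\<Sum>m\<le>l i. \<Sum>j\<le>k. single (single (i, m, k - j) 1) (of_nat (k choose j) * mcoeff M i m j \<mu>))"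
proof -
  have "lookup (of_nat (k choose j) * (const (pvar (i, m, k - j)) * mpow M i m j)) \<mu>
      = single (single (i, m, k - j) 1) (of_nat (k choose j) * mcoeff M i m j \<mu>)" for m j
  proof -
    have nat: "(of_nat a :: dlpol) = const (of_nat a)" "(of_nat a :: dpol) = const (of_nat a)" for a
      by (simp_all add: const_def)
    show ?thesis
      by (simp only: nat lookup_const_mult lookup_mpow)
        (simp only: const_def pvar_def mult_single add_0_left add_0_right mult_1_left)
  qed
  then show ?thesis by (simp add: der_F_eq lookup_sum)
qed

lemma lookup_lookup_der_F:
  assumes "m \<le> l i" "j \<le> k"
  shows "lookup (lookup (der_F l M i k) \<mu>) (single (i, m, k - j) 1) = of_nat (k choose j) * mcoeff M i m j \<mu>"
proof -
  have inj: "single a (1::nat) = single b 1 \<longleftrightarrow> a = b" for a b :: avar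
    by (metis lookup_single_eq lookup_single_not_eq zero_neq_one)
  have "lookup (lookup (der_F l M i k) \<mu>) (single (i, m, k - j) 1)
      = (\<Sum>m'\<le>l i. \<Sum>j'\<le>k. of_nat (k choose j') * mcoeff M i m' j' \<mu> when single (i, m', k - j') (1::nat) = single (i, m, k - j) 1)"
    by (simp add: lookup_der_F lookup_sum lookup_single)
  also have "\<dots> = (\<Sum>m'\<le>l i. \<Sum>j'\<le>k. if j' = j then (if m' = m then of_nat (k choose j) * mcoeff M i m j \<mu> else 0) else 0)"
    using assms by (intro sum.cong refl) (auto simp: inj[simplified] when_def)
  also have "\<dots> = of_nat (k choose j) * mcoeff M i m j \<mu>"
    using assms by (simp add: sum.delta)
  finally show ?thesis .
qed

text \<open>Different pairs (m, j) contribute to different indeterminates (i, m, k - j), so nothing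
  cancels. This is why the supports of successive derivatives are nested.\<close>

lemma keys_der_F_iff: "\<mu> \<in> keys (der_F l M i k) \<longleftrightarrow> (\<exists>m\<le>l i. \<exists>j\<le>k. mcoeff M i m j \<mu> \<noteq> 0)"
proof
  assume "\<exists>m\<le>l i. \<exists>j\<le>k. mcoeff M i m j \<mu> \<noteq> 0"
  then obtain m j where "m \<le> l i" "j \<le> k" "mcoeff M i m j \<mu> \<noteq> 0" by blast
  then have "lookup (lookup (der_F l M i k) \<mu>) (single (i, m, k - j) 1) \<noteq> 0"
    using lookup_lookup_der_F[of m l i j k M \<mu>] by simp
  then show "\<mu> \<in> keys (der_F l M i k)" by (auto simp: in_keys_iff)
next
  assume "\<mu> \<in> keys (der_F l M i k)"
  then have "lookup (der_F l M i k) \<mu> \<noteq> 0" by (simp add: in_keys_iff)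
  then show "\<exists>m\<le>l i. \<exists>j\<le>k. mcoeff M i m j \<mu> \<noteq> 0"
    unfolding lookup_der_F by (metis (no_types, lifting) atMost_iff mult_zero_right single_zero sum.neutral)
qed

lemma keys_der_F_mono: "k \<le> k' \<Longrightarrow> keys (der_F l M i k) \<subseteq> keys (der_F l M i k')"
  by (auto simp: keys_der_F_iff) (meson order_trans)

lemma occurring_sum_subset: "(\<And>a. a \<in> A \<Longrightarrow> occurring (f a) \<subseteq> X) \<Longrightarrow> occurring (\<Sum>a\<in>A. f a) \<subseteq> X"
  using occurring_sum[of f A] by blast

lemma occurring_lookup_der_F:
  "occurring (lookup (der_F l M i k) \<mu>) \<subseteq> {(i, m, k - j) | m j. m \<le> l i \<and> j \<le> k \<and> mcoeff M i m j \<mu> \<noteq> 0}"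
proof -
  have *: "occurring (single (single (i, m, k - j) 1) (of_nat (k choose j) * mcoeff M i m j \<mu>))
      \<subseteq> {(i, m, k - j) | m j. m \<le> l i \<and> j \<le> k \<and> mcoeff M i m j \<mu> \<noteq> 0}" if "m \<le> l i" "j \<le> k" for m j
    using that by (auto simp: occurring_def split: if_splits)
  show ?thesis
    unfolding lookup_der_F by (intro occurring_sum_subset *) auto
qed

definition rest_F :: "(nat \<Rightarrow> nat) \<Rightarrow> (nat \<Rightarrow> nat \<Rightarrow> (uvar \<Rightarrow>\<^sub>0 int)) \<Rightarrow> nat \<Rightarrow> nat \<Rightarrow> dlpol" where
  "rest_F l M i k = der_F l M i k - single (M i 0) (pvar (i, 0, k))"

lemma der_F_split: "der_F l M i k = single (M i 0) (pvar (i, 0, k)) + rest_F l M i k"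
  by (simp add: rest_F_def)

text \<open>In Leibniz's formula (i, 0, k) multiplies the underived monomial \<open>M i 0\<close>
  only, and exactly this term has been removed. Hence the equation can be solved for (i, 0,
  k).\<close>

lemma occurring_rest_F: "occurring (lookup (rest_F l M i k) \<mu>) \<subseteq> {(i, m, d) | m d. m \<le> l i \<and> d \<le> k} - {(i, 0, k)}"
proof -
  have sub: "occurring (lookup (rest_F l M i k) \<mu>) \<subseteq> {(i, m, d) | m d. m \<le> l i \<and> d \<le> k}"
  proof -
    have "occurring (lookup (single (M i 0) (pvar (i, 0, k) :: dpol)) \<mu>) \<subseteq> {(i, 0, k)}"
      by (auto simp: lookup_single when_def)
    then show ?thesis
      using occurring_diff[of "lookup (der_F l M i k) \<mu>" "lookup (single (M i 0) (pvar (i, 0, k))) \<mu>"]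
        occurring_lookup_der_F[of l M i k \<mu>]
      unfolding rest_F_def lookup_minus by fastforce
  qed
  have zero: "lookup (lookup (rest_F l M i k) \<mu>) (single (i, 0, k) 1) = 0"
    using lookup_lookup_der_F[of 0 l i 0 k M \<mu>]
    by (auto simp: rest_F_def lookup_minus mcoeff_0 lookup_single when_def pvar_def)
  \<comment> \<open>All coefficients are linear forms, so an indeterminate is absent as soon as its
    own monomial is.\<close>
  have form: "m = single v 1" if "m \<in> keys (lookup (rest_F l M i k) \<mu>)" "v \<in> keys m" for m v
  proof -
    have "keys (lookup (rest_F l M i k) \<mu>) \<subseteq> range (\<lambda>v. single v 1)"
    proof -
      have 1: "keys (lookup (der_F l M i k) \<mu>) \<subseteq> range (\<lambda>v. single v 1)"
      proof -
        have "keys (\<Sum>j\<le>k. single (single (i, m, k - j) (1::nat)) (of_nat (k choose j) * mcoeff M i m j \<mu>)) \<subseteq> range (\<lambda>v. single v 1)" for m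
          by (rule order_trans[OF keys_sum]) auto
        then show ?thesis
          unfolding lookup_der_F by (intro order_trans[OF keys_sum]) auto
      qed
      have "keys (a - b) \<subseteq> keys a \<union> keys b" for a b :: dpol
        by (auto simp: in_keys_iff lookup_minus)
      moreover have "keys (lookup (single (M i 0) (pvar (i, 0, k) :: dpol)) \<mu>) \<subseteq> range (\<lambda>v. single v 1)"
        by (auto simp: lookup_single when_def pvar_def)
      ultimately show ?thesis using 1 unfolding rest_F_def lookup_minus by blast
    qed
    then show ?thesis using that by (auto split: if_splits)
  qed
  have "(i, 0, k) \<notin> occurring (lookup (rest_F l M i k) \<mu>)"
  proof
    assume "(i, 0, k) \<in> occurring (lookup (rest_F l M i k) \<mu>)"
    then obtain m where m: "m \<in> keys (lookup (rest_F l M i k) \<mu>)" "(i, 0, k) \<in> keys m"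
      by (auto simp: occurring_def)
    show False using m(1) zero unfolding form[OF m] by (simp add: in_keys_iff)
  qed
  then show ?thesis using sub by auto
qed

section \<open>Solving for the coefficients of the distinguished monomials\<close>

lemma occurring_rest_FE:
  assumes "v \<in> occurring (lookup (rest_F l M i k) \<mu>)"
  obtains m d where "v = (i, m, d)" "m \<le> l i" "d \<le> k" "(m, d) \<noteq> (0, k)"
  using assms occurring_rest_F[of l M i k \<mu>] by blast

abbreviation cconst :: "rat \<Rightarrow> dlpol" where
  "cconst \<equiv> (\<lambda>q. const (const q))"

definition lsubst :: "(avar \<Rightarrow> dlpol) \<Rightarrow> dlpol \<Rightarrow> dlpol" where
  "lsubst T Q = (\<Sum>\<mu>\<in>keys Q. single \<mu> 1 * peval cconst T (lookup Q \<mu>))"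

lemma lsubst_cong:
  assumes "\<And>\<mu> v. v \<in> occurring (lookup Q \<mu>) \<Longrightarrow> T v = T' v"
  shows "lsubst T Q = lsubst T' Q"
  unfolding lsubst_def by (intro sum.cong arg_cong2[where f = "(*)"] peval_cong refl) (use assms in auto)

lemma ev_peval_cconst:
  assumes "\<And>v. u v \<noteq> 0"
  shows "ev x u (peval cconst T p) = peval of_rat (\<lambda>v. ev x u (T v)) p"
  by (rule peval_peval) (auto simp: assms ring_hom_ev ev_const)

lemma ev_lsubst:
  assumes u: "\<And>v. u v \<noteq> 0"
  shows "ev x u (lsubst T Q) = ev (\<lambda>v. ev x u (T v)) u Q"
  by (simp add: lsubst_def ev_sum[OF u] ev_mult[OF u] ev_single[OF u] ev_peval_cconst[OF u]
      ev_eq_sum[of _ u Q] mult.commute)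

lemma ev_cong:
  assumes "\<And>\<mu> v. v \<in> occurring (lookup Q \<mu>) \<Longrightarrow> x v = y v"
  shows "ev x u Q = ev y u Q"
  unfolding ev_eq_sum by (intro sum.cong arg_cong2[where f = "(*)"] peval_cong refl) (use assms in auto)

context
  fixes l :: "nat \<Rightarrow> nat" and M :: "nat \<Rightarrow> nat \<Rightarrow> (uvar \<Rightarrow>\<^sub>0 int)" and B :: "(nat \<times> nat) set"
begin

text \<open>Recursion on the order: the right-hand side for (i, 0, k) contains only pivots of order
  below k, which \<open>tau_step k\<close> has already solved for.\<close>

primrec tau_step :: "nat \<Rightarrow> avar \<Rightarrow> dlpol" where
  "tau_step 0 = (\<lambda>v. const (pvar v))"
| "tau_step (Suc k) = (\<lambda>v. case v of (i, m, d) \<Rightarrow>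
     if m = 0 \<and> d = k \<and> (i, k) \<in> B then - (single (- M i 0) 1 * lsubst (tau_step k) (rest_F l M i k))
     else tau_step k v)"

text \<open>The triangular substitution that solves each equation in \<open>B\<close> for its indeterminate \<open>(i, 0, k)\<close>.\<close>

definition tau :: "avar \<Rightarrow> dlpol" where
  "tau v = (case v of (i, m, d) \<Rightarrow> tau_step (Suc d) v)"

lemma tau_step_eq: "tau_step K (i, m, d) = (if d < K then tau (i, m, d) else const (pvar (i, m, d)))"
  by (induction K) (auto simp: tau_def less_Suc_eq)

lemma tau_free: "\<not> (m = 0 \<and> (i, d) \<in> B) \<Longrightarrow> tau (i, m, d) = const (pvar (i, m, d))"
  using tau_step_eq[of d i m d] by (auto simp: tau_def)

lemma tau_pivot:
  assumes "(i, k) \<in> B"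
  shows "tau (i, 0, k) = - (single (- M i 0) 1 * lsubst tau (rest_F l M i k))"
proof -
  have "lsubst (tau_step k) (rest_F l M i k) = lsubst tau (rest_F l M i k)"
  proof (rule lsubst_cong)
    fix \<mu> v assume "v \<in> occurring (lookup (rest_F l M i k) \<mu>)"
    then obtain m d where v: "v = (i, m, d)" "d \<le> k" "(m, d) \<noteq> (0, k)"
      by (rule occurring_rest_FE) auto
    then show "tau_step k v = tau v"
      using tau_free[of m i d] by (cases "d = k") (auto simp: tau_step_eq)
  qed
  then show ?thesis using assms by (simp add: tau_def)
qed

definition solved :: "(avar \<Rightarrow> complex) \<Rightarrow> (uvar \<Rightarrow> complex) \<Rightarrow> avar \<Rightarrow> complex" where
  "solved x u v = ev x u (tau v)"

context
  fixes u :: "uvar \<Rightarrow> complex"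
  assumes u: "\<And>v. u v \<noteq> 0"
begin

lemma ev_der_F: "ev x u (der_F l M i k) = lmev u (M i 0) * x (i, 0, k) + ev x u (rest_F l M i k)"
  by (simp add: der_F_split[of l M i k] ev_add[OF u] ev_single[OF u])

lemma solved_free: "\<not> (m = 0 \<and> (i, d) \<in> B) \<Longrightarrow> solved x u (i, m, d) = x (i, m, d)"
  by (simp add: solved_def tau_free ev_const[OF u])

lemma solved_pivot:
  assumes "(i, k) \<in> B"
  shows "solved x u (i, 0, k) = - (ev (solved x u) u (rest_F l M i k) / lmev u (M i 0))"
  by (simp add: solved_def[of x u "(i, 0, k)"] tau_pivot[OF assms] ev_uminus[OF u] ev_mult[OF u] ev_single[OF u]
      ev_lsubst[OF u] lmev_uminus[OF u] solved_def[abs_def] divide_inverse mult.commute)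

lemma solved_solves:
  assumes "(i, k) \<in> B"
  shows "ev (solved x u) u (der_F l M i k) = 0"
  using lmev_nonzero[of u "M i 0", OF u] by (simp add: ev_der_F solved_pivot[OF assms])

text \<open>Each pivot is determined by the free coordinates and pivots of lower order. Further
  equations can therefore be solved without disturbing a point at the orders where it satisfies them
  already.\<close>

lemma solved_unique:
  assumes "\<And>k. k \<le> K \<Longrightarrow> (i, k) \<in> B \<Longrightarrow> ev x u (der_F l M i k) = 0" "d \<le> K"
  shows "solved x u (i, m, d) = x (i, m, d)"
  using assms(2)
proof (induction d arbitrary: m rule: less_induct)
  case (less d)
  show ?case
  proof (cases "m = 0 \<and> (i, d) \<in> B")
    case True
    have "ev (solved x u) u (rest_F l M i d) = ev x u (rest_F l M i d)"
    proof (rule ev_cong)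
      fix \<mu> v assume "v \<in> occurring (lookup (rest_F l M i d) \<mu>)"
      then obtain m d' where v: "v = (i, m, d')" "d' \<le> d" "(m, d') \<noteq> (0, d)"
        by (rule occurring_rest_FE) auto
      then show "solved x u v = x v"
        using less solved_free[of m i d'] by (cases "d' = d") auto
    qed
    moreover have "lmev u (M i 0) * x (i, 0, d) + ev x u (rest_F l M i d) = 0"
      using assms(1)[of d] less.prems True by (simp add: ev_der_F)
    ultimately show ?thesis
      using True lmev_nonzero[of u "M i 0", OF u]
      by (simp add: solved_pivot field_simps add_eq_0_iff)
  qed (simp add: solved_free)
qed

end

end

section \<open>The elimination ideal\<close>

lemma D_ring_closed:
  "const q \<in> D_ring n l" "0 \<in> D_ring n l" "1 \<in> D_ring n l"
  "p \<in> D_ring n l \<Longrightarrow> q' \<in> D_ring n l \<Longrightarrow> p + q' \<in> D_ring n l"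
  "p \<in> D_ring n l \<Longrightarrow> q' \<in> D_ring n l \<Longrightarrow> p * q' \<in> D_ring n l"
  "p \<in> D_ring n l \<Longrightarrow> - p \<in> D_ring n l"
  "v \<in> A_derivs n l \<Longrightarrow> pvar v \<in> D_ring n l"
  using occurring_add[of p q'] occurring_mult[of p q'] by (auto simp: D_ring_def)

lemma D_ring_dderiv: "p \<in> D_ring n l \<Longrightarrow> dderiv p \<in> D_ring n l"
  using occurring_dderiv[of p] by (fastforce simp: D_ring_def A_derivs_def)

lemma D_ring_of_int: "of_int z \<in> D_ring n l"
  using D_ring_closed(1)[of "of_int z" n l] by (simp add: const_def)

lemma DU_ring_0: "0 \<in> DU_ring n l"
  by (simp add: DU_ring_def)

lemma DU_ring_single:
  assumes "keys m \<subseteq> {1..n-1} \<times> UNIV" "p \<in> D_ring n l"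
  shows "single m p \<in> DU_ring n l"
  using assms occurring_single[of m p] by (auto simp: DU_ring_def lookup_single when_def D_ring_closed)

lemma DU_ring_add: "f \<in> DU_ring n l \<Longrightarrow> g \<in> DU_ring n l \<Longrightarrow> f + g \<in> DU_ring n l"
proof -
  assume *: "f \<in> DU_ring n l" "g \<in> DU_ring n l"
  have "lookup h m \<in> D_ring n l" if "h \<in> DU_ring n l" for h m
    using that by (cases "m \<in> keys h") (auto simp: DU_ring_def in_keys_iff D_ring_closed)
  then show ?thesis
    using * occurring_add[of f g] by (auto simp: DU_ring_def lookup_add intro!: D_ring_closed)
qed

lemma DU_ring_sum: "(\<And>a. a \<in> A \<Longrightarrow> f a \<in> DU_ring n l) \<Longrightarrow> (\<Sum>a\<in>A. f a) \<in> DU_ring n l"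
  by (induction A rule: infinite_finite_induct) (auto intro: DU_ring_add DU_ring_0)

lemma DU_ringD:
  assumes "f \<in> DU_ring n l" "m \<in> keys f"
  shows "keys m \<subseteq> {1..n-1} \<times> UNIV" "lookup f m \<in> D_ring n l"
  using assms by (auto simp: DU_ring_def occurring_def)

lemma DU_ring_mult:
  assumes "f \<in> DU_ring n l" "g \<in> DU_ring n l"
  shows "f * g \<in> DU_ring n l"
proof -
  have "f * g = (\<Sum>m\<in>keys f. single m (lookup f m)) * (\<Sum>m\<in>keys g. single m (lookup g m))"
    by (simp add: sum_single_keys)
  also have "\<dots> = (\<Sum>m\<in>keys f. \<Sum>m'\<in>keys g. single (m + m') (lookup f m * lookup g m'))"
    by (simp add: sum_product mult_single)
  also have "\<dots> \<in> DU_ring n l"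
  proof (intro DU_ring_sum DU_ring_single D_ring_closed)
    fix m m' assume "m \<in> keys f" "m' \<in> keys g"
    then show "keys (m + m') \<subseteq> {1..n-1} \<times> UNIV"
      using DU_ringD(1)[OF assms(1), of m] DU_ringD(1)[OF assms(2), of m'] keys_add[of m m'] by blast
  qed (use DU_ringD[OF assms(1)] DU_ringD[OF assms(2)] in auto)
  finally show ?thesis .
qed

lemma DU_ring_uminus: "f \<in> DU_ring n l \<Longrightarrow> - f \<in> DU_ring n l"
  by (auto simp: DU_ring_def intro: D_ring_closed)

lemma DU_ring_const: "p \<in> D_ring n l \<Longrightarrow> const p \<in> DU_ring n l"
  unfolding const_def by (rule DU_ring_single) auto

lemma DU_ring_lderiv:
  assumes "f \<in> DU_ring n l"
  shows "lderiv f \<in> DU_ring n l"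
  unfolding lderiv_def
proof (intro DU_ring_sum DU_ring_add DU_ring_single)
  fix m v assume m: "m \<in> keys f" and v: "v \<in> keys m"
  have *: "keys (m - single v 1 + single (u_next v) 1) \<subseteq> keys m \<union> {v, u_next v}"
    by (auto simp: in_keys_iff lookup_add lookup_minus lookup_single when_def split: if_splits)
  have "v \<in> {1..n-1} \<times> UNIV" using DU_ringD(1)[OF assms m] v by (rule subsetD)
  moreover from this have "u_next v \<in> {1..n-1} \<times> UNIV" by (cases v) auto
  ultimately have "keys m \<union> {v, u_next v} \<subseteq> {1..n-1} \<times> UNIV"
    using DU_ringD(1)[OF assms m] by (simp only: Un_subset_iff insert_subset empty_subsetI)
  with * show "keys (m - single v 1 + single (u_next v) 1) \<subseteq> {1..n-1} \<times> UNIV"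
    by (rule order_trans)
qed (use DU_ringD[OF assms] in \<open>auto intro!: D_ring_closed D_ring_dderiv D_ring_of_int\<close>)

lemma lderiv_pow_add: "(lderiv ^^ j) (f + g) = (lderiv ^^ j) f + (lderiv ^^ j) g"
  by (induction j) (auto simp: lderiv_add)

lemma lderiv_pow_0 [simp]: "(lderiv ^^ j) 0 = 0"
  by (induction j) auto

lemma ev_lderiv_pow_mult:
  assumes u: "\<And>v. u v \<noteq> 0" and "\<And>j. ev x u ((lderiv ^^ j) f) = 0"
  shows "ev x u ((lderiv ^^ j) (g * f)) = 0"
  using assms(2)
proof (induction j arbitrary: f g)
  case 0
  then show ?case using "0"[of 0] by (simp add: ev_mult[OF u])
next
  case (Suc j)
  have "ev x u ((lderiv ^^ i) (lderiv f)) = 0" for i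
    using Suc.prems[of "Suc i"] by (simp add: funpow_swap1)
  then show ?case
    using Suc.IH[of f "lderiv g"] Suc.IH[of "lderiv f" g] Suc.prems
    by (simp add: funpow_Suc_right lderiv_mult lderiv_pow_add ev_add[OF u] del: funpow.simps)
qed

locale sparse_system =
  fixes n :: nat and l :: "nat \<Rightarrow> nat" and M :: "nat \<Rightarrow> nat \<Rightarrow> (uvar \<Rightarrow>\<^sub>0 int)"
  assumes gen: "generic_system n l M"
begin

abbreviation F :: "nat \<times> nat \<Rightarrow> dlpol" where
  "F e \<equiv> der_F l M (fst e) (snd e)"

lemma keys_M: "i \<in> {1..n} \<Longrightarrow> k \<le> l i \<Longrightarrow> keys (M i k) \<subseteq> {1..n-1} \<times> UNIV"
  using gen unfolding generic_system_def by blast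

lemma gen_F_in_DU_ring: "i \<in> {1..n} \<Longrightarrow> gen_F l M i \<in> DU_ring n l"
  unfolding gen_F_def
  by (rule DU_ring_sum, rule DU_ring_single, rule keys_M) (auto intro!: D_ring_closed simp: A_derivs_def)

lemma der_F_in_DU_ring: "i \<in> {1..n} \<Longrightarrow> der_F l M i k \<in> DU_ring n l"
  unfolding der_F_def by (induction k) (auto intro: DU_ring_lderiv gen_F_in_DU_ring)

lemma rest_F_in_DU_ring: "i \<in> {1..n} \<Longrightarrow> rest_F l M i k \<in> DU_ring n l"
  unfolding rest_F_def diff_conv_add_uminus
  by (rule DU_ring_add, erule der_F_in_DU_ring, rule DU_ring_uminus, rule DU_ring_single, rule keys_M)
    (auto intro!: D_ring_closed simp: A_derivs_def)

text \<open>The Laurent polynomials all of whose derivatives vanish at the point form a differential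
  ideal. It contains the generators, hence the ideal that they generate.\<close>

lemma elimination_ideal_vanishes:
  assumes u: "\<And>v. u v \<noteq> 0" and f: "f \<in> elimination_ideal n l M"
    and x: "\<And>i k. i \<in> {1..n} \<Longrightarrow> ev x u (der_F l M i k) = 0"
  shows "peval of_rat x f = 0"
proof -
  let ?I = "{Q \<in> DU_ring n l. \<forall>j. ev x u ((lderiv ^^ j) Q) = 0}"
  have "diff_ideal n l ?I"
    unfolding diff_ideal_def
  proof (intro conjI ballI)
    fix f g assume "f \<in> ?I" "g \<in> ?I"
    then show "f + g \<in> ?I" by (auto simp: lderiv_pow_add ev_add[OF u] DU_ring_add)
  next
    fix f g assume "f \<in> ?I" "g \<in> DU_ring n l"
    then show "g * f \<in> ?I" using ev_lderiv_pow_mult[OF u] by (auto simp: DU_ring_mult)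
  next
    fix f assume f: "f \<in> ?I"
    have "ev x u ((lderiv ^^ j) (lderiv f)) = 0" for j
      using f by (auto simp: funpow_swap1 simp flip: funpow.simps(2)[unfolded comp_def] dest: spec[of _ "Suc j"])
    then show "lderiv f \<in> ?I" using f by (auto simp: DU_ring_lderiv)
  qed (auto simp: DU_ring_0 ev_def)
  moreover have "gen_F l M ` {1..n} \<subseteq> ?I"
    using x by (auto simp: gen_F_in_DU_ring der_F_def)
  ultimately have "diff_ideal_P n l M \<subseteq> ?I" by (auto simp: diff_ideal_P_def)
  then have "ev x u ((lderiv ^^ 0) (const f)) = 0"
    using f unfolding elimination_ideal_def by blast
  then show ?thesis by (simp add: ev_const[OF u])
qed

section \<open>From vanishing at complex points to membership in the ideal\<close>

context
  fixes I :: "dlpol set" and B :: "(nat \<times> nat) set"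
  assumes I: "diff_ideal n l I" "gen_F l M ` {1..n} \<subseteq> I" and B: "B \<subseteq> {1..n} \<times> UNIV"
begin

lemma I_closed:
  "0 \<in> I" "f \<in> I \<Longrightarrow> g \<in> I \<Longrightarrow> f + g \<in> I" "f \<in> I \<Longrightarrow> g \<in> DU_ring n l \<Longrightarrow> g * f \<in> I"
  "f \<in> I \<Longrightarrow> lderiv f \<in> I" "f \<in> I \<Longrightarrow> - f \<in> I" "f \<in> I \<Longrightarrow> f \<in> DU_ring n l"
proof -
  show "- f \<in> I" if "f \<in> I"
  proof -
    have "const (- 1) * f \<in> I"
      using I(1) that by (auto simp: diff_ideal_def intro!: DU_ring_const D_ring_closed)
    then show ?thesis by (simp add: const_def single_uminus)
  qed
qed (use I in \<open>auto simp: diff_ideal_def\<close>)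

lemma der_F_in_I: "i \<in> {1..n} \<Longrightarrow> der_F l M i k \<in> I"
  unfolding der_F_def by (induction k) (use I in \<open>auto intro: I_closed\<close>)

lemma I_sum: "(\<And>a. a \<in> A \<Longrightarrow> f a \<in> I) \<Longrightarrow> (\<Sum>a\<in>A. f a) \<in> I"
  by (induction A rule: infinite_finite_induct) (auto intro: I_closed)

lemma subst_mod_I:
  assumes "\<And>v. v \<in> occurring p \<Longrightarrow> const (pvar v) - T v \<in> I \<and> T v \<in> DU_ring n l"
    and "occurring p \<subseteq> A_derivs n l"
  shows "const p - peval cconst T p \<in> I \<and> peval cconst T p \<in> DU_ring n l \<and> p \<in> D_ring n l"
proof -
  have "const q - peval cconst T q \<in> I \<and> peval cconst T q \<in> DU_ring n l \<and> q \<in> D_ring n l"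
    if "occurring q \<subseteq> occurring p" for q
    using that
  proof (induction q rule: mpol_induct_occurring)
    case (const c)
    then show ?case using I_closed by (simp add: DU_ring_const D_ring_closed)
  next
    case (pvar v)
    then show ?case using assms by (auto intro: D_ring_closed)
  next
    case (add q1 q2)
    have eq: "const (q1 + q2) - peval cconst T (q1 + q2)
        = (const q1 - peval cconst T q1) + (const q2 - peval cconst T q2)"
      by (simp add: const_add peval_add)
    show ?case
      unfolding eq using add by (auto simp: peval_add intro!: I_closed(2) DU_ring_add D_ring_closed)
  next
    case (mult q1 q2)
    have eq: "const (q1 * q2) - peval cconst T (q1 * q2)
        = const q2 * (const q1 - peval cconst T q1) + peval cconst T q1 * (const q2 - peval cconst T q2)"
      by (simp add: const_mult peval_mult algebra_simps)
    show ?case unfolding eq using mult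
      by (auto simp: peval_mult intro!: I_closed(2,3) DU_ring_mult D_ring_closed DU_ring_const)
  qed
  then show ?thesis by auto
qed

text \<open>Multiplied by the inverse of \<open>M i 0\<close>, the equation says that its pivot is
  congruent to the expression assigned by \<open>tau\<close>; the pivots in that expression have
  lower order.\<close>

lemma tau_mod_I: "(i, m, d) \<in> A_derivs n l \<Longrightarrow>
    const (pvar (i, m, d)) - tau l M B (i, m, d) \<in> I \<and> tau l M B (i, m, d) \<in> DU_ring n l"
proof (induction d arbitrary: m rule: less_induct)
  case (less d)
  show ?case
  proof (cases "m = 0 \<and> (i, d) \<in> B")
    case False
    then have "tau l M B (i, m, d) = const (pvar (i, m, d))" by (rule tau_free)
    then show ?thesis using less.prems by (auto intro: I_closed DU_ring_const D_ring_closed)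
  next
    case True
    let ?T = "tau l M B" and ?Q = "rest_F l M i d" and ?S = "single (- M i 0) (1 :: dpol)"
    have i: "i \<in> {1..n}" using less.prems by (auto simp: A_derivs_def)
    have key: "const (lookup ?Q \<mu>) - peval cconst ?T (lookup ?Q \<mu>) \<in> I
        \<and> peval cconst ?T (lookup ?Q \<mu>) \<in> DU_ring n l \<and> lookup ?Q \<mu> \<in> D_ring n l" for \<mu>
    proof (rule subst_mod_I)
      show "occurring (lookup ?Q \<mu>) \<subseteq> A_derivs n l"
        using occurring_rest_F[of l M i d \<mu>] i by (fastforce simp: A_derivs_def)
      fix v assume "v \<in> occurring (lookup ?Q \<mu>)"
      then obtain m' d' where v: "v = (i, m', d')" "d' \<le> d" "m' \<le> l i" "(m', d') \<noteq> (0, d)"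
        by (rule occurring_rest_FE) auto
      then have mem: "v \<in> A_derivs n l" using i by (auto simp: A_derivs_def)
      show "const (pvar v) - ?T v \<in> I \<and> ?T v \<in> DU_ring n l"
      proof (cases "d' = d")
        case True
        then have "?T v = const (pvar v)" using v by (auto intro!: tau_free)
        then show ?thesis using mem by (auto intro: I_closed DU_ring_const D_ring_closed)
      qed (use less.IH[of d' m'] v mem in auto)
    qed
    have mon: "single \<mu> 1 \<in> DU_ring n l" if "\<mu> \<in> keys ?Q" for \<mu>
      using DU_ringD(1)[OF rest_F_in_DU_ring[OF i] that] by (intro DU_ring_single D_ring_closed)
    have S: "?S \<in> DU_ring n l"
      using keys_M[OF i, of 0] by (intro DU_ring_single D_ring_closed) (auto simp: in_keys_iff)
    have sub: "lsubst ?T ?Q \<in> DU_ring n l"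
      unfolding lsubst_def by (intro DU_ring_sum DU_ring_mult mon) (use key in auto)
    have Q: "?Q = (\<Sum>\<mu>\<in>keys ?Q. single \<mu> 1 * const (lookup ?Q \<mu>))"
      by (simp add: const_def mult_single sum_single_keys)
    have "?Q - lsubst ?T ?Q = (\<Sum>\<mu>\<in>keys ?Q. single \<mu> 1 * (const (lookup ?Q \<mu>) - peval cconst ?T (lookup ?Q \<mu>)))"
      by (subst Q) (simp add: lsubst_def right_diff_distrib sum_subtractf)
    then have diff: "?Q - lsubst ?T ?Q \<in> I"
      using key mon by (auto intro!: I_sum I_closed(3))
    have tau: "?T (i, 0, d) = - (?S * lsubst ?T ?Q)"
      using True by (simp add: tau_pivot)
    have "?S * der_F l M i d = const (pvar (i, 0, d)) + ?S * ?Q"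
      by (simp add: der_F_split distrib_left mult_single const_def)
    then have "const (pvar (i, 0, d)) - ?T (i, 0, d) = ?S * der_F l M i d + - (?S * (?Q - lsubst ?T ?Q))"
      by (simp add: tau algebra_simps)
    moreover have "\<dots> \<in> I"
      using S diff der_F_in_I[OF i] by (intro I_closed(2,3,5))
    ultimately show ?thesis
      using True S sub by (auto simp: tau intro!: DU_ring_uminus DU_ring_mult)
  qed
qed

text \<open>Modulo I, f is congruent to its image under \<open>tau\<close>. The image vanishes at
  every point of the torus for all values of the free coordinates, so it is 0.\<close>

lemma vanishing_in_I:
  assumes f: "f \<in> D_ring n l"
    and van: "\<And>x u. (\<And>v. u v \<noteq> 0) \<Longrightarrow> (\<And>e. e \<in> B \<Longrightarrow> ev x u (F e) = 0) \<Longrightarrow> peval of_rat x f = 0"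
  shows "const f \<in> I"
proof -
  let ?Q = "peval cconst (tau l M B) f"
  have "?Q = 0"
  proof (rule ccontr)
    assume "?Q \<noteq> 0"
    then obtain x u where xu: "\<And>v. u v \<noteq> 0" "ev x u ?Q \<noteq> 0"
      using ex_nonroot_Laurent by metis
    have "ev x u ?Q = peval of_rat (solved l M B x u) f"
      by (simp add: ev_peval_cconst[OF xu(1)] solved_def[abs_def])
    moreover have "\<dots> = 0"
      by (rule van[OF xu(1)]) (auto intro!: solved_solves[OF xu(1)])
    ultimately show False using xu by simp
  qed
  moreover have "const f - ?Q \<in> I"
    using subst_mod_I[of f "tau l M B"] tau_mod_I f by (fastforce simp: D_ring_def)
  ultimately show ?thesis by simp
qed

end

lemma vanishing_in_elimination_ideal:
  assumes "f \<in> D_ring n l" "B \<subseteq> {1..n} \<times> UNIV"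
    and "\<And>x u. (\<And>v. u v \<noteq> 0) \<Longrightarrow> (\<And>e. e \<in> B \<Longrightarrow> ev x u (F e) = 0) \<Longrightarrow> peval of_rat x f = 0"
  shows "f \<in> elimination_ideal n l M"
proof -
  have "const f \<in> I" if "diff_ideal n l I" "gen_F l M ` {1..n} \<subseteq> I" for I
    by (rule vanishing_in_I[OF that assms(2,1,3)])
  then show ?thesis using assms(1) by (auto simp: elimination_ideal_def diff_ideal_P_def)
qed

end

section \<open>Partial derivatives\<close>

definition pd :: "'v \<Rightarrow> ('v, 'a::comm_ring_1) mpol \<Rightarrow> ('v, 'a) mpol" where
  "pd v p = (\<Sum>m\<in>keys p. single (m - single v 1) (of_nat (lookup m v) * lookup p m))"

lemma pd_0 [simp]: "pd v 0 = 0"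
  by (simp add: pd_def)

lemma pd_add: "pd v (p + q) = pd v p + pd v q"
  unfolding pd_def
  by (rule linear_extension_add[where T = "\<lambda>m c. single (m - single v 1) (of_nat (lookup m v) * c)"])
    (auto simp: distrib_left single_add)

lemma pd_single: "pd v (single m c) = single (m - single v 1) (of_nat (lookup m v) * c)"
  by (cases "c = 0") (auto simp: pd_def)

lemma pd_mult: "pd v (p * q) = pd v p * q + p * pd v q"
proof (induction p rule: poly_mapping_single_induct)
  case (single m c)
  show ?case
  proof (induction q rule: poly_mapping_single_induct)
    case (single m' c')
    have 1: "single (m - single v 1) (of_nat (lookup m v) * c) * single m' c'
        = single (m + m' - single v 1) (of_nat (lookup m v) * (c * c'))"
    proof (cases "v \<in> keys m")
      case True
      then show ?thesis using minus_single_add(1)[OF True, of 0 m'] by (simp add: mult_single mult.assoc)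
    qed (simp add: in_keys_iff)
    have 2: "single m c * single (m' - single v 1) (of_nat (lookup m' v) * c')
        = single (m + m' - single v 1) (of_nat (lookup m' v) * (c * c'))"
    proof (cases "v \<in> keys m'")
      case True
      then show ?thesis using minus_single_add(2)[OF True, of m 0] by (simp add: mult_single mult.left_commute)
    qed (simp add: in_keys_iff)
    show ?case
      unfolding pd_single 1 2 by (simp add: mult_single pd_single lookup_add distrib_right single_add)
  qed (simp_all add: pd_add distrib_left)
qed (simp_all add: pd_add distrib_right)

lemma pd_const [simp]: "pd v (const c) = 0"
  by (simp add: const_def pd_single)

lemma pd_pvar: "pd v (pvar w) = (if v = w then 1 else 0)"
  by (simp add: pvar_def pd_single lookup_single when_def)

lemma keys_pd: "keys (pd v p) \<subseteq> (\<lambda>m. m - single v 1) ` {m \<in> keys p. v \<in> keys m}"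
proof -
  have "keys (single (m - single v 1) (of_nat (lookup m v) * lookup p m))
      \<subseteq> (\<lambda>m. m - single v 1) ` {m \<in> keys p. v \<in> keys m}" if "m \<in> keys p" for m
  proof (cases "v \<in> keys m")
    case True
    then have "m - single v 1 \<in> (\<lambda>m. m - single v 1) ` {m \<in> keys p. v \<in> keys m}" using that by blast
    then show ?thesis by simp
  qed (simp add: in_keys_iff)
  then show ?thesis unfolding pd_def by (intro order_trans[OF keys_sum] UN_least)
qed

lemma occurring_pd: "occurring (pd v p) \<subseteq> occurring p"
proof
  fix w assume "w \<in> occurring (pd v p)"
  then obtain m where "m \<in> keys (pd v p)" "w \<in> keys m" by (auto simp: occurring_def)
  then obtain m' where "m' \<in> keys p" "w \<in> keys (m' - single v 1)" using keys_pd[of v p] by blast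
  then have "m' \<in> keys p" "w \<in> keys m'" by (auto simp: in_keys_iff lookup_minus)
  then show "w \<in> occurring p" by (auto simp: occurring_def)
qed

lemma pd_free: "v \<notin> occurring p \<Longrightarrow> pd v p = 0"
  unfolding pd_def by (rule sum.neutral) (auto simp: occurring_def in_keys_iff)

lemma degree_in_pd: "degree_in w (pd v p) \<le> degree_in w p"
proof -
  have "lookup m w \<le> degree_in w p" if mk: "m \<in> keys (pd v p)" for m
  proof -
    obtain m' where m': "m' \<in> keys p" "m = m' - single v 1" using mk keys_pd[of v p] by blast
    then have "lookup m w \<le> lookup m' w" by (simp add: lookup_minus)
    also have "\<dots> \<le> degree_in w p" unfolding degree_in_def using m' by (intro Max_ge) auto
    finally show ?thesis .
  qed
  then show ?thesis unfolding degree_in_def[of w "pd v p"] by (intro Max.boundedI) auto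
qed

lemma degree_in_pd_less:
  assumes "v \<in> occurring p"
  shows "degree_in v (pd v p) < degree_in v p"
proof -
  have "lookup m v < degree_in v p" if mk: "m \<in> keys (pd v p)" for m
  proof -
    obtain m' where m': "m' \<in> keys p" "v \<in> keys m'" "m = m' - single v 1" using mk keys_pd[of v p] by blast
    then have "lookup m v < lookup m' v" by (simp add: lookup_minus in_keys_iff)
    also have "\<dots> \<le> degree_in v p" unfolding degree_in_def using m' by (intro Max_ge) auto
    finally show ?thesis .
  qed
  moreover have "0 < degree_in v p" using assms by (simp add: degree_in_pos_iff)
  ultimately show ?thesis unfolding degree_in_def[of v "pd v p"] by (subst Max_less_iff) auto
qed

lemma pd_sum: "pd v (\<Sum>a\<in>A. f a) = (\<Sum>a\<in>A. pd v (f a))"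
  by (induction A rule: infinite_finite_induct) (auto simp: pd_add)

lemma pd_power_pvar: "pd v (pvar v ^ k) = of_nat k * pvar v ^ (k - 1)"
proof (induction k)
  case (Suc k)
  then show ?case by (cases k) (auto simp: pd_mult pd_pvar algebra_simps)
qed (use pd_const[of v 1] in \<open>simp del: pd_const\<close>)

lemma coeff_in_pd:
  fixes p :: "('v::linorder, 'a::idom) mpol"
  shows "coeff_in v d (pd v p) = of_nat (Suc d) * coeff_in v (Suc d) p"
proof -
  have free: "v \<notin> occurring (coeff_in v k p)" for k
    using occurring_coeff_in[of v k p] by auto
  have X: "[:0, 1:] ^ n = monom (1 :: ('v, 'a) mpol) n" for n
    by (simp add: monom_altdef)
  let ?N = "degree_in v p"
  have "pd v p = pd v (\<Sum>k\<le>?N. coeff_in v k p * pvar v ^ k)"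
    using mpol_eq_sum_coeff_in[of p v] by simp
  also have "\<dots> = (\<Sum>k\<le>?N. of_nat k * coeff_in v k p * pvar v ^ (k - 1))"
    by (simp add: pd_sum pd_mult pd_free[OF free] pd_power_pvar mult_ac)
  finally have "to_poly v (pd v p) = (\<Sum>k\<le>?N. monom (of_nat k * coeff_in v k p) (k - 1))"
    by (simp add: to_poly_sum to_poly_mult to_poly_power to_poly_pvar to_poly_free[OF free] X
        ring_hom_of_nat[OF ring_hom_to_poly] smult_monom of_nat_poly mult.commute)
  then have "coeff (to_poly v (pd v p)) d
      = (\<Sum>k\<le>?N. if k - 1 = d then of_nat k * coeff_in v k p else 0)"
    by (simp add: coeff_sum)
  also have "\<dots> = (\<Sum>k\<le>?N. if k = Suc d then of_nat (Suc d) * coeff_in v (Suc d) p else 0)"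
  proof (intro sum.cong refl)
    fix k show "(if k - 1 = d then of_nat k * coeff_in v k p else 0)
        = (if k = Suc d then of_nat (Suc d) * coeff_in v (Suc d) p else 0)"
      by (cases k) auto
  qed
  also have "\<dots> = of_nat (Suc d) * coeff_in v (Suc d) p"
  proof (cases "Suc d \<le> ?N")
    case False
    then have "coeff_in v (Suc d) p = 0"
      unfolding coeff_to_poly[symmetric] by (intro coeff_eq_0) (simp add: degree_to_poly)
    then show ?thesis by simp
  qed simp
  finally show ?thesis by (simp add: coeff_to_poly)
qed

lemma dvd_of_nat_mult:
  fixes p q :: dpol
  assumes "p dvd of_nat (Suc d) * q"
  shows "p dvd q"
proof -
  have "const (inverse (of_nat (Suc d))) * (of_nat (Suc d) * q) = q"
  proof -
    have "(of_nat (Suc d) :: dpol) = const (of_nat (Suc d))" by (simp only: const_def single_of_nat)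
    moreover have "const (inverse (of_nat (Suc d))) * (const (of_nat (Suc d)) * q) = q"
      unfolding mult.assoc[symmetric] const_mult[symmetric] by (simp del: of_nat_Suc)
    ultimately show ?thesis by simp
  qed
  then show ?thesis using assms by (metis dvd_mult)
qed

lemma pd_nonzero:
  fixes p :: dpol
  assumes "v \<in> occurring p"
  shows "pd v p \<noteq> 0"
proof
  assume "pd v p = 0"
  obtain d where d: "degree_in v p = Suc d"
    using assms by (metis degree_in_pos_iff gr0_implies_Suc)
  have "p \<noteq> 0" using assms by auto
  then have "coeff_in v (Suc d) p \<noteq> 0" using lead_coeff_in_nonzero[of p v] d by simp
  moreover have z: "of_nat (Suc d) * coeff_in v (Suc d) p = 0"
    unfolding coeff_in_pd[symmetric] \<open>pd v p = 0\<close> by (simp add: coeff_in_def)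
  have "0 dvd coeff_in v (Suc d) p"
    by (rule dvd_of_nat_mult[of 0 d]) (simp only: z dvd_refl)
  ultimately show False by simp
qed

text \<open>Up to nonzero integers, which are units over the rationals, the coefficients of q of
  positive degree in v are those of its partial derivative, so p divides them.\<close>

lemma dvd_pd_imp:
  fixes p q :: dpol
  assumes "p dvd pd v q" "v \<notin> occurring p"
  shows "p dvd q - coeff_in v 0 q"
proof -
  have "p dvd coeff_in v (Suc d) q" for d
  proof (rule dvd_of_nat_mult)
    show "p dvd of_nat (Suc d) * coeff_in v (Suc d) q"
      using dvd_coeff_in[OF assms, of d] by (simp only: coeff_in_pd)
  qed
  then have "p dvd coeff_in v d q * pvar v ^ d" if "0 < d" for d
    using that by (cases d) (auto intro: dvd_mult2)
  then have "p dvd (\<Sum>d\<in>{0<..degree_in v q}. coeff_in v d q * pvar v ^ d)"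
    by (intro dvd_sum) simp
  also have "(\<Sum>d\<in>{0<..degree_in v q}. coeff_in v d q * pvar v ^ d) = q - coeff_in v 0 q"
  proof -
    have "(\<Sum>d\<le>degree_in v q. coeff_in v d q * pvar v ^ d)
        = coeff_in v 0 q + (\<Sum>d\<in>{0<..degree_in v q}. coeff_in v d q * pvar v ^ d)"
      by (subst sum.remove[of _ 0]) (auto intro!: sum.cong)
    with mpol_eq_sum_coeff_in[of q v]
    have "q = coeff_in v 0 q + (\<Sum>d\<in>{0<..degree_in v q}. coeff_in v d q * pvar v ^ d)" by (rule trans)
    from trans[OF add.commute this[symmetric]] show ?thesis unfolding eq_diff_eq .
  qed
  finally show ?thesis .
qed

section \<open>Differentiation, limits and linear algebra at complex points\<close>

lemma peval_has_field_derivative: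
  fixes y :: "complex \<Rightarrow> avar \<Rightarrow> complex" and p :: dpol
  assumes W: "finite W" "occurring p \<subseteq> W"
    and y: "\<And>w. w \<in> W \<Longrightarrow> ((\<lambda>s. y s w) has_field_derivative y' w) (at a)"
  shows "((\<lambda>s. peval of_rat (y s) p) has_field_derivative
    (\<Sum>w\<in>W. peval of_rat (y a) (pd w p) * y' w)) (at a)"
  using W(2)
proof (induction p rule: mpol_induct_occurring)
  case (const c)
  show ?case by simp
next
  case (pvar v)
  have "(\<Sum>w\<in>W. peval of_rat (y a) (pd w (pvar v)) * y' w) = (\<Sum>w\<in>W. if w = v then y' v else 0)"
    by (intro sum.cong) (auto simp: pd_pvar)
  also have "\<dots> = y' v" using pvar W by simp
  finally have "(\<Sum>w\<in>W. peval of_rat (y a) (pd w (pvar v)) * y' w) = y' v" .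
  then show ?case using y[OF pvar] by simp
next
  case (add p q)
  then show ?case
    by (auto simp: peval_add pd_add distrib_right sum.distrib intro: DERIV_add)
next
  case (mult p q)
  show ?case
    using DERIV_mult[OF mult.IH]
    by (auto simp: peval_add peval_mult pd_mult algebra_simps sum.distrib sum_distrib_left sum_distrib_right)
qed

lemma isCont_peval:
  fixes p :: dpol
  assumes "\<And>w. isCont (\<lambda>s. y s w) (a::complex)"
  shows "isCont (\<lambda>s. peval of_rat (y s) p :: complex) a"
  unfolding peval_def by (intro continuous_intros assms)

lemma isCont_zero:
  fixes g :: "complex \<Rightarrow> complex"
  assumes "isCont g 0" "\<And>s. s \<noteq> 0 \<Longrightarrow> g s = 0"
  shows "g 0 = 0"
proof -
  have "(g \<longlongrightarrow> g 0) (at 0)" using assms(1) by (simp add: isCont_def)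
  moreover have "(g \<longlongrightarrow> 0) (at 0)"
    by (rule tendsto_eventually) (auto simp: eventually_at_filter assms(2))
  ultimately show ?thesis by (rule LIM_unique)
qed

text \<open>Row rank is at most the number of rows: Gaussian elimination picks one coordinate for
  each row that is not yet zero, and a combination that vanishes at these coordinates is
  zero.\<close>

lemma ex_separating_coordinates:
  fixes A :: "'w \<Rightarrow> 'v \<Rightarrow> 'k::field"
  assumes "finite W"
  shows "\<exists>J. finite J \<and> card J \<le> card W \<and>
    (\<forall>q. (\<forall>v\<in>J. (\<Sum>w\<in>W. q w * A w v) = 0) \<longrightarrow> (\<forall>v. (\<Sum>w\<in>W. q w * A w v) = 0))"
  using assms
proof (induction W arbitrary: A rule: finite_induct)
  case empty
  show ?case by (intro exI[of _ "{}"]) auto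
next
  case (insert w W)
  show ?case
  proof (cases "\<exists>j. A w j \<noteq> 0")
    case False
    then show ?thesis using insert.IH[of A] insert.hyps by (auto intro: le_SucI)
  next
    case True
    then obtain j where j: "A w j \<noteq> 0" by auto
    define A' where "A' w' v = A w' v - A w' j / A w j * A w v" for w' v
    obtain J where J: "finite J" "card J \<le> card W"
      "\<And>q. (\<forall>v\<in>J. (\<Sum>w\<in>W. q w * A' w v) = 0) \<Longrightarrow> (\<forall>v. (\<Sum>w\<in>W. q w * A' w v) = 0)"
      using insert.IH[of A'] by blast
    have "\<forall>v. (\<Sum>w\<in>insert w W. q w * A w v) = 0"
      if *: "\<forall>v\<in>insert j J. (\<Sum>w\<in>insert w W. q w * A w v) = 0" for q
    proof -
      have "q w * A w j + (\<Sum>w\<in>W. q w * A w j) = 0" using * insert.hyps by simp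
      then have qw: "q w = - (\<Sum>w\<in>W. q w * A w j) / A w j"
        using j by (simp add: field_simps eq_neg_iff_add_eq_0)
      have eq: "(\<Sum>w\<in>insert w W. q w * A w v) = (\<Sum>w\<in>W. q w * A' w v)" for v
      proof -
        have "(\<Sum>w\<in>W. q w * A' w v) = (\<Sum>w\<in>W. q w * A w v) - (\<Sum>w\<in>W. q w * A w j) / A w j * A w v"
          by (simp add: A'_def right_diff_distrib sum_subtractf sum_divide_distrib sum_distrib_right mult.assoc)
        also have "\<dots> = q w * A w v + (\<Sum>w\<in>W. q w * A w v)" by (subst qw) simp
        finally show ?thesis using insert.hyps by simp
      qed
      show ?thesis using J(3)[of q] * unfolding eq by blast
    qed
    moreover have "card (insert j J) \<le> card (insert w W)"
      using J(1,2) insert.hyps card_insert_le_m1[of "Suc (card W)" J j] by (simp add: card_insert_if)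
    moreover have "finite (insert j J)" using J(1) by simp
    ultimately show ?thesis by (intro exI conjI allI impI) blast+
  qed
qed

text \<open>The remainder theorem for the monic divisor v - \<xi>. The drop of the degree in v makes
  the repeated division in \<open>specialize_coefficient\<close> terminate.\<close>

lemma linear_division:
  fixes f \<xi> :: dpol
  assumes "v \<notin> occurring \<xi>"
  shows "\<exists>G. f - peval const (pvar(v := \<xi>)) f = (pvar v - \<xi>) * G \<and> occurring G \<subseteq> insert v (occurring f \<union> occurring \<xi>)
    \<and> (G = 0 \<or> degree_in v G < degree_in v f)"
proof -
  let ?h = "pvar v - \<xi>" and ?Y = "insert v (occurring f \<union> occurring \<xi>)"
  have tp: "to_poly v ?h = [:- \<xi>, 1:]"
    by (simp add: to_poly_diff to_poly_pvar to_poly_free[OF assms])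
  then have deg: "degree_in v ?h = 1" by (simp add: degree_to_poly[symmetric])
  have nz: "?h \<noteq> 0" using deg by (auto simp: degree_in_def)
  have lc: "coeff_in v (degree_in v ?h) ?h = 1"
    by (simp add: deg coeff_to_poly[symmetric] tp)
  obtain e q r where qr: "occurring q \<subseteq> ?Y" "occurring r \<subseteq> ?Y" "f = q * ?h + r" "r = 0 \<or> degree_in v r < 1"
    using pseudo_division[OF nz, of ?Y f v] occurring_diff[of "pvar v" \<xi>] unfolding lc by (auto simp: deg)
  then have degr: "degree_in v r = 0" by (auto simp: degree_in_def)
  then have free: "v \<notin> occurring r" by (simp add: degree_in_eq_0_iff)
  have id: "peval const (pvar(v := \<xi>)) p = p" if "v \<notin> occurring p" for p
  proof -
    have "peval const (pvar(v := \<xi>)) p = peval const pvar p"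
      by (rule peval_cong) (use that in auto)
    then show ?thesis by simp
  qed
  have sub: "peval const (pvar(v := \<xi>)) f = r"
    by (subst qr(3)) (simp add: peval_add peval_mult peval_diff id[OF free] id[OF assms])
  have eq: "f - r = (pvar v - \<xi>) * q" using qr(3) by (simp add: mult.commute)
  have "degree_in v q < degree_in v f" if "q \<noteq> 0"
  proof -
    have "degree_in v q + 1 = degree_in v (f - r)"
      using degree_in_mult[OF that nz, of v] qr(3) deg by simp
    also have "\<dots> \<le> degree_in v f"
      using degr degree_diff_le[of "to_poly v f" "degree_in v f" "to_poly v r"]
      by (simp add: degree_to_poly[symmetric] to_poly_diff)
    finally show ?thesis by simp
  qed
  then show ?thesis
    unfolding sub using qr(1) eq by blast
qed

section \<open>Specialization of a generic resultant\<close>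

text \<open>The subgroup generated by the exponent differences within the supports. Exchanging \<mu>
  and \<nu> provides the inverses.\<close>

inductive_set lattice_of :: "('e \<Rightarrow> ('v \<Rightarrow>\<^sub>0 int) set) \<Rightarrow> 'e set \<Rightarrow> ('v \<Rightarrow>\<^sub>0 int) set" for S W where
  zero: "0 \<in> lattice_of S W"
| step: "\<delta> \<in> lattice_of S W \<Longrightarrow> e \<in> W \<Longrightarrow> \<mu> \<in> S e \<Longrightarrow> \<nu> \<in> S e \<Longrightarrow> \<delta> + (\<mu> - \<nu>) \<in> lattice_of S W"

type_synonym cidx = "(nat \<times> nat) \<times> (uvar \<Rightarrow>\<^sub>0 int)"

text \<open>
  The pair \<open>e = (i, k)\<close> in \<open>E\<close> stands for the equation \<open>\<partial>\<^sup>k\<bbbF>\<^sub>i\<close>, and \<open>(e, \<mu>)\<close> for the coefficient of the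
  monomial \<open>\<mu>\<close> in the generic polynomial with the same support; \<open>Q\<close> is the algebraic resultant.  So that
  partially specialized resultants are differential polynomials, \<open>b\<close> renames the generic coefficients to
  indeterminates with first index 0, which do not occur in \<open>\<DD>\<close>.
\<close>

locale specialized_resultant = sparse_system n l M
  for n l M +
  fixes E :: "(nat \<times> nat) set" and R :: dpol and b :: "cidx \<Rightarrow> avar" and Q :: "(cidx, rat) mpol"
  assumes finite_E: "finite E" and E_sub: "E \<subseteq> {1..n} \<times> UNIV"
    and E_down: "(i, k) \<in> E \<Longrightarrow> k' \<le> k \<Longrightarrow> (i, k') \<in> E"
    and res: "is_sparse_diff_resultant n l M R"
    and pivot: "e \<in> E \<Longrightarrow> lookup (F e) (M (fst e) 0) = pvar (fst e, 0, snd e)"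
    and b_inj: "inj_on b (Sigma E (\<lambda>e. keys (F e)))"
    and b_range: "fst (b p) = 0"
    and Q_occ: "occurring Q \<subseteq> Sigma E (\<lambda>e. keys (F e))"
    and Q_vanishes: "\<And>z u. (\<And>v. u v \<noteq> 0) \<Longrightarrow>
      (\<And>e. e \<in> E \<Longrightarrow> (\<Sum>\<mu>\<in>keys (F e). z (e, \<mu>) * lmev u \<mu>) = 0) \<Longrightarrow> peval of_rat z Q = (0 :: complex)"
    and full_rank: "\<And>W J. W \<subseteq> E \<Longrightarrow> finite J \<Longrightarrow> card J + 2 \<le> card W \<Longrightarrow>
      \<exists>\<delta>\<in>lattice_of (\<lambda>e. keys (F e)) W. \<delta> \<noteq> 0 \<and> (\<forall>v\<in>J. lookup \<delta> v = 0)"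
begin

abbreviation S :: "nat \<times> nat \<Rightarrow> (uvar \<Rightarrow>\<^sub>0 int) set" where
  "S e \<equiv> keys (F e)"

section \<open>The equations and indeterminates on which R depends\<close>

definition I0 :: "nat set" where "I0 = fst ` occurring R"

definition r :: "nat \<Rightarrow> nat" where "r i = Max {d. \<exists>m. (i, m, d) \<in> occurring R}"

definition P0 :: "(nat \<times> nat) set" where "P0 = {(i, k). i \<in> I0 \<and> k \<le> r i}"

definition A0 :: "avar set" where "A0 = {(i, m, d). i \<in> I0 \<and> m \<le> l i \<and> d \<le> r i}"

lemma R_props: "R \<in> D_ring n l" "irreducible R" "occurring R \<noteq> {}" "R \<in> elimination_ideal n l M"
  using res irreducible_in_D_ring[of n l R] self_in_sat[of R n l]
  by (auto simp: is_sparse_diff_resultant_def irreducible_in_def)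

lemma R_nonzero: "R \<noteq> 0"
  using R_props by auto

lemma occurring_R: "occurring R \<subseteq> A_derivs n l"
  using R_props by (auto simp: D_ring_def)

lemma finite_orders: "finite {d. \<exists>m. (i, m, d) \<in> occurring R}"
proof -
  have "{d. \<exists>m. (i, m, d) \<in> occurring R} \<subseteq> (\<lambda>(i, m, d). d) ` occurring R" by force
  then show ?thesis by (rule finite_subset) simp
qed

lemma le_r: "(i, m, d) \<in> occurring R \<Longrightarrow> d \<le> r i"
  unfolding r_def by (rule Max_ge[OF finite_orders]) auto

lemma r_attained: "i \<in> I0 \<Longrightarrow> \<exists>m. (i, m, r i) \<in> occurring R"
proof -
  assume "i \<in> I0"
  then have "{d. \<exists>m. (i, m, d) \<in> occurring R} \<noteq> {}" unfolding I0_def by fastforce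
  from Max_in[OF finite_orders this] show ?thesis by (auto simp: r_def)
qed

lemma I0_sub: "I0 \<subseteq> {1..n}"
  using occurring_R by (force simp: I0_def A_derivs_def)

lemma I0_nonempty: "I0 \<noteq> {}"
  using R_props by (auto simp: I0_def)

lemma P0_sub: "P0 \<subseteq> {1..n} \<times> UNIV"
  using I0_sub by (auto simp: P0_def)

lemma A0_sub: "A0 \<subseteq> A_derivs n l"
  using I0_sub by (auto simp: A0_def A_derivs_def)

lemma occurring_R_A0: "occurring R \<subseteq> A0"
proof
  fix v assume v: "v \<in> occurring R"
  obtain i m d where v': "v = (i, m, d)" by (cases v)
  have "i \<in> I0" unfolding I0_def using v v' by force
  then show "v \<in> A0" using v v' occurring_R le_r[of i m d] by (auto simp: A0_def A_derivs_def)
qed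

lemma finite_I0: "finite I0"
  by (simp add: I0_def)

lemma finite_A0: "finite A0"
proof -
  have "A0 = (\<Union>i\<in>I0. {i} \<times> {..l i} \<times> {..r i})" by (auto simp: A0_def)
  then show ?thesis using finite_I0 by simp
qed

lemma finite_P0: "finite P0"
proof -
  have "P0 = (\<Union>i\<in>I0. {i} \<times> {..r i})" by (auto simp: P0_def)
  then show ?thesis using finite_I0 by simp
qed

lemma low_order_dvd:
  assumes "f \<in> elimination_ideal n l M" "i \<in> I0" "\<And>m d. r i < d \<Longrightarrow> (i, m, d) \<notin> occurring f"
  shows "R dvd f"
proof -
  obtain m where m: "(i, m, r i) \<in> occurring R" using r_attained[OF assms(2)] by auto
  have "f \<in> sat n l R" using assms(1) res by (simp add: is_sparse_diff_resultant_def)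
  then show ?thesis
    using sat_low_order_dvd[OF R_props(2,1) m _ _ assms(3)] le_r[of i m] by fastforce
qed

text \<open>Membership in the elimination ideal requires a point that solves all derivatives of all
  equations. Such a point is obtained by solving for all pivots, which leaves the coordinates
  occurring in R unchanged.\<close>

lemma R_vanishes:
  assumes u: "\<And>v. u v \<noteq> 0" and x: "\<And>e. e \<in> P0 \<Longrightarrow> ev x u (F e) = 0"
  shows "peval of_rat x R = 0"
proof -
  let ?x = "solved l M ({1..n} \<times> UNIV) x u"
  have "peval of_rat ?x R = 0"
    by (rule elimination_ideal_vanishes[OF u R_props(4)]) (auto intro!: solved_solves[OF u])
  moreover have "peval of_rat ?x R = peval of_rat x R"
  proof (rule peval_cong)
    fix v assume v: "v \<in> occurring R"
    obtain i m d where v': "v = (i, m, d)" by (cases v)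
    have i: "i \<in> I0" "d \<le> r i" using v occurring_R_A0 by (auto simp: v' A0_def)
    show "?x v = x v"
      unfolding v' by (rule solved_unique[OF u _ i(2)]) (use x i in \<open>auto simp: P0_def\<close>)
  qed
  ultimately show ?thesis by simp
qed

text \<open>The system in which the coefficients in \<open>Sp\<close> are specialized and the others are generic, its
  solutions, and the relations between its coefficients.\<close>

definition cf :: "cidx set \<Rightarrow> cidx \<Rightarrow> dpol" where
  "cf Sp p = (if p \<in> Sp then lookup (F (fst p)) (snd p) else pvar (b p))"

definition sol :: "cidx set \<Rightarrow> (avar \<Rightarrow> complex) \<Rightarrow> (uvar \<Rightarrow> complex) \<Rightarrow> bool" where
  "sol Sp x u \<longleftrightarrow> (\<forall>v. u v \<noteq> 0) \<and>
     (\<forall>e\<in>E. (\<Sum>\<mu>\<in>S e. peval of_rat x (cf Sp (e, \<mu>)) * lmev u \<mu>) = 0)"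

definition rel :: "cidx set \<Rightarrow> dpol set" where
  "rel Sp = {f. \<forall>x u. sol Sp x u \<longrightarrow> peval of_rat x f = 0}"

lemma occurring_coeff: "occurring (lookup (F e) \<mu>) \<subseteq> {(i, m, d). i = fst e \<and> m \<le> l i \<and> d \<le> snd e}"
  using occurring_lookup_der_F[of l M "fst e" "snd e" \<mu>] by fastforce

lemma pivot_in_support: "e \<in> E \<Longrightarrow> M (fst e) 0 \<in> S e"
proof -
  assume "e \<in> E"
  then have "occurring (lookup (F e) (M (fst e) 0)) \<noteq> {}" by (simp add: pivot)
  then have "lookup (F e) (M (fst e) 0) \<noteq> 0" by auto
  then show ?thesis by (simp add: in_keys_iff)
qed

lemma b_notin: "b p \<notin> A_derivs n l"
  using b_range[of p] by (cases "b p") (auto simp: A_derivs_def)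

lemma coeff_free: "e \<in> E \<Longrightarrow> b p \<notin> occurring (lookup (F e) \<mu>)"
  using occurring_coeff[of e \<mu>] b_range[of p] E_sub by (cases "b p"; cases e) force

lemma R_free: "b p \<notin> occurring R"
  using occurring_R b_notin by blast

lemma b_eq_iff: "e \<in> E \<Longrightarrow> \<mu> \<in> S e \<Longrightarrow> e' \<in> E \<Longrightarrow> \<mu>' \<in> S e' \<Longrightarrow> b (e, \<mu>) = b (e', \<mu>') \<longleftrightarrow> e = e' \<and> \<mu> = \<mu>'"
  using inj_onD[OF b_inj, of "(e, \<mu>)" "(e', \<mu>')"] by auto

lemma peval_cf_cong:
  assumes "e \<in> E" "\<mu> \<in> S e" "x (b (e, \<mu>)) = y (b (e, \<mu>)) \<or> (e, \<mu>) \<in> Sp" "\<And>v. fst v \<noteq> 0 \<Longrightarrow> x v = y v"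
  shows "peval of_rat x (cf Sp (e, \<mu>)) = (peval of_rat y (cf Sp (e, \<mu>)) :: complex)"
proof (cases "(e, \<mu>) \<in> Sp")
  case True
  have "fst v \<noteq> 0" if "v \<in> occurring (lookup (F e) \<mu>)" for v
    using that occurring_coeff[of e \<mu>] E_sub assms(1) by (cases v; cases e) force
  then show ?thesis using True assms(4) by (auto simp: cf_def intro!: peval_cong)
qed (use assms in \<open>auto simp: cf_def\<close>)

lemma sol_special:
  assumes "sol Sp x u" "e \<in> E" "{e} \<times> S e \<subseteq> Sp"
  shows "ev x u (F e) = 0"
proof -
  have "ev x u (F e) = (\<Sum>\<mu>\<in>S e. peval of_rat x (cf Sp (e, \<mu>)) * lmev u \<mu>)"
    unfolding ev_eq_sum by (intro sum.cong) (use assms(3) in \<open>auto simp: cf_def\<close>)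
  then show ?thesis using assms by (auto simp: sol_def)
qed

lemma R_in_rel:
  assumes "P0 \<subseteq> E" "Sigma P0 S \<subseteq> Sp"
  shows "R \<in> rel Sp"
  unfolding rel_def
proof (intro CollectI allI impI)
  fix x u assume s: "sol Sp x u"
  show "peval of_rat x R = 0"
    by (rule R_vanishes[of u]) (use s assms in \<open>auto simp: sol_def intro!: sol_special[OF s]\<close>)
qed

text \<open>Opposite changes at \<mu> and \<nu>, weighted by the monomials, cancel in equation e,
  and no other equation contains these two generic coefficients.\<close>

lemma sol_shift:
  assumes s: "sol Sp x u" and e: "e \<in> E" "\<mu> \<in> S e" "\<nu> \<in> S e" "\<mu> \<noteq> \<nu>" "(e, \<mu>) \<notin> Sp" "(e, \<nu>) \<notin> Sp"
  shows "sol Sp (x(b (e, \<mu>) := x (b (e, \<mu>)) + t, b (e, \<nu>) := x (b (e, \<nu>)) - t * lmev u \<mu> / lmev u \<nu>)) u"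
    (is "sol Sp ?x u")
  unfolding sol_def
proof (intro conjI ballI)
  show u: "\<forall>v. u v \<noteq> 0" using s by (simp add: sol_def)
  fix e' assume e': "e' \<in> E"
  have low: "?x v = x v" if "fst v \<noteq> 0" for v
    using that b_range[of "(e, \<mu>)"] b_range[of "(e, \<nu>)"] by auto
  have ne: "b (e, \<mu>) \<noteq> b (e, \<nu>)" using b_eq_iff e by auto
  have summand: "peval of_rat ?x (cf Sp (e', \<kappa>)) * lmev u \<kappa> = peval of_rat x (cf Sp (e', \<kappa>)) * lmev u \<kappa>
      + ((if e' = e \<and> \<kappa> = \<mu> then t * lmev u \<mu> else 0) - (if e' = e \<and> \<kappa> = \<nu> then t * lmev u \<mu> else 0))"
    if k: "\<kappa> \<in> S e'" for \<kappa>
  proof -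
    consider "e' = e \<and> \<kappa> = \<mu>" | "e' = e \<and> \<kappa> = \<nu>" | "\<not> (e' = e \<and> (\<kappa> = \<mu> \<or> \<kappa> = \<nu>))" by blast
    then show ?thesis
    proof cases
      case 1
      then show ?thesis using e ne by (simp add: cf_def algebra_simps)
    next
      case 2
      then show ?thesis using e lmev_nonzero[of u \<nu>] u by (simp add: cf_def left_diff_distrib)
    next
      case 3
      have "peval of_rat ?x (cf Sp (e', \<kappa>)) = peval of_rat x (cf Sp (e', \<kappa>))"
        by (rule peval_cf_cong[OF e' k]) (use 3 low b_eq_iff[OF e' k] e in auto)
      then show ?thesis using 3 by auto
    qed
  qed
  have "(\<Sum>\<kappa>\<in>S e'. peval of_rat ?x (cf Sp (e', \<kappa>)) * lmev u \<kappa>)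
      = (\<Sum>\<kappa>\<in>S e'. peval of_rat x (cf Sp (e', \<kappa>)) * lmev u \<kappa>)
        + ((\<Sum>\<kappa>\<in>S e'. if e' = e \<and> \<kappa> = \<mu> then t * lmev u \<mu> else 0)
          - (\<Sum>\<kappa>\<in>S e'. if e' = e \<and> \<kappa> = \<nu> then t * lmev u \<mu> else 0))"
    by (subst sum.cong[OF refl summand]) (simp_all add: sum.distrib sum_subtractf)
  also have "\<dots> = 0"
    using s e e' by (cases "e' = e") (auto simp: sol_def)
  finally show "(\<Sum>\<kappa>\<in>S e'. peval of_rat ?x (cf Sp (e', \<kappa>)) * lmev u \<kappa>) = 0" .
qed

text \<open>Giving the newly generic coefficient its special value turns solutions of the more
  special system into solutions of the less special one. This is what carries relations through a
  specialization.\<close>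

lemma sol_insert:
  assumes s: "sol (insert (e, \<mu>) Sp) x u" and e: "e \<in> E" "\<mu> \<in> S e" "(e, \<mu>) \<notin> Sp"
  shows "sol Sp (x(b (e, \<mu>) := peval of_rat x (lookup (F e) \<mu>))) u" (is "sol Sp ?x u")
proof -
  have "peval of_rat ?x (cf Sp (e', \<kappa>)) = peval of_rat x (cf (insert (e, \<mu>) Sp) (e', \<kappa>))"
    if e': "e' \<in> E" and k: "\<kappa> \<in> S e'" for e' \<kappa>
  proof (cases "(e', \<kappa>) = (e, \<mu>)")
    case True
    then show ?thesis using e by (simp add: cf_def)
  next
    case False
    have "peval of_rat ?x (cf Sp (e', \<kappa>)) = peval of_rat x (cf Sp (e', \<kappa>))"
      by (rule peval_cf_cong[OF e' k]) (use False b_eq_iff[OF e' k e(1,2)] b_range[of "(e, \<mu>)"] in auto)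
    moreover have "cf (insert (e, \<mu>) Sp) (e', \<kappa>) = cf Sp (e', \<kappa>)"
      using False unfolding cf_def by (metis insertE insertI2)
    ultimately show ?thesis by simp
  qed
  then show ?thesis using s by (simp add: sol_def)
qed

lemma peval_subst_one:
  "peval of_rat x (peval const (pvar(v := \<xi>)) f) = (peval of_rat (x(v := peval of_rat x \<xi>)) f :: complex)"
proof -
  have "peval of_rat x (peval const (pvar(v := \<xi>)) f) = peval of_rat (\<lambda>w. peval of_rat x ((pvar(v := \<xi>)) w)) f"
    by (rule peval_peval) auto
  also have "(\<lambda>w. peval of_rat x ((pvar(v := \<xi>)) w)) = x(v := peval of_rat x \<xi>)"
    by (auto simp: fun_eq_iff)
  finally show ?thesis .
qed

text \<open>Let \<open>g\<close> be the specialization of \<open>f\<close>.  As long as it is a multiple of \<open>R\<close>, replace \<open>f\<close> by the quotient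
  of \<open>f - g\<close> by the difference of \<open>b (e, \<mu>)\<close> and its special value.  This is a relation again: the free
  coefficient at \<open>\<nu>\<close> makes it possible to move every solution away from the zeros of the divisor.\<close>

lemma specialize_coefficient:
  assumes P0: "P0 \<subseteq> E" "Sigma P0 S \<subseteq> Sp"
    and e: "e \<in> E" "\<mu> \<in> S e" "\<nu> \<in> S e" "\<mu> \<noteq> \<nu>" "(e, \<mu>) \<notin> Sp" "(e, \<nu>) \<notin> Sp"
    and f: "f \<in> rel Sp" "\<not> R dvd f" "occurring f \<subseteq> X" and X: "occurring (lookup (F e) \<mu>) \<subseteq> X"
  shows "\<exists>g\<in>rel (insert (e, \<mu>) Sp). \<not> R dvd g \<and> occurring g \<subseteq> X - {b (e, \<mu>)}"
  using f
proof (induction "degree_in (b (e, \<mu>)) f" arbitrary: f rule: less_induct)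
  case less
  let ?v = "b (e, \<mu>)" and ?w = "b (e, \<nu>)" and ?\<xi> = "lookup (F e) \<mu>"
  let ?g = "peval const (pvar(?v := ?\<xi>)) f"
  have free: "?v \<notin> occurring ?\<xi>" by (rule coeff_free[OF e(1)])
  have g_rel: "?g \<in> rel (insert (e, \<mu>) Sp)"
    using less.prems(1) sol_insert[OF _ e(1,2,5)] by (auto simp: rel_def peval_subst_one)
  have occ_g: "occurring ?g \<subseteq> X - {?v}"
  proof -
    have "occurring ?g \<subseteq> (\<Union>w\<in>occurring f. occurring ((pvar(?v := ?\<xi>)) w))" by (rule occurring_peval)
    also have "\<dots> \<subseteq> X - {?v}" using less.prems(3) X free by (auto split: if_splits)
    finally show ?thesis .
  qed
  show ?case
  proof (cases "R dvd ?g")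
    case False
    then show ?thesis using g_rel occ_g by blast
  next
    case True
    obtain G where G: "f - ?g = (pvar ?v - ?\<xi>) * G" "occurring G \<subseteq> insert ?v (occurring f \<union> occurring ?\<xi>)"
      "G = 0 \<or> degree_in ?v G < degree_in ?v f"
      using linear_division[OF free, of f] by blast
    have nd: "\<not> R dvd G"
    proof
      assume "R dvd G"
      then have "R dvd f - ?g" using G(1) by simp
      then show False using True less.prems(2) by (metis diff_add_cancel dvd_add)
    qed
    have prod0: "(x ?v - peval of_rat x ?\<xi>) * peval of_rat x G = 0" if s: "sol Sp x u" for x u
    proof -
      have "peval of_rat x R = 0" using R_in_rel[OF P0] s by (auto simp: rel_def)
      then have "peval of_rat x ?g = 0" using True by (auto simp: peval_mult elim!: dvdE)
      moreover have "peval of_rat x f = 0" using less.prems(1) s by (auto simp: rel_def)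
      ultimately have "peval of_rat x (f - ?g) = 0" by (simp add: peval_diff)
      then show ?thesis by (simp add: G(1) peval_mult peval_diff)
    qed
    have "G \<in> rel Sp"
      unfolding rel_def
    proof (intro CollectI allI impI)
      fix x u assume s: "sol Sp x u"
      show "peval of_rat x G = 0"
      proof (cases "x ?v = peval of_rat x ?\<xi>")
        case False
        then show ?thesis using prod0[OF s] by simp
      next
        case True
        define y where "y t = x(?v := x ?v + t, ?w := x ?w - t * lmev u \<mu> / lmev u \<nu>)" for t
        have ne: "?v \<noteq> ?w" using b_eq_iff e by auto
        have "peval of_rat (y 0) G = 0"
        proof (rule isCont_zero)
          have "isCont (\<lambda>t. y t z) 0" for z
            using lmev_nonzero[of u \<nu>] s
            by (cases "z = ?w"; cases "z = ?v") (auto simp: y_def sol_def intro!: continuous_intros)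
          then show "isCont (\<lambda>t. peval of_rat (y t) G) 0" by (rule isCont_peval)
        next
          fix t :: complex assume t: "t \<noteq> 0"
          have "peval of_rat (y t) ?\<xi> = peval of_rat x ?\<xi>"
          proof (rule peval_cong)
            fix v assume "v \<in> occurring ?\<xi>"
            then have "v \<noteq> ?v" "v \<noteq> ?w" using coeff_free[OF e(1)] by blast+
            then show "y t v = x v" by (simp add: y_def)
          qed
          moreover have "y t ?v = x ?v + t" using ne by (simp add: y_def)
          ultimately show "peval of_rat (y t) G = 0"
            using prod0[OF sol_shift[OF s e, of t, folded y_def]] t True by simp
        qed
        moreover have "y 0 = x" by (auto simp: y_def)
        ultimately show ?thesis by simp
      qed
    qed
    moreover have "insert ?v (occurring f \<union> occurring ?\<xi>) \<subseteq> X" if "?v \<in> X" using that X less.prems(3) by auto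
    moreover have "?v \<in> occurring f"
    proof (rule ccontr)
      assume "?v \<notin> occurring f"
      then have "?g = peval const pvar f" by (intro peval_cong) auto
      then show False using True less.prems(2) by simp
    qed
    ultimately show ?thesis
      using less.hyps[of G] G nd less.prems(3) by auto
  qed
qed

text \<open>The last coefficient of an equation has no free partner left for the shift argument. But
  its special value is one indeterminate, occurring neither in f nor in R, so the specialization is
  a renaming and can be undone.\<close>

lemma specialize_pivot:
  assumes P0: "P0 \<subseteq> E" and e: "e \<in> E" "e \<notin> P0" "(e, M (fst e) 0) \<notin> Sp"
    and f: "f \<in> rel Sp" "\<not> R dvd f" "occurring f \<subseteq> X" "(fst e, 0, snd e) \<notin> X"
  shows "\<exists>g\<in>rel (insert (e, M (fst e) 0) Sp). \<not> R dvd g \<and>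
    occurring g \<subseteq> insert (fst e, 0, snd e) (X - {b (e, M (fst e) 0)})"
proof -
  let ?v = "b (e, M (fst e) 0)" and ?a = "(fst e, 0 :: nat, snd e)"
  let ?g = "peval const (pvar(?v := pvar ?a)) f"
  have mem: "M (fst e) 0 \<in> S e" by (rule pivot_in_support[OF e(1)])
  have aR: "?a \<notin> occurring R"
    using occurring_R_A0 e(2) by (force simp: A0_def P0_def)
  have va: "?v \<noteq> ?a" using b_range[of "(e, M (fst e) 0)"] E_sub e(1) by (cases ?v) auto
  have g_rel: "?g \<in> rel (insert (e, M (fst e) 0) Sp)"
    using f(1) sol_insert[OF _ e(1) mem e(3)] by (auto simp: rel_def peval_subst_one pivot[OF e(1)])
  have occ: "occurring ?g \<subseteq> insert ?a (X - {?v})"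
  proof -
    have "occurring ?g \<subseteq> (\<Union>w\<in>occurring f. occurring ((pvar(?v := pvar ?a) :: avar \<Rightarrow> dpol) w))" by (rule occurring_peval)
    also have "\<dots> \<subseteq> insert ?a (X - {?v})" using f(3) va by (auto split: if_splits)
    finally show ?thesis .
  qed
  let ?back = "peval const (pvar(?a := pvar ?v)) :: dpol \<Rightarrow> dpol"
  have "?back ?g = peval const (\<lambda>w. ?back ((pvar(?v := pvar ?a)) w)) f"
    by (rule peval_peval) auto
  also have "\<dots> = peval const pvar f"
    by (rule peval_cong) (use f(3,4) in auto)
  finally have back_g: "?back ?g = f" by simp
  have "?back R = peval const pvar R"
    by (rule peval_cong) (use aR in auto)
  then have back_R: "?back R = R" by simp
  have "\<not> R dvd ?g"
  proof
    assume "R dvd ?g"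
    then obtain h where "?g = R * h" by auto
    then have "f = R * ?back h" using back_g back_R by (simp add: peval_mult)
    then show False using f(2) by simp
  qed
  then show ?thesis using g_rel occ by blast
qed

section \<open>Specializing whole equations\<close>

definition A_eq :: "nat \<times> nat \<Rightarrow> avar set" where
  "A_eq e = {(i, m, d). i = fst e \<and> m \<le> l i \<and> d \<le> snd e}"

lemma occurring_coeff_nonpivot:
  "\<mu> \<noteq> M (fst e) 0 \<Longrightarrow> occurring (lookup (F e) \<mu>) \<subseteq> A_eq e - {(fst e, 0, snd e)}"
  using occurring_rest_F[of l M "fst e" "snd e" \<mu>]
  by (auto simp: A_eq_def rest_F_def lookup_minus lookup_single)

text \<open>The coefficient of the distinguished monomial stays free, as the partner for the shift
  argument, until all others are specialized; it is renamed last.\<close>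

lemma specialize_equation:
  assumes P0: "P0 \<subseteq> E" "P0 \<subseteq> T" and e: "e \<in> E" "e \<notin> T"
    and f: "f \<in> rel (Sigma T S)" "\<not> R dvd f" "occurring f \<subseteq> X" "(fst e, 0, snd e) \<notin> X"
  shows "\<exists>g\<in>rel (Sigma (insert e T) S). \<not> R dvd g \<and> occurring g \<subseteq> (X - b ` ({e} \<times> S e)) \<union> A_eq e"
proof -
  let ?\<nu> = "M (fst e) 0" and ?X = "X \<union> (A_eq e - {(fst e, 0, snd e)})"
  have mem: "?\<nu> \<in> S e" by (rule pivot_in_support[OF e(1)])
  have "\<exists>g\<in>rel (Sigma T S \<union> {e} \<times> Y). \<not> R dvd g \<and> occurring g \<subseteq> ?X - b ` ({e} \<times> Y)"
    if "finite Y" "Y \<subseteq> S e - {?\<nu>}" for Y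
    using that
  proof (induction Y rule: finite_induct)
    case empty
    then show ?case using f by auto
  next
    case (insert \<mu> Y)
    then obtain g where g: "g \<in> rel (Sigma T S \<union> {e} \<times> Y)" "\<not> R dvd g" "occurring g \<subseteq> ?X - b ` ({e} \<times> Y)"
      by auto
    have "occurring (lookup (F e) \<mu>) \<subseteq> ?X - b ` ({e} \<times> Y)"
      using occurring_coeff_nonpivot[of \<mu> e] coeff_free[OF e(1)] insert.prems by blast
    then have ex: "\<exists>g\<in>rel (insert (e, \<mu>) (Sigma T S \<union> {e} \<times> Y)). \<not> R dvd g
        \<and> occurring g \<subseteq> (?X - b ` ({e} \<times> Y)) - {b (e, \<mu>)}"
      using P0 e mem insert by (intro specialize_coefficient[OF P0(1) _ e(1) _ mem _ _ _ g]) auto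
    have eq1: "insert (e, \<mu>) (Sigma T S \<union> {e} \<times> Y) = Sigma T S \<union> {e} \<times> insert \<mu> Y" by auto
    have eq2: "(?X - b ` ({e} \<times> Y)) - {b (e, \<mu>)} = ?X - b ` ({e} \<times> insert \<mu> Y)" by auto
    show ?case using ex unfolding eq1 eq2 .
  qed
  from this[of "S e - {?\<nu>}"] obtain g where g: "g \<in> rel (Sigma T S \<union> {e} \<times> (S e - {?\<nu>}))" "\<not> R dvd g"
    "occurring g \<subseteq> ?X - b ` ({e} \<times> (S e - {?\<nu>}))" by auto
  have eq: "insert (e, ?\<nu>) (Sigma T S \<union> {e} \<times> (S e - {?\<nu>})) = Sigma (insert e T) S"
    using mem by auto
  have sub: "insert (fst e, 0, snd e) ((?X - b ` ({e} \<times> (S e - {?\<nu>}))) - {b (e, ?\<nu>)})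
      \<subseteq> (X - b ` ({e} \<times> S e)) \<union> A_eq e"
    by (auto simp: A_eq_def)
  have "\<exists>g\<in>rel (insert (e, ?\<nu>) (Sigma T S \<union> {e} \<times> (S e - {?\<nu>}))). \<not> R dvd g \<and>
      occurring g \<subseteq> insert (fst e, 0, snd e) ((?X - b ` ({e} \<times> (S e - {?\<nu>}))) - {b (e, ?\<nu>)})"
    by (rule specialize_pivot[OF P0(1) e(1) _ _ g]) (use P0 e f in auto)
  then obtain h where "h \<in> rel (Sigma (insert e T) S)" "\<not> R dvd h"
    "occurring h \<subseteq> insert (fst e, 0, snd e) ((?X - b ` ({e} \<times> (S e - {?\<nu>}))) - {b (e, ?\<nu>)})"
    unfolding eq by blast
  then show ?thesis using order_trans[OF _ sub] by blast
qed

text \<open>Equations of lower order are specialized first, so that the pivot of the current one is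
  still fresh. Z collects the generic coefficients of the equations whose turn comes later.\<close>

lemma specialize_equations:
  assumes P0: "P0 \<subseteq> E" and K: "finite K" "K \<subseteq> E - P0"
    and f: "f \<in> rel (Sigma P0 S)" "\<not> R dvd f" "occurring f \<subseteq> A0 \<union> b ` (Sigma K S) \<union> Z"
    and Z: "Z \<inter> A_derivs n l = {}" "Z \<inter> b ` (Sigma K S) = {}"
  shows "\<exists>g\<in>rel (Sigma (P0 \<union> K) S). \<not> R dvd g \<and> occurring g \<subseteq> A0 \<union> (\<Union>e\<in>K. A_eq e) \<union> Z"
  using K f Z
proof (induction K arbitrary: f Z rule: finite_ranking_induct[where f = snd])
  case empty
  then show ?case by auto
next
  case (insert e K)
  show ?case
  proof (cases "e \<in> K")
    case True
    then show ?thesis using insert by (simp add: insert_absorb)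
  next
    case False
    let ?Z = "Z \<union> b ` ({e} \<times> S e)"
    have Z1: "?Z \<inter> A_derivs n l = {}" using insert.prems b_notin by blast
    have Z2: "?Z \<inter> b ` (Sigma K S) = {}"
    proof -
      have "b (e, \<mu>) \<noteq> b (e', \<mu>')" if "\<mu> \<in> S e" "e' \<in> K" "\<mu>' \<in> S e'" for \<mu> e' \<mu>'
        using b_eq_iff[of e \<mu> e' \<mu>'] that insert.prems False by auto
      then show ?thesis using insert.prems by blast
    qed
    have occ: "occurring f \<subseteq> A0 \<union> b ` (Sigma K S) \<union> ?Z" using insert.prems by blast
    have "K \<subseteq> E - P0" using insert.prems by blast
    from insert.IH[OF this insert.prems(2,3) occ Z1 Z2] obtain g where g: "g \<in> rel (Sigma (P0 \<union> K) S)" "\<not> R dvd g"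
      "occurring g \<subseteq> A0 \<union> (\<Union>e\<in>K. A_eq e) \<union> ?Z"
      by blast
    have e: "e \<in> E" "e \<notin> P0 \<union> K" using insert.prems False by auto
    have "(fst e, 0, snd e) \<in> A_derivs n l" using e(1) E_sub by (cases e) (auto simp: A_derivs_def)
    then have "(fst e, 0, snd e) \<notin> ?Z" using Z1 by blast
    moreover have "(fst e, 0, snd e) \<notin> A0" using e by (cases e) (auto simp: A0_def P0_def)
    moreover have "(fst e, 0, snd e) \<notin> A_eq e'" if "e' \<in> K" for e'
      using insert.hyps(2)[OF that] that False by (cases e; cases e') (auto simp: A_eq_def)
    ultimately have "(fst e, 0, snd e) \<notin> A0 \<union> (\<Union>e\<in>K. A_eq e) \<union> ?Z" by blast
    then obtain h where h: "h \<in> rel (Sigma (insert e (P0 \<union> K)) S)" "\<not> R dvd h"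
      "occurring h \<subseteq> (A0 \<union> (\<Union>e\<in>K. A_eq e) \<union> ?Z - b ` ({e} \<times> S e)) \<union> A_eq e"
      using specialize_equation[OF P0 _ e g] by blast
    then show ?thesis by (intro bexI[of _ h]) auto
  qed
qed

text \<open>The generic equations impose no condition: they hold everywhere once all generic
  coefficients are set to 0, and f does not contain these.\<close>

lemma special_imp_elimination:
  assumes T: "T \<subseteq> E" and f: "f \<in> rel (Sigma T S)" "f \<in> D_ring n l"
  shows "f \<in> elimination_ideal n l M"
proof (rule vanishing_in_elimination_ideal[OF f(2)])
  show "T \<subseteq> {1..n} \<times> UNIV" using T E_sub by auto
  fix x u assume u: "\<And>v. u v \<noteq> (0::complex)" and x: "\<And>e. e \<in> T \<Longrightarrow> ev x u (F e) = 0"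
  define y where "y v = (if fst v = 0 then 0 else x v)" for v
  have same: "peval of_rat y p = peval of_rat x p" if "occurring p \<subseteq> A_derivs n l" for p
    by (rule peval_cong) (use that in \<open>auto simp: y_def A_derivs_def\<close>)
  have "sol (Sigma T S) y u"
    unfolding sol_def
  proof (intro conjI ballI allI u)
    fix e assume e: "e \<in> E"
    show "(\<Sum>\<mu>\<in>S e. peval of_rat y (cf (Sigma T S) (e, \<mu>)) * lmev u \<mu>) = 0"
    proof (cases "e \<in> T")
      case True
      have "(\<Sum>\<mu>\<in>S e. peval of_rat y (cf (Sigma T S) (e, \<mu>)) * lmev u \<mu>) = ev x u (F e)"
        unfolding ev_eq_sum
      proof (intro sum.cong arg_cong2[where f = "(*)"] refl)
        fix \<mu> assume "\<mu> \<in> S e"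
        moreover have "occurring (lookup (F e) \<mu>) \<subseteq> A_derivs n l"
          using occurring_coeff[of e \<mu>] E_sub e by (cases e) (fastforce simp: A_derivs_def)
        ultimately show "peval of_rat y (cf (Sigma T S) (e, \<mu>)) = peval of_rat x (lookup (F e) \<mu>)"
          using True same by (simp add: cf_def)
      qed
      then show ?thesis using x[OF True] by simp
    next
      case False
      then show ?thesis using b_range by (auto simp: cf_def y_def)
    qed
  qed
  then have "peval of_rat y f = 0" using f(1) by (auto simp: rel_def)
  then show "peval of_rat x f = 0" using same[of f] f(2) by (simp add: D_ring_def)
qed

text \<open>Otherwise specializing the equations in K gives an element of the elimination ideal that
  R does not divide, although its order in block i is at most that of R.\<close>

lemma relation_meets_all_blocks:
  assumes P0: "P0 \<subseteq> E" and K: "K \<subseteq> E - P0"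
    and f: "f \<in> rel (Sigma P0 S)" "\<not> R dvd f" "occurring f \<subseteq> A0 \<union> b ` (Sigma K S)"
    and i: "i \<in> I0"
  shows "\<exists>k. (i, k) \<in> K"
proof (rule ccontr)
  assume no: "\<nexists>k. (i, k) \<in> K"
  have "finite K" using K finite_E finite_subset by blast
  then obtain g where g: "g \<in> rel (Sigma (P0 \<union> K) S)" "\<not> R dvd g" "occurring g \<subseteq> A0 \<union> (\<Union>e\<in>K. A_eq e)"
    using specialize_equations[OF P0 _ K f(1,2), of "{}"] f(3) by auto
  have "A_eq e \<subseteq> A_derivs n l" if "e \<in> K" for e
    using that K E_sub by (cases e) (auto simp: A_eq_def A_derivs_def)
  then have "g \<in> D_ring n l" using g(3) A0_sub by (fastforce simp: D_ring_def)
  then have "g \<in> elimination_ideal n l M" using g(1) K P0 by (intro special_imp_elimination[of "P0 \<union> K"]) auto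
  moreover have "(i, m, d) \<notin> occurring g" if "r i < d" for m d
  proof
    assume "(i, m, d) \<in> occurring g"
    then consider "(i, m, d) \<in> A0" | e where "e \<in> K" "(i, m, d) \<in> A_eq e" using g(3) by auto
    then show False
    proof cases
      case 2
      then show False using no by (cases e) (auto simp: A_eq_def)
    qed (use that in \<open>auto simp: A0_def\<close>)
  qed
  ultimately show False using low_order_dvd[OF _ i] g(2) by blast
qed

end

section \<open>Derivatives along the torus\<close>

lemma lmev_scale:
  "lmev (u(v := u v * t)) m = lmev u m * t powi lookup m v"
  for u :: "'v \<Rightarrow> complex"
proof -
  let ?S = "insert v (keys m)"
  have "lmev (u(v := u v * t)) m = (\<Prod>w\<in>?S. (u(v := u v * t)) w powi lookup m w)"
    by (rule lmev_superset) auto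
  also have "\<dots> = (\<Prod>w\<in>?S. u w powi lookup m w * (if w = v then t powi lookup m v else 1))"
    by (intro prod.cong refl) (auto simp: power_int_mult_distrib)
  also have "\<dots> = (\<Prod>w\<in>?S. u w powi lookup m w) * t powi lookup m v"
    by (simp add: prod.distrib)
  also have "(\<Prod>w\<in>?S. u w powi lookup m w) = lmev u m"
    by (rule lmev_superset[symmetric]) auto
  finally show ?thesis .
qed

lemma lmev_scale_deriv:
  "((\<lambda>s. lmev (u(v := u v * (1 + s))) m) has_field_derivative lmev u m * of_int (lookup m v)) (at 0)"
  for u :: "'v \<Rightarrow> complex"
proof -
  have "((\<lambda>s::complex. (1 + s) powi lookup m v) has_field_derivative
      of_int (lookup m v) * (1 + 0) powi (lookup m v - 1) * 1) (at 0)"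
    by (rule DERIV_power_int) (auto intro!: derivative_eq_intros)
  then have "((\<lambda>s::complex. (1 + s) powi lookup m v) has_field_derivative of_int (lookup m v)) (at 0)"
    by simp
  from DERIV_cmult[OF this, of "lmev u m"] show ?thesis by (simp add: lmev_scale)
qed

text \<open>The logarithmic partial derivative, that is, u v times the partial derivative with
  respect to u v.\<close>

definition dev :: "(avar \<Rightarrow> complex) \<Rightarrow> (uvar \<Rightarrow> complex) \<Rightarrow> uvar \<Rightarrow> dlpol \<Rightarrow> complex" where
  "dev x u v q = (\<Sum>m\<in>keys q. peval of_rat x (lookup q m) * (lmev u m * of_int (lookup m v)))"

lemma ev_scale_deriv:
  "((\<lambda>s. ev x (u(v := u v * (1 + s))) q) has_field_derivative dev x u v q) (at 0)"
  unfolding ev_eq_sum dev_def by (intro DERIV_sum DERIV_cmult lmev_scale_deriv)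

text \<open>The point s = -1 is exempt because 1 + s scales a coordinate that has to stay
  nonzero.\<close>

lemma DERIV_locally_zero:
  fixes g :: "complex \<Rightarrow> complex"
  assumes "(g has_field_derivative D) (at 0)" "\<And>s. s \<noteq> -1 \<Longrightarrow> g s = 0"
  shows "D = 0"
proof -
  have "eventually (\<lambda>s::complex. s \<in> - {-1}) (nhds 0)"
    by (rule eventually_nhds_in_open) auto
  then have "eventually (\<lambda>s. g s = 0) (nhds 0)"
    by eventually_elim (use assms(2) in auto)
  then have "((\<lambda>s. 0) has_field_derivative D) (at 0)"
    using assms(1) DERIV_cong_ev[of 0 0 g "\<lambda>s. 0" D D] by simp
  then show ?thesis using DERIV_const DERIV_unique by blast
qed

text \<open>A relation with nonzero coefficient at t expresses row t by the others; each use
  shortens a spanning family by one.\<close>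

lemma eliminate_from_combination:
  fixes c :: "'w \<Rightarrow> 'k::field"
  assumes "finite T" "t \<in> T" "c t \<noteq> 0" "\<And>v. (\<Sum>e\<in>T. c e * A e v) = 0"
  shows "(\<Sum>e\<in>T. q e * A e v) = (\<Sum>e\<in>T - {t}. (q e - q t * c e / c t) * A e v)"
proof -
  have "c t * A t v = - (\<Sum>e\<in>T - {t}. c e * A e v)"
    using assms(4)[of v] sum.remove[OF assms(1,2), of "\<lambda>e. c e * A e v"] by (simp add: add_eq_0_iff)
  then have "A t v = - (\<Sum>e\<in>T - {t}. c e * A e v) / c t"
    using assms(3) by (simp add: field_simps)
  moreover have "(\<Sum>e\<in>T - {t}. (q e - q t * c e / c t) * A e v)
      = (\<Sum>e\<in>T - {t}. q e * A e v) - q t * (\<Sum>e\<in>T - {t}. c e * A e v) / c t"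
  proof -
    have "(\<Sum>e\<in>T - {t}. q t * c e / c t * A e v) = q t * (\<Sum>e\<in>T - {t}. c e * A e v) / c t"
      by (simp add: sum_distrib_left sum_divide_distrib mult.assoc)
    then show ?thesis by (simp add: left_diff_distrib sum_subtractf)
  qed
  ultimately show ?thesis
    using sum.remove[OF assms(1,2), of "\<lambda>e. q e * A e v"] by simp
qed

lemma sum_divide_mult_cancel:
  fixes c :: "'k::field"
  shows "c \<noteq> 0 \<Longrightarrow> (\<Sum>w\<in>W. N w * V w) = (\<Sum>w\<in>W. N w / c * V w) * c"
  by (simp add: sum_distrib_right)

context specialized_resultant
begin

lemma sol_nonzero: "sol Sp x u \<Longrightarrow> u v \<noteq> 0"
  unfolding sol_def by blast

section \<open>Parametrization of the solutions when exactly the equations in \<open>P0\<close> are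
  specialized\<close>

abbreviation Sp0 :: "cidx set" where "Sp0 \<equiv> Sigma P0 S"

text \<open>Solves every equation of the system in which exactly the equations in \<open>P0\<close> are specialized for the
  coefficient of its distinguished monomial.\<close>

definition sigma :: "avar \<Rightarrow> dlpol" where
  "sigma v = (if \<exists>e\<in>E - P0. v = b (e, M (fst e) 0)
    then (let e = SOME e. e \<in> E - P0 \<and> v = b (e, M (fst e) 0)
      in - (\<Sum>\<mu>\<in>S e - {M (fst e) 0}. single (\<mu> - M (fst e) 0) (pvar (b (e, \<mu>)))))
    else tau l M P0 v)"

lemma sigma_pivot:
  assumes "e \<in> E - P0"
  shows "sigma (b (e, M (fst e) 0)) = - (\<Sum>\<mu>\<in>S e - {M (fst e) 0}. single (\<mu> - M (fst e) 0) (pvar (b (e, \<mu>))))"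
proof -
  have "(SOME e'. e' \<in> E - P0 \<and> b (e, M (fst e) 0) = b (e', M (fst e') 0)) = e"
  proof (rule some_equality)
    fix e' assume "e' \<in> E - P0 \<and> b (e, M (fst e) 0) = b (e', M (fst e') 0)"
    then show "e' = e" using b_eq_iff pivot_in_support assms by (metis DiffD1)
  qed (use assms in auto)
  then show ?thesis using assms by (auto simp: sigma_def Let_def)
qed

lemma b_not_P0: "b p = (i, m, d) \<Longrightarrow> (i, k) \<notin> P0"
  using b_range[of p] P0_sub by auto

lemma tau_b: "tau l M P0 (b p) = const (pvar (b p))"
  using b_not_P0[of p] by (cases "b p") (auto intro!: tau_free)

lemma sigma_free:
  assumes "e \<in> E" "\<mu> \<in> S e" "\<mu> \<noteq> M (fst e) 0"
  shows "sigma (b (e, \<mu>)) = const (pvar (b (e, \<mu>)))"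
proof -
  have "\<not> (\<exists>e'\<in>E - P0. b (e, \<mu>) = b (e', M (fst e') 0))"
    using b_eq_iff assms pivot_in_support by (metis DiffD1)
  then show ?thesis by (simp add: sigma_def tau_b)
qed

lemma sigma_A: "fst v \<noteq> 0 \<Longrightarrow> sigma v = tau l M P0 v"
  using b_range by (auto simp: sigma_def)

definition pivots :: "avar set" where
  "pivots = {(i, 0, k) | i k. (i, k) \<in> P0} \<union> {b (e, M (fst e) 0) | e. e \<in> E - P0}"

lemma sigma_not_pivot: "v \<notin> pivots \<Longrightarrow> sigma v = const (pvar v)"
  by (cases v) (auto simp: sigma_def pivots_def intro!: tau_free)

text \<open>Keeps the free coordinates of x and recomputes the pivots from u; solutions are the
  fixed points.\<close>

definition full :: "(avar \<Rightarrow> complex) \<Rightarrow> (uvar \<Rightarrow> complex) \<Rightarrow> avar \<Rightarrow> complex" where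
  "full x u v = ev x u (sigma v)"

lemma full_A: "fst v \<noteq> 0 \<Longrightarrow> full x u v = solved l M P0 x u v"
  by (simp add: full_def solved_def sigma_A)

lemma full_pivot:
  assumes u: "\<And>v. u v \<noteq> 0" and e: "e \<in> E - P0"
  shows "full x u (b (e, M (fst e) 0)) = - (\<Sum>\<mu>\<in>S e - {M (fst e) 0}. x (b (e, \<mu>)) * lmev u \<mu>) / lmev u (M (fst e) 0)"
  by (simp add: full_def sigma_pivot[OF e] ev_uminus[OF u] ev_sum[OF u] ev_single[OF u] lmev_diff[OF u]
      sum_divide_distrib)

lemma peval_cf_Sp0:
  assumes "e \<in> E" "\<mu> \<in> S e"
  shows "peval of_rat x (cf Sp0 (e, \<mu>)) = (if e \<in> P0 then peval of_rat x (lookup (F e) \<mu>) else x (b (e, \<mu>)) :: complex)"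
  using assms by (simp add: cf_def)

lemma sol_Sp0_iff:
  assumes "P0 \<subseteq> E"
  shows "sol Sp0 x u \<longleftrightarrow> (\<forall>v. u v \<noteq> 0) \<and> (\<forall>e\<in>P0. ev x u (F e) = 0) \<and>
    (\<forall>e\<in>E - P0. (\<Sum>\<mu>\<in>S e. x (b (e, \<mu>)) * lmev u \<mu>) = 0)"
proof -
  have "(\<Sum>\<mu>\<in>S e. peval of_rat x (cf Sp0 (e, \<mu>)) * lmev u \<mu>)
      = (if e \<in> P0 then ev x u (F e) else \<Sum>\<mu>\<in>S e. x (b (e, \<mu>)) * lmev u \<mu>)" if "e \<in> E" for e
    unfolding ev_eq_sum using that by (auto simp: peval_cf_Sp0 intro!: sum.cong)
  then show ?thesis using assms unfolding sol_def by auto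
qed

lemma full_sol:
  assumes P0: "P0 \<subseteq> E" and u: "\<And>v. u v \<noteq> 0"
  shows "sol Sp0 (full x u) u"
  unfolding sol_Sp0_iff[OF P0]
proof (intro conjI allI ballI u)
  fix e assume e: "e \<in> P0"
  have "ev (full x u) u (F e) = ev (solved l M P0 x u) u (F e)"
  proof (rule ev_cong)
    fix \<mu> v assume "v \<in> occurring (lookup (F e) \<mu>)"
    then have "fst v = fst e" using occurring_coeff[of e \<mu>] by (cases v) auto
    then show "full x u v = solved l M P0 x u v" using e P0_sub by (intro full_A) auto
  qed
  also have "\<dots> = 0" using e by (intro solved_solves[OF u]) simp
  finally show "ev (full x u) u (F e) = 0" .
next
  fix e assume e: "e \<in> E - P0"
  let ?\<nu> = "M (fst e) 0"
  have "(\<Sum>\<mu>\<in>S e. full x u (b (e, \<mu>)) * lmev u \<mu>)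
      = full x u (b (e, ?\<nu>)) * lmev u ?\<nu> + (\<Sum>\<mu>\<in>S e - {?\<nu>}. full x u (b (e, \<mu>)) * lmev u \<mu>)"
    using e pivot_in_support[of e] by (intro sum.remove) auto
  also have "(\<Sum>\<mu>\<in>S e - {?\<nu>}. full x u (b (e, \<mu>)) * lmev u \<mu>) = (\<Sum>\<mu>\<in>S e - {?\<nu>}. x (b (e, \<mu>)) * lmev u \<mu>)"
    using e by (intro sum.cong refl) (auto simp: full_def sigma_free ev_const[OF u])
  finally show "(\<Sum>\<mu>\<in>S e. full x u (b (e, \<mu>)) * lmev u \<mu>) = 0"
    using lmev_nonzero[of u ?\<nu>, OF u] by (simp add: full_pivot[OF u e])
qed

lemma full_unique:
  assumes P0: "P0 \<subseteq> E" and s: "sol Sp0 x u"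
  shows "full x u = x"
proof
  fix v
  have u: "u w \<noteq> 0" for w using s by (rule sol_nonzero)
  show "full x u v = x v"
  proof (cases "v \<in> pivots")
    case False
    then show ?thesis by (simp add: full_def sigma_not_pivot ev_const[OF u])
  next
    case True
    then consider i k where "v = (i, 0, k)" "(i, k) \<in> P0" | e where "e \<in> E - P0" "v = b (e, M (fst e) 0)"
      by (auto simp: pivots_def)
    then show ?thesis
    proof cases
      case 1
      then have "full x u v = solved l M P0 x u (i, 0, k)" using P0_sub by (auto intro!: full_A)
      also have "\<dots> = x (i, 0, k)"
        by (rule solved_unique[OF u _ le_refl]) (use s in \<open>auto simp: sol_Sp0_iff[OF P0]\<close>)
      finally show ?thesis using 1 by simp
    next
      case 2
      let ?\<nu> = "M (fst e) 0"
      have "(\<Sum>\<mu>\<in>S e. x (b (e, \<mu>)) * lmev u \<mu>)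
          = x (b (e, ?\<nu>)) * lmev u ?\<nu> + (\<Sum>\<mu>\<in>S e - {?\<nu>}. x (b (e, \<mu>)) * lmev u \<mu>)"
        using 2 pivot_in_support[of e] by (intro sum.remove) auto
      moreover have "(\<Sum>\<mu>\<in>S e. x (b (e, \<mu>)) * lmev u \<mu>) = 0"
        using s 2 by (simp add: sol_Sp0_iff[OF P0])
      ultimately show ?thesis
        using 2 lmev_nonzero[of u ?\<nu>, OF u] by (simp add: full_pivot[OF u] field_simps add_eq_0_iff)
    qed
  qed
qed

lemma ev_sigma:
  "(\<And>v. u v \<noteq> 0) \<Longrightarrow> ev x u (peval cconst sigma f) = peval of_rat (full x u) f"
  by (simp add: ev_peval_cconst full_def[abs_def])

text \<open>In effect the relations form a prime ideal: a polynomial whose image under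
  \<open>sigma\<close> is 0 is a relation, and the images lie in a domain. So the product of the
  images of finitely many non-relations is nonzero at some point.\<close>

lemma generic_solution:
  assumes P0: "P0 \<subseteq> E" and G: "finite G" "G \<inter> rel Sp0 = {}"
  shows "\<exists>x u. sol Sp0 x u \<and> (\<forall>f\<in>G. peval of_rat x f \<noteq> 0)"
proof -
  have nz: "peval cconst sigma f \<noteq> 0" if "f \<in> G" for f
  proof
    assume z: "peval cconst sigma f = 0"
    have "f \<in> rel Sp0"
      unfolding rel_def
    proof (intro CollectI allI impI)
      fix x u assume s: "sol Sp0 x u"
      then have u: "u v \<noteq> 0" for v by (rule sol_nonzero)
      show "peval of_rat x f = 0"
        using ev_sigma[of u x f, OF u] z full_unique[OF P0 s] ring_homD(1)[OF ring_hom_ev[OF u], of x] by simp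
    qed
    then show False using G(2) that by auto
  qed
  then have "(\<Prod>f\<in>G. peval cconst sigma f) \<noteq> 0" using G(1) by (simp add: prod_zero_iff)
  then obtain x u where xu: "\<And>v. u v \<noteq> 0" "ev x u (\<Prod>f\<in>G. peval cconst sigma f) \<noteq> 0"
    using ex_nonroot_Laurent by metis
  have "peval of_rat (full x u) f \<noteq> 0" if "f \<in> G" for f
  proof
    assume "peval of_rat (full x u) f = 0"
    then have "ev x u (peval cconst sigma f) = 0" by (simp add: ev_sigma[OF xu(1)])
    then have "ev x u (peval cconst sigma f * (\<Prod>f\<in>G - {f}. peval cconst sigma f)) = 0"
      by (simp add: ev_mult[OF xu(1)])
    then show False using xu(2) prod.remove[OF G(1) that, of "peval cconst sigma"] by simp
  qed
  then show ?thesis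
    by (intro exI[of _ "full x u"] exI[of _ u] conjI full_sol[OF P0 xu(1)]) auto
qed

text \<open>\<open>vel x u v w\<close> is the velocity of the coordinate \<open>w\<close> when \<open>u v\<close> moves with relative velocity 1 and
  the free coefficients are kept fixed.\<close>

definition vel :: "(avar \<Rightarrow> complex) \<Rightarrow> (uvar \<Rightarrow> complex) \<Rightarrow> uvar \<Rightarrow> avar \<Rightarrow> complex" where
  "vel x u v w = dev x u v (sigma w)"

lemma vel_not_pivot: "w \<notin> pivots \<Longrightarrow> vel x u v w = 0"
  by (simp add: vel_def dev_def sigma_not_pivot const_def)

context
  fixes x u
  assumes P0: "P0 \<subseteq> E" and s: "sol Sp0 x u"
begin

lemma u_nonzero: "u v \<noteq> 0"
  using s by (rule sol_nonzero)

lemma move_sol: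
  assumes "t \<noteq> -1"
  shows "sol Sp0 (full x (u(v := u v * (1 + t)))) (u(v := u v * (1 + t)))"
proof (rule full_sol[OF P0])
  have "1 + t \<noteq> 0" using assms by (simp add: add_eq_0_iff)
  then show "(u(v := u v * (1 + t))) w \<noteq> 0" for w using u_nonzero by auto
qed

lemma move_deriv:
  assumes W: "finite W" "occurring f \<subseteq> W"
  shows "((\<lambda>t. peval of_rat (full x (u(v := u v * (1 + t)))) f) has_field_derivative
    (\<Sum>w\<in>W. peval of_rat x (pd w f) * vel x u v w)) (at 0)"
proof -
  have "full x (u(v := u v * (1 + 0))) = x" using full_unique[OF P0 s] by simp
  moreover have "((\<lambda>t. full x (u(v := u v * (1 + t))) w) has_field_derivative vel x u v w) (at 0)" for w
    unfolding full_def vel_def by (rule ev_scale_deriv)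
  ultimately show ?thesis
    using peval_has_field_derivative[OF W, where y = "\<lambda>t. full x (u(v := u v * (1 + t)))" and y' = "vel x u v" and a = 0]
    by simp
qed

text \<open>Moving u v while the free coordinates are fixed gives a curve of solutions through x,
  along which f vanishes identically.\<close>

lemma velocity_relation:
  assumes "f \<in> rel Sp0" "finite W" "occurring f \<subseteq> W"
  shows "(\<Sum>w\<in>W. peval of_rat x (pd w f) * vel x u v w) = 0"
proof (rule DERIV_locally_zero[OF move_deriv[OF assms(2,3)]])
  fix t :: complex assume "t \<noteq> -1"
  then show "peval of_rat (full x (u(v := u v * (1 + t)))) f = 0"
    using assms(1) move_sol[of t v] unfolding rel_def by blast
qed

text \<open>Differentiate f along the exchange of \<open>sol_shift\<close>. Up to a common factor,
  the monomials of equation e at a solution are thus the partial derivatives of f.\<close>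

lemma ratio_relation:
  assumes f: "f \<in> rel Sp0" and e: "e \<in> E - P0" "\<mu> \<in> S e" "\<nu> \<in> S e"
  shows "peval of_rat x (pd (b (e, \<mu>)) f) * lmev u \<nu> = peval of_rat x (pd (b (e, \<nu>)) f) * lmev u \<mu>"
proof (cases "\<mu> = \<nu>")
  case False
  let ?v = "b (e, \<mu>)" and ?w = "b (e, \<nu>)" and ?c = "- (lmev u \<mu> / lmev u \<nu>)"
  let ?W = "insert ?v (insert ?w (occurring f))"
  define y where "y t = x(?v := x ?v + t, ?w := x ?w - t * lmev u \<mu> / lmev u \<nu>)" for t
  define y' where "y' z = (if z = ?v then 1 else if z = ?w then ?c else 0)" for z
  have ne: "?v \<noteq> ?w" using b_eq_iff e False by auto
  have nz: "lmev u \<nu> \<noteq> 0" by (rule lmev_nonzero[OF u_nonzero])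
  have deriv: "((\<lambda>t. y t z) has_field_derivative y' z) (at 0)" for z
    using ne nz by (cases "z = ?v"; cases "z = ?w") (auto simp: y_def y'_def intro!: derivative_eq_intros)
  have D: "((\<lambda>t. peval of_rat (y t) f) has_field_derivative (\<Sum>z\<in>?W. peval of_rat (y 0) (pd z f) * y' z)) (at 0)"
    by (rule peval_has_field_derivative[OF _ _ deriv]) auto
  have "sol Sp0 (y t) u" for t
    unfolding y_def by (rule sol_shift[OF s]) (use e False in auto)
  then have z: "peval of_rat (y t) f = 0" for t using f by (auto simp: rel_def)
  have "(\<Sum>z\<in>?W. peval of_rat (y 0) (pd z f) * y' z) = 0"
    by (rule DERIV_locally_zero[OF D]) (rule z)
  moreover have "y 0 = x" by (auto simp: y_def)
  moreover have "(\<Sum>z\<in>?W. peval of_rat x (pd z f) * y' z)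
      = (\<Sum>z\<in>?W. (if z = ?v then peval of_rat x (pd ?v f) else 0) + (if z = ?w then peval of_rat x (pd ?w f) * ?c else 0))"
    using ne by (intro sum.cong) (auto simp: y'_def)
  moreover have "\<dots> = peval of_rat x (pd ?v f) + peval of_rat x (pd ?w f) * ?c"
    by (simp add: sum.distrib del: sum.insert)
  ultimately show ?thesis using nz by (simp add: field_simps)
qed auto

end

text \<open>Logarithmic differentiation of the equation between ratios in \<open>ratio_relation\<close>.\<close>

lemma exponent_combination:
  assumes P0: "P0 \<subseteq> E" and s: "sol Sp0 x u" and f: "f \<in> rel Sp0" and e: "e \<in> E - P0" "\<mu> \<in> S e" "\<nu> \<in> S e"
    and W: "finite W" "occurring f \<subseteq> W" and nz: "peval of_rat x (pd (b (e, \<mu>)) f) \<noteq> 0"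
  shows "\<exists>q. \<forall>v. of_int (lookup \<mu> v - lookup \<nu> v) = (\<Sum>w\<in>W. q w * vel x u v w)"
proof -
  let ?f = "pd (b (e, \<mu>)) f" and ?g = "pd (b (e, \<nu>)) f"
  let ?c = "peval of_rat x ?f * lmev u \<nu>"
  let ?q = "\<lambda>w. (peval of_rat x (pd w ?f) * lmev u \<nu> - peval of_rat x (pd w ?g) * lmev u \<mu>) / ?c"
  have c: "?c \<noteq> 0" using nz lmev_nonzero[OF u_nonzero[OF P0 s]] by simp
  have c': "?c = peval of_rat x ?g * lmev u \<mu>" by (rule ratio_relation[OF P0 s f e])
  have "of_int (lookup \<mu> v - lookup \<nu> v) = (\<Sum>w\<in>W. ?q w * vel x u v w)" for v
  proof -
    let ?us = "\<lambda>t. u(v := u v * (1 + t))"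
    let ?A = "\<Sum>w\<in>W. peval of_rat x (pd w ?f) * vel x u v w"
    let ?B = "\<Sum>w\<in>W. peval of_rat x (pd w ?g) * vel x u v w"
    have occ: "occurring ?f \<subseteq> W" "occurring ?g \<subseteq> W"
      by (rule order_trans[OF occurring_pd W(2)])+
    have at0: "?us 0 = u" "full x u = x" using full_unique[OF P0 s] by simp_all
    have "((\<lambda>t. peval of_rat (full x (?us t)) ?f * lmev (?us t) \<nu> - peval of_rat (full x (?us t)) ?g * lmev (?us t) \<mu>)
        has_field_derivative ((?A * lmev (?us 0) \<nu> + lmev u \<nu> * of_int (lookup \<nu> v) * peval of_rat (full x (?us 0)) ?f)
          - (?B * lmev (?us 0) \<mu> + lmev u \<mu> * of_int (lookup \<mu> v) * peval of_rat (full x (?us 0)) ?g))) (at 0)"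
      by (intro DERIV_diff DERIV_mult move_deriv[OF P0 s W(1)] occ lmev_scale_deriv)
    moreover have "peval of_rat (full x (?us t)) ?f * lmev (?us t) \<nu> - peval of_rat (full x (?us t)) ?g * lmev (?us t) \<mu> = 0"
      if "t \<noteq> -1" for t
      using ratio_relation[OF P0 move_sol[OF P0 s that, of v] f e] by simp
    ultimately have "(?A * lmev u \<nu> + lmev u \<nu> * of_int (lookup \<nu> v) * peval of_rat x ?f)
          - (?B * lmev u \<mu> + lmev u \<mu> * of_int (lookup \<mu> v) * peval of_rat x ?g) = 0"
      unfolding at0 by (rule DERIV_locally_zero)
    then have "?A * lmev u \<nu> + of_int (lookup \<nu> v) * ?c
        = ?B * lmev u \<mu> + of_int (lookup \<mu> v) * (peval of_rat x ?g * lmev u \<mu>)"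
      by (simp add: mult_ac)
    then have "of_int (lookup \<mu> v - lookup \<nu> v) * ?c = ?A * lmev u \<nu> - ?B * lmev u \<mu>"
      unfolding c'[symmetric] by (simp add: algebra_simps)
    also have "\<dots> = (\<Sum>w\<in>W. (peval of_rat x (pd w ?f) * lmev u \<nu> - peval of_rat x (pd w ?g) * lmev u \<mu>) * vel x u v w)"
      unfolding left_diff_distrib sum_subtractf sum_distrib_right by (simp add: mult_ac)
    also have "\<dots> = (\<Sum>w\<in>W. ?q w * vel x u v w) * ?c"
      by (rule sum_divide_mult_cancel[OF c])
    finally show ?thesis by (rule mult_right_cancel[THEN iffD1, OF c])
  qed
  then show ?thesis by (intro exI[of _ ?q] allI)
qed

end

context specialized_resultant
begin

section \<open>A minimal relation that is not a multiple of R\<close>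

definition piv :: "nat \<times> nat \<Rightarrow> avar" where
  "piv e = (if e \<in> P0 then (fst e, 0, snd e) else b (e, M (fst e) 0))"

text \<open>If R contained no pivot, all its indeterminates could be prescribed and completed to a
  solution, so R would vanish identically.\<close>

lemma ex_pivot_in_R:
  assumes P0: "P0 \<subseteq> E"
  shows "\<exists>e\<in>P0. piv e \<in> occurring R"
proof (rule ccontr)
  assume no: "\<not> ?thesis"
  obtain x :: "avar \<Rightarrow> complex" where x: "peval of_rat x R \<noteq> 0"
    using ex_nonroot[OF ring_hom_of_rat of_rat_inj R_nonzero] by blast
  let ?u = "\<lambda>_ :: uvar. 1 :: complex"
  have s: "sol Sp0 (full x ?u) ?u" by (rule full_sol[OF P0]) simp
  have "Sp0 \<subseteq> Sp0" by simp
  then have "peval of_rat (full x ?u) R = 0" using R_in_rel[OF P0] s unfolding rel_def by blast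
  moreover have "peval of_rat (full x ?u) R = peval of_rat x R"
  proof (rule peval_cong)
    fix v assume v: "v \<in> occurring R"
    have "v \<notin> pivots"
    proof
      assume "v \<in> pivots"
      then consider i k where "v = (i, 0, k)" "(i, k) \<in> P0" | e where "v = b (e, M (fst e) 0)"
        by (auto simp: pivots_def)
      then show False using no v R_free by cases (auto simp: piv_def)
    qed
    then show "full x ?u v = x v" by (simp add: full_def sigma_not_pivot ev_const)
  qed
  ultimately show False using x by simp
qed

text \<open>Free of generic coefficients, f lies in the elimination ideal, and \<open>A0\<close>
  bounds its orders by those of R.\<close>

lemma low_relation_dvd:
  assumes P0: "P0 \<subseteq> E" and f: "f \<in> rel Sp0" "occurring f \<subseteq> A0"
  shows "R dvd f"
proof -
  obtain i where i: "i \<in> I0" using I0_nonempty by auto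
  have "f \<in> elimination_ideal n l M"
    using f A0_sub by (intro special_imp_elimination[OF P0]) (auto simp: D_ring_def)
  then show ?thesis
    by (rule low_order_dvd[OF _ i]) (use f(2) in \<open>auto simp: A0_def\<close>)
qed

text \<open>Otherwise R would divide its own partial derivative, which is nonzero and of smaller
  degree in v.\<close>

lemma pd_R_not_rel:
  assumes P0: "P0 \<subseteq> E" and v: "v \<in> occurring R"
  shows "pd v R \<notin> rel Sp0"
proof
  assume "pd v R \<in> rel Sp0"
  then have "R dvd pd v R"
    using low_relation_dvd[OF P0] occurring_pd[of v R] occurring_R_A0 by blast
  then obtain h where h: "pd v R = R * h" by auto
  have "pd v R \<noteq> 0" by (rule pd_nonzero[OF v])
  then have "degree_in v R \<le> degree_in v (pd v R)"
    unfolding h by (subst degree_in_mult) auto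
  then show False using degree_in_pd_less[OF v] by simp
qed

definition C0 :: "avar set" where "C0 = b ` Sigma (E - P0) S"

lemma finite_C0: "finite C0"
  unfolding C0_def using finite_E by auto

definition bad :: "dpol \<Rightarrow> bool" where
  "bad f \<longleftrightarrow> f \<in> rel Sp0 \<and> \<not> R dvd f \<and> occurring f \<subseteq> A0 \<union> C0"

text \<open>Minimize first the number of generic coefficients, then the sum of the degrees in them.
  If a partial derivative were a relation, it would either be bad with smaller degree sum, or R
  would divide it, and then g at v = 0 would be bad with fewer generic coefficients.\<close>

lemma minimal_bad:
  assumes P0: "P0 \<subseteq> E" and f: "bad f"
  shows "\<exists>g. bad g \<and> (\<forall>v\<in>occurring g \<inter> C0. pd v g \<notin> rel Sp0)"
proof -
  define c where "c g = card (occurring g \<inter> C0)" for g :: dpol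
  define d where "d g = (\<Sum>v\<in>C0. degree_in v g)" for g :: dpol
  obtain g0 where g0: "bad g0" "\<And>h. bad h \<Longrightarrow> c g0 \<le> c h"
    using ex_has_least_nat[of bad f c] f by blast
  obtain g where g: "bad g" "c g = c g0" "\<And>h. bad h \<Longrightarrow> c h = c g0 \<Longrightarrow> d g \<le> d h"
    using ex_has_least_nat[of "\<lambda>h. bad h \<and> c h = c g0" g0 d] g0(1) by blast
  have "pd v g \<notin> rel Sp0" if v: "v \<in> occurring g" "v \<in> C0" for v
  proof
    assume rel: "pd v g \<in> rel Sp0"
    have vR: "v \<notin> occurring R" using v(2) R_free by (auto simp: C0_def)
    have fin: "finite (occurring g \<inter> C0)" by simp
    have "R dvd pd v g"
    proof (rule ccontr)
      assume nd: "\<not> R dvd pd v g"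
      then have bad: "bad (pd v g)"
        using rel g(1) occurring_pd[of v g] by (auto simp: bad_def)
      have "c (pd v g) \<le> c g"
        unfolding c_def by (rule card_mono[OF fin]) (use occurring_pd[of v g] in auto)
      then have "c (pd v g) = c g0" using g0(2)[OF bad] g(2) by simp
      then have "d g \<le> d (pd v g)" using g(3) bad by blast
      moreover have "d (pd v g) < d g"
        unfolding d_def using degree_in_pd_less[OF v(1)] v(2) finite_C0 degree_in_pd
        by (intro sum_strict_mono_ex1) auto
      ultimately show False by simp
    qed
    then have dvd: "R dvd g - coeff_in v 0 g" by (rule dvd_pd_imp[OF _ vR])
    let ?h = "coeff_in v 0 g"
    have occ: "occurring ?h \<subseteq> occurring g - {v}" by (rule occurring_coeff_in)
    have "?h \<in> rel Sp0"
      unfolding rel_def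
    proof (intro CollectI allI impI)
      fix x u assume s: "sol Sp0 x u"
      have "peval of_rat x R = 0" using R_in_rel[OF P0 subset_refl] s unfolding rel_def by blast
      then have "peval of_rat x (g - ?h) = 0" using dvd by (auto simp: peval_mult elim!: dvdE)
      moreover have "peval of_rat x g = 0" using g(1) s unfolding bad_def rel_def by blast
      ultimately show "peval of_rat x ?h = 0" by (simp add: peval_diff)
    qed
    moreover have "\<not> R dvd ?h"
    proof
      assume "R dvd ?h"
      then have "R dvd (g - ?h) + ?h" using dvd by (intro dvd_add)
      then show False using g(1) by (simp add: bad_def)
    qed
    ultimately have "bad ?h" using occ g(1) by (auto simp: bad_def)
    then have "c g \<le> c ?h" using g0(2) g(2) by simp
    moreover have "c ?h < c g"
      unfolding c_def by (rule psubset_card_mono[OF fin]) (use occ v in auto)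
    ultimately show False by simp
  qed
  then show ?thesis using g(1) by blast
qed

lemma piv_inj:
  assumes "P0 \<subseteq> E" "K \<subseteq> E - P0"
  shows "inj_on piv (P0 \<union> K)"
proof (rule inj_onI)
  fix e e' assume *: "e \<in> P0 \<union> K" "e' \<in> P0 \<union> K" "piv e = piv e'"
  have mem: "e \<in> E" "e' \<in> E" using * assms by auto
  have fst: "fst e \<noteq> 0" "fst e' \<noteq> 0" using mem E_sub by auto
  show "e = e'"
    using * mem fst b_range[of "(e, M (fst e) 0)"] b_range[of "(e', M (fst e') 0)"]
      b_eq_iff[OF mem(1) pivot_in_support[OF mem(1)] mem(2) pivot_in_support[OF mem(2)]]
    by (auto simp: piv_def prod_eq_iff split: if_splits)
qed

text \<open>All coordinates except the pivots stand still, so one term per equation remains.\<close>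

lemma sum_over_pivots:
  assumes P0: "P0 \<subseteq> E" and K: "K \<subseteq> E - P0"
  shows "(\<Sum>w\<in>A0 \<union> b ` Sigma K S. q w * vel x u v w) = (\<Sum>e\<in>P0 \<union> K. q (piv e) * vel x u v (piv e))"
proof -
  let ?W = "A0 \<union> b ` Sigma K S"
  have fin: "finite ?W" using finite_A0 finite_subset[OF K] finite_E by auto
  have 1: "piv ` (P0 \<union> K) \<subseteq> ?W"
  proof (intro image_subsetI)
    fix e assume "e \<in> P0 \<union> K"
    then show "piv e \<in> ?W"
    proof
      assume "e \<in> P0"
      then show ?thesis by (cases e) (auto simp: piv_def A0_def P0_def)
    next
      assume e: "e \<in> K"
      then have "piv e = b (e, M (fst e) 0)" "M (fst e) 0 \<in> S e"
        using K pivot_in_support[of e] by (auto simp: piv_def)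
      then show ?thesis using e by auto
    qed
  qed
  have 2: "vel x u v w = 0" if w: "w \<in> ?W - piv ` (P0 \<union> K)" for w
  proof (rule vel_not_pivot, rule notI)
    assume "w \<in> pivots"
    then consider i k where "w = (i, 0, k)" "(i, k) \<in> P0" | e where "e \<in> E - P0" "w = b (e, M (fst e) 0)"
      by (auto simp: pivots_def)
    then show False
    proof cases
      case 1
      then have "w = piv (i, k)" by (simp add: piv_def)
      then show False using w 1 by blast
    next
      case 2
      have "w \<notin> A0" using 2 A0_sub b_notin by blast
      then obtain e' \<mu> where e': "e' \<in> K" "\<mu> \<in> S e'" "w = b (e', \<mu>)" using w by auto
      then have "e = e'"
        using 2 K b_eq_iff[of e "M (fst e) 0" e' \<mu>] pivot_in_support[of e] by auto
      then have "w = piv e'" using 2 by (simp add: piv_def)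
      then show False using w e' by blast
    qed
  qed
  have "(\<Sum>w\<in>?W. q w * vel x u v w) = (\<Sum>w\<in>piv ` (P0 \<union> K). q w * vel x u v w)"
    using fin 1 2 by (intro sum.mono_neutral_right) auto
  also have "\<dots> = (\<Sum>e\<in>P0 \<union> K. q (piv e) * vel x u v (piv e))"
    by (rule sum.reindex_cong[OF piv_inj[OF P0 K]]) auto
  finally show ?thesis .
qed

lemma generic_relation_dvd:
  assumes P0: "P0 \<subseteq> E" and f: "f \<in> rel Sp0" "occurring f \<subseteq> A0 \<union> C0"
  shows "R dvd f"
proof (rule ccontr)
  assume "\<not> R dvd f"
  then have "bad f" using f by (simp add: bad_def)
  then obtain g where g: "bad g" "\<And>v. v \<in> occurring g \<Longrightarrow> v \<in> C0 \<Longrightarrow> pd v g \<notin> rel Sp0"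
    using minimal_bad[OF P0] by blast
  have g_rel: "g \<in> rel Sp0" using g by (simp add: bad_def)
  define K where "K = {e \<in> E - P0. \<exists>\<mu>\<in>S e. b (e, \<mu>) \<in> occurring g}"
  let ?W = "A0 \<union> b ` Sigma K S" and ?T = "P0 \<union> K"
  have K: "K \<subseteq> E - P0" by (auto simp: K_def)
  have finK: "finite K" using finite_subset[OF K] finite_E by simp
  have finW: "finite ?W" using finite_A0 finK by auto
  have occ_g: "occurring g \<subseteq> ?W"
  proof
    fix v assume v: "v \<in> occurring g"
    then have "v \<in> A0 \<union> C0" using g(1) by (auto simp: bad_def)
    then show "v \<in> ?W"
    proof
      assume "v \<in> C0"
      then obtain e \<mu> where e: "e \<in> E - P0" "\<mu> \<in> S e" "v = b (e, \<mu>)" unfolding C0_def by auto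
      then have "e \<in> K" unfolding K_def using v by auto
      then show ?thesis using e by auto
    qed simp
  qed
  have blocks: "\<exists>k. (i, k) \<in> K" if "i \<in> I0" for i
    using relation_meets_all_blocks[OF P0 K g_rel _ occ_g that] g(1) by (simp add: bad_def)
  obtain e0 where e0: "e0 \<in> P0" "piv e0 \<in> occurring R" using ex_pivot_in_R[OF P0] by auto
  obtain h0 where h0: "h0 \<in> K" using blocks I0_nonempty by blast
  have "\<forall>e\<in>K. \<exists>\<mu>. \<mu> \<in> S e \<and> b (e, \<mu>) \<in> occurring g" unfolding K_def by blast
  from bchoice[OF this] obtain m where m: "\<And>e. e \<in> K \<Longrightarrow> m e \<in> S e \<and> b (e, m e) \<in> occurring g"
    by blast
  \<comment> \<open>One nonvanishing condition per equation is enough: \<open>ratio_relation\<close>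
    carries it over to all monomials of that equation.\<close>
  let ?G = "insert (pd (piv e0) R) ((\<lambda>e. pd (b (e, m e)) g) ` K)"
  have dG: "?G \<inter> rel Sp0 = {}"
  proof -
    have "pd (b (e, m e)) g \<notin> rel Sp0" if "e \<in> K" for e
    proof (rule g(2))
      show "b (e, m e) \<in> C0" unfolding C0_def using m[OF that] that K by (intro imageI) auto
    qed (use m[OF that] in simp)
    then show ?thesis using pd_R_not_rel[OF P0 e0(2)] by auto
  qed
  have finG: "finite ?G" using finK by simp
  obtain x u where s: "sol Sp0 x u" and nz: "\<And>h. h \<in> ?G \<Longrightarrow> peval of_rat x h \<noteq> 0"
    using generic_solution[OF P0 finG dG] by blast
  have u: "u v \<noteq> 0" for v using s by (rule sol_nonzero)
  have g_nz: "peval of_rat x (pd (b (e, \<mu>)) g) \<noteq> 0" if "e \<in> K" "\<mu> \<in> S e" for e \<mu>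
  proof -
    have "peval of_rat x (pd (b (e, m e)) g) * lmev u \<mu> = peval of_rat x (pd (b (e, \<mu>)) g) * lmev u (m e)"
      by (rule ratio_relation[OF P0 s g_rel]) (use that m K in auto)
    moreover have "peval of_rat x (pd (b (e, m e)) g) \<noteq> 0" using nz that by simp
    ultimately show ?thesis using lmev_nonzero[of u \<mu>, OF u] by auto
  qed
  \<comment> \<open>One velocity vector per equation; R and g yield two linear relations between
    these vectors.\<close>
  define A where "A e v = vel x u v (piv e)" for e v
  define cR where "cR e = (peval of_rat x (pd (piv e) R) :: complex)" for e
  define cG where "cG e = (peval of_rat x (pd (piv e) g) :: complex)" for e
  have relR: "(\<Sum>e\<in>?T. cR e * A e v) = 0" for v
    using velocity_relation[OF P0 s R_in_rel[OF P0 subset_refl] finW, of v] occurring_R_A0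
    unfolding sum_over_pivots[OF P0 K] cR_def A_def by blast
  have relG: "(\<Sum>e\<in>?T. cG e * A e v) = 0" for v
    using velocity_relation[OF P0 s g_rel finW occ_g, of v]
    unfolding sum_over_pivots[OF P0 K] cG_def A_def .
  have finT: "finite ?T" using finite_P0 finK by simp
  have disj: "P0 \<inter> K = {}" using K by auto
  have e0T: "e0 \<in> ?T" "cR e0 \<noteq> 0" using e0 nz by (auto simp: cR_def)
  let ?T1 = "?T - {e0}"
  define c1 where "c1 e = cG e - cG e0 * cR e / cR e0" for e
  \<comment> \<open>The relation of R does not involve h0 whereas that of g does. So the second
    relation still has a nonzero coefficient at h0 after e0 has been eliminated by the first, and
    both equations can be removed.\<close>
  have "cR h0 = 0"
    using h0 K R_free by (auto simp: cR_def piv_def pd_free)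
  moreover have "cG h0 \<noteq> 0"
    using h0 K g_nz[OF h0 pivot_in_support[of h0]] by (auto simp: cG_def piv_def)
  ultimately have h0T: "h0 \<in> ?T1" "c1 h0 \<noteq> 0"
    using h0 e0 disj by (auto simp: c1_def)
  have rel1: "(\<Sum>e\<in>?T1. c1 e * A e v) = 0" for v
    unfolding c1_def
    by (rule trans[OF eliminate_from_combination[OF finT e0T relR, where q = cG, symmetric] relG])
  let ?T2 = "?T1 - {h0}"
  have span: "\<exists>q'. \<forall>v. (\<Sum>e\<in>?T. q e * A e v) = (\<Sum>e\<in>?T2. q' e * A e v)" for q
    using eliminate_from_combination[OF finT e0T relR, where q = q]
      eliminate_from_combination[OF finite_Diff[OF finT] h0T rel1, where q = "\<lambda>e. q e - q e0 * cR e / cR e0"]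
    by (intro exI[of _ "\<lambda>e. q e - q e0 * cR e / cR e0 - (q h0 - q e0 * cR h0 / cR e0) * c1 e / c1 h0"] allI) (rule trans)
  \<comment> \<open>All exponent differences will be shown to lie in the span of the rows in
    \<open>?T2\<close>, where a vector vanishing on J is 0. This collides with the nonzero lattice
    vector vanishing on J that \<open>full_rank\<close> provides.\<close>
  obtain J where J: "finite J" "card J \<le> card ?T2"
    "\<And>q. (\<forall>v\<in>J. (\<Sum>e\<in>?T2. q e * A e v) = 0) \<Longrightarrow> (\<forall>v. (\<Sum>e\<in>?T2. q e * A e v) = 0)"
    using ex_separating_coordinates[of ?T2 A] finT by blast
  have "card ?T2 + 2 = card ?T"
    using card_Suc_Diff1[OF finT e0T(1)] card_Suc_Diff1[OF finite_Diff[OF finT] h0T(1)] by linarith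
  then have cardJ: "card J + 2 \<le> card ?T" using J(2) by linarith
  have TE: "?T \<subseteq> E" using P0 K by auto
  obtain \<delta> where \<delta>: "\<delta> \<in> lattice_of S ?T" "\<delta> \<noteq> 0" "\<And>v. v \<in> J \<Longrightarrow> lookup \<delta> v = 0"
    using full_rank[OF TE J(1) cardJ] by blast
  have diffK: "\<exists>q. \<forall>v. of_int (lookup \<mu> v - lookup \<nu> v) = (\<Sum>e\<in>?T2. q e * A e v)"
    if e: "e \<in> K" "\<mu> \<in> S e" "\<nu> \<in> S e" for e \<mu> \<nu>
  proof -
    have eK: "e \<in> E - P0" using e K by auto
    obtain q where q: "\<And>v. of_int (lookup \<mu> v - lookup \<nu> v) = (\<Sum>w\<in>?W. q w * vel x u v w)"
      using exponent_combination[OF P0 s g_rel eK e(2,3) finW occ_g g_nz[OF e(1,2)]] by blast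
    then have "of_int (lookup \<mu> v - lookup \<nu> v) = (\<Sum>e\<in>?T. q (piv e) * A e v)" for v
      by (simp only: sum_over_pivots[OF P0 K] A_def)
    then show ?thesis using span[of "\<lambda>e. q (piv e)"] by simp
  qed
  have diffT: "\<exists>q. \<forall>v. of_int (lookup \<mu> v - lookup \<nu> v) = (\<Sum>e\<in>?T2. q e * A e v)"
    if e: "e \<in> ?T" "\<mu> \<in> S e" "\<nu> \<in> S e" for e \<mu> \<nu>
  proof (cases "e \<in> K")
    case False
    then have eP: "e \<in> P0" using e by auto
    then have "fst e \<in> I0" "snd e \<le> r (fst e)" by (auto simp: P0_def)
    \<comment> \<open>The ratio argument does not apply to the specialized equations; their supports
      are contained in that of a higher derivative in K.\<close>
    then obtain k where k: "(fst e, k) \<in> K" using blocks by blast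
    then have "(fst e, k) \<notin> P0" using K by auto
    then have "snd e \<le> k" using eP by (auto simp: P0_def)
    then have "S e \<subseteq> S (fst e, k)" using keys_der_F_mono[of "snd e" k l M "fst e"] by simp
    then show ?thesis using diffK[OF k] e by blast
  qed (use diffK e in blast)
  have comb: "\<exists>q. \<forall>v. of_int (lookup \<delta> v) = (\<Sum>e\<in>?T2. q e * A e v)" if "\<delta> \<in> lattice_of S ?T" for \<delta>
    using that
  proof (induction rule: lattice_of.induct)
    case zero
    show ?case by (intro exI[of _ "\<lambda>_. 0"]) simp
  next
    case (step \<delta> e \<mu> \<nu>)
    obtain q where q: "\<And>v. of_int (lookup \<delta> v) = (\<Sum>e\<in>?T2. q e * A e v)"
      using step.IH by blast
    obtain q' where q': "\<And>v. of_int (lookup \<mu> v - lookup \<nu> v) = (\<Sum>e\<in>?T2. q' e * A e v)"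
      using diffT[OF step.hyps(2-4)] by blast
    show ?case
    proof (intro exI[of _ "\<lambda>e. q e + q' e"] allI)
      fix v
      have "of_int (lookup (\<delta> + (\<mu> - \<nu>)) v) = (of_int (lookup \<delta> v) + of_int (lookup \<mu> v - lookup \<nu> v) :: complex)"
        by (simp add: lookup_add lookup_minus)
      also have "\<dots> = (\<Sum>e\<in>?T2. (q e + q' e) * A e v)"
        unfolding q q' by (simp only: distrib_right sum.distrib)
      finally show "of_int (lookup (\<delta> + (\<mu> - \<nu>)) v) = (\<Sum>e\<in>?T2. (q e + q' e) * A e v)" .
    qed
  qed
  obtain q where q: "\<And>v. of_int (lookup \<delta> v) = (\<Sum>e\<in>?T2. q e * A e v)" using comb[OF \<delta>(1)] by blast
  have "\<forall>v\<in>J. (\<Sum>e\<in>?T2. q e * A e v) = 0"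
    using \<delta>(3) by (simp flip: q)
  then have zero: "\<forall>v. (\<Sum>e\<in>?T2. q e * A e v) = 0" by (rule J(3))
  have "lookup \<delta> v = 0" for v
  proof -
    have "(of_int (lookup \<delta> v) :: complex) = 0" unfolding q using zero by blast
    then show ?thesis by simp
  qed
  then have "\<delta> = 0" by (intro poly_mapping_eqI) simp
  then show False using \<delta>(2) by simp
qed

theorem R_dvd_specialized:
  "R dvd peval const (\<lambda>p. lookup (F (fst p)) (snd p)) Q"
proof -
  let ?\<xi> = "\<lambda>p. lookup (F (fst p)) (snd p)"
  have rel: "peval const (cf Sp) Q \<in> rel Sp" for Sp
    unfolding rel_def
  proof (intro CollectI allI impI)
    fix x u assume s: "sol Sp x u"
    have "peval of_rat x (peval const (cf Sp) Q) = peval of_rat (\<lambda>p. peval of_rat x (cf Sp p)) Q"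
      by (rule peval_peval) auto
    also have "\<dots> = 0"
      by (rule Q_vanishes[of u]) (use s in \<open>auto simp: sol_def\<close>)
    finally show "peval of_rat x (peval const (cf Sp) Q) = 0" .
  qed
  show ?thesis
  proof (cases "\<exists>i\<in>I0. \<forall>k. (i, k) \<in> E \<longrightarrow> k \<le> r i")
    case True
    then obtain i where i: "i \<in> I0" "\<And>k. (i, k) \<in> E \<Longrightarrow> k \<le> r i" by blast
    let ?f = "peval const (cf (Sigma E S)) Q"
    have eq: "peval const ?\<xi> Q = ?f"
      by (rule peval_cong) (use Q_occ in \<open>auto simp: cf_def\<close>)
    have occ: "occurring ?f \<subseteq> (\<Union>e\<in>E. A_eq e)"
    proof -
      have "occurring ?f \<subseteq> (\<Union>p\<in>occurring Q. occurring (cf (Sigma E S) p))" by (rule occurring_peval)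
      also have "\<dots> \<subseteq> (\<Union>e\<in>E. A_eq e)"
      proof (rule UN_least)
        fix p assume "p \<in> occurring Q"
        then have "p \<in> Sigma E S" using Q_occ by blast
        moreover have "occurring (?\<xi> p) \<subseteq> A_eq (fst p)"
          using occurring_coeff[of "fst p" "snd p"] unfolding A_eq_def .
        moreover have "fst p \<in> E" using \<open>p \<in> Sigma E S\<close> by auto
        then have "A_eq (fst p) \<subseteq> (\<Union>e\<in>E. A_eq e)" by (rule UN_upper)
        ultimately show "occurring (cf (Sigma E S) p) \<subseteq> (\<Union>e\<in>E. A_eq e)"
          unfolding cf_def by (simp only: if_True)
      qed
      finally show ?thesis .
    qed
    have "A_eq e \<subseteq> A_derivs n l" if "e \<in> E" for e
      using that E_sub by (cases e) (auto simp: A_eq_def A_derivs_def)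
    then have "?f \<in> D_ring n l" using occ by (fastforce simp: D_ring_def)
    then have "?f \<in> elimination_ideal n l M" using rel by (intro special_imp_elimination[of E]) auto
    moreover have "(i, m, d) \<notin> occurring ?f" if "r i < d" for m d
      using occ i(2) that by (fastforce simp: A_eq_def)
    ultimately show ?thesis unfolding eq by (rule low_order_dvd[OF _ i(1)])
  next
    case False
    have P0: "P0 \<subseteq> E"
    proof
      fix e assume e: "e \<in> P0"
      then obtain i k where ik: "e = (i, k)" "i \<in> I0" "k \<le> r i" by (auto simp: P0_def)
      then obtain k' where "(i, k') \<in> E" "r i < k'" using False by (auto simp: not_le)
      then show "e \<in> E" using E_down[of i k' k] ik by auto
    qed
    let ?f = "peval const (cf Sp0) Q"
    have "occurring ?f \<subseteq> (\<Union>p\<in>occurring Q. occurring (cf Sp0 p))" by (rule occurring_peval)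
    also have "\<dots> \<subseteq> A0 \<union> C0"
    proof (rule UN_least)
      fix p assume "p \<in> occurring Q"
      then have p: "p \<in> Sigma E S" using Q_occ by blast
      show "occurring (cf Sp0 p) \<subseteq> A0 \<union> C0"
      proof (cases "fst p \<in> P0")
        case True
        then have "cf Sp0 p = ?\<xi> p" using p by (auto simp: cf_def)
        moreover have "occurring (?\<xi> p) \<subseteq> A0"
          using occurring_coeff[of "fst p" "snd p"] True by (cases p) (fastforce simp: A0_def P0_def)
        ultimately show ?thesis by auto
      next
        case False
        then have "cf Sp0 p = pvar (b p)" by (auto simp: cf_def)
        moreover have "b p \<in> C0" unfolding C0_def using False p by (intro imageI) auto
        ultimately show ?thesis by simp
      qed
    qed
    finally have dvd: "R dvd ?f" by (rule generic_relation_dvd[OF P0 rel])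
    \<comment> \<open>Specializes the generic coefficients that are left. R is free of them, so
      divisibility survives.\<close>
    define T where "T v = (if v \<in> b ` Sigma E S then ?\<xi> (inv_into (Sigma E S) b v) else pvar v)" for v
    have Tb: "T (b p) = ?\<xi> p" if "p \<in> Sigma E S" for p
      using that inv_into_f_f[OF b_inj that] by (simp add: T_def)
    have TA: "peval const T q = q" if "occurring q \<subseteq> A_derivs n l" for q
    proof -
      have "peval const T q = peval const pvar q"
        by (rule peval_cong) (use that b_notin in \<open>auto simp: T_def\<close>)
      then show ?thesis by simp
    qed
    have "peval const T ?f = peval const (\<lambda>p. peval const T (cf Sp0 p)) Q"
      by (rule peval_peval) auto
    also have "\<dots> = peval const ?\<xi> Q"
    proof (rule peval_cong)
      fix p assume "p \<in> occurring Q"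
      then have p: "p \<in> Sigma E S" using Q_occ by blast
      have "occurring (?\<xi> p) \<subseteq> A_derivs n l"
        using occurring_coeff[of "fst p" "snd p"] p E_sub by (fastforce simp: A_derivs_def)
      then show "peval const T (cf Sp0 p) = ?\<xi> p"
        using Tb[OF p] TA by (simp add: cf_def)
    qed
    finally have eq: "peval const T ?f = peval const ?\<xi> Q" .
    obtain h where "?f = R * h" using dvd by auto
    then have "peval const ?\<xi> Q = R * peval const T h"
      unfolding eq[symmetric] by (simp add: peval_mult TA[OF occurring_R])
    then show ?thesis by (rule dvdI)
  qed
qed

end

section \<open>Counting monomials\<close>

lemma ex_linear_relation:
  fixes A :: "'i \<Rightarrow> 'g \<Rightarrow> 'k::field"
  assumes "finite G" "finite I" "card G < card I"
  shows "\<exists>x. (\<exists>i\<in>I. x i \<noteq> 0) \<and> (\<forall>g\<in>G. (\<Sum>i\<in>I. x i * A i g) = 0)"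
  using assms
proof (induction G arbitrary: I A rule: finite_induct)
  case empty
  then obtain i where "i \<in> I" by fastforce
  then show ?case by (intro exI[of _ "\<lambda>_. 1"]) auto
next
  case (insert g G)
  show ?case
  proof (cases "\<forall>i\<in>I. A i g = 0")
    case True
    have "card G < card I" using insert by simp
    then obtain x where "\<exists>i\<in>I. x i \<noteq> 0" "\<forall>g\<in>G. (\<Sum>i\<in>I. x i * A i g) = 0"
      using insert.IH[OF insert.prems(1)] by blast
    then show ?thesis using True by (intro exI[of _ x]) auto
  next
    case False
    then obtain i0 where i0: "i0 \<in> I" "A i0 g \<noteq> 0" by auto
    let ?I = "I - {i0}"
    have "card G < card ?I" using insert i0 by (simp add: card_Diff_singleton)
    then obtain x where x: "\<exists>i\<in>?I. x i \<noteq> 0"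
      "\<And>g'. g' \<in> G \<Longrightarrow> (\<Sum>i\<in>?I. x i * (A i g' - A i g / A i0 g * A i0 g')) = 0"
      using insert.IH[of ?I "\<lambda>i g'. A i g' - A i g / A i0 g * A i0 g'"] insert.prems by auto
    define y where "y i = (if i = i0 then - (\<Sum>i\<in>?I. x i * A i g) / A i0 g else x i)" for i
    have y: "(\<Sum>i\<in>I. y i * A i g') = (\<Sum>i\<in>?I. x i * (A i g' - A i g / A i0 g * A i0 g'))" for g'
    proof -
      have "(\<Sum>i\<in>I. y i * A i g') = y i0 * A i0 g' + (\<Sum>i\<in>?I. y i * A i g')"
        by (rule sum.remove[OF insert.prems(1) i0(1)])
      also have "(\<Sum>i\<in>?I. y i * A i g') = (\<Sum>i\<in>?I. x i * A i g')"
        by (intro sum.cong) (auto simp: y_def)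
      also have "y i0 * A i0 g' = - (\<Sum>i\<in>?I. x i * (A i g / A i0 g * A i0 g'))"
        by (simp add: y_def sum_distrib_right sum_divide_distrib mult.assoc)
      finally show ?thesis by (simp add: right_diff_distrib sum_subtractf)
    qed
    have "\<forall>g'\<in>insert g G. (\<Sum>i\<in>I. y i * A i g') = 0"
    proof
      fix g' assume "g' \<in> insert g G"
      then show "(\<Sum>i\<in>I. y i * A i g') = 0"
        using x(2) i0 by (auto simp: y)
    qed
    moreover have "\<exists>i\<in>I. y i \<noteq> 0" using x(1) by (auto simp: y_def)
    ultimately show ?thesis by blast
  qed
qed

section \<open>The lattice of exponent differences\<close>

lemma lattice_of_add: "\<gamma> \<in> lattice_of S W \<Longrightarrow> \<delta> \<in> lattice_of S W \<Longrightarrow> \<delta> + \<gamma> \<in> lattice_of S W"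
proof (induction rule: lattice_of.induct)
  case (step \<gamma> e \<mu> \<nu>)
  then show ?case using lattice_of.step[of "\<delta> + \<gamma>" S W e \<mu> \<nu>] by (simp add: add.assoc)
qed simp

lemma lattice_of_diff: "e \<in> W \<Longrightarrow> \<mu> \<in> S e \<Longrightarrow> \<nu> \<in> S e \<Longrightarrow> \<mu> - \<nu> \<in> lattice_of S W"
  using lattice_of.step[OF lattice_of.zero] by fastforce

lemma lattice_of_uminus: "\<delta> \<in> lattice_of S W \<Longrightarrow> - \<delta> \<in> lattice_of S W"
proof (induction rule: lattice_of.induct)
  case zero
  show ?case by (simp add: lattice_of.zero)
next
  case (step \<delta> e \<mu> \<nu>)
  then show ?case using lattice_of.step[of "- \<delta>" S W e \<nu> \<mu>] by (simp add: algebra_simps)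
qed

lemma lattice_of_minus: "\<gamma> \<in> lattice_of S W \<Longrightarrow> \<delta> \<in> lattice_of S W \<Longrightarrow> \<gamma> - \<delta> \<in> lattice_of S W"
  using lattice_of_add[OF lattice_of_uminus, of \<delta> S W \<gamma>] by simp

text \<open>More equations than coordinates needed to separate their exponent differences. Equation
  h is solved for the coefficient of a h, while the coefficient of c h serves to adjust the
  degree.\<close>

locale deficient_system =
  fixes As :: "'e \<Rightarrow> ('v \<Rightarrow>\<^sub>0 int) set" and H :: "'e set" and J :: "'v set" and a c :: "'e \<Rightarrow> ('v \<Rightarrow>\<^sub>0 int)"
  assumes finite_As: "h \<in> H \<Longrightarrow> finite (As h)" and finite_H: "finite H" and finite_J: "finite J"
    and J_small: "card J < card H"
    and separating: "\<delta> \<in> lattice_of As H \<Longrightarrow> (\<And>v. v \<in> J \<Longrightarrow> lookup \<delta> v = 0) \<Longrightarrow> \<delta> = 0"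
    and ac: "h \<in> H \<Longrightarrow> a h \<in> As h" "h \<in> H \<Longrightarrow> c h \<in> As h" "h \<in> H \<Longrightarrow> a h \<noteq> c h"
begin

definition solves :: "('e \<times> ('v \<Rightarrow>\<^sub>0 int) \<Rightarrow> complex) \<Rightarrow> ('v \<Rightarrow> complex) \<Rightarrow> bool" where
  "solves z \<eta> \<longleftrightarrow> (\<forall>v. \<eta> v \<noteq> 0) \<and> (\<forall>h\<in>H. (\<Sum>\<alpha>\<in>As h. z (h, \<alpha>) * lmev \<eta> \<alpha>) = 0)"

text \<open>A crude bound; what matters is that it does not depend on the degree, so that the size
  of \<open>mons\<close> is polynomial in the degree.\<close>

definition bnd :: nat where
  "bnd = (\<Sum>h\<in>H. \<Sum>\<alpha>\<in>As h. \<Sum>v\<in>J. nat \<bar>lookup (\<alpha> - a h) v\<bar>)"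

lemma bnd: "h \<in> H \<Longrightarrow> \<alpha> \<in> As h \<Longrightarrow> v \<in> J \<Longrightarrow> \<bar>lookup (\<alpha> - a h) v\<bar> \<le> int bnd"
proof -
  assume *: "h \<in> H" "\<alpha> \<in> As h" "v \<in> J"
  have "nat \<bar>lookup (\<alpha> - a h) v\<bar> \<le> (\<Sum>v\<in>J. nat \<bar>lookup (\<alpha> - a h) v\<bar>)"
    using * finite_J by (intro member_le_sum) auto
  also have "\<dots> \<le> (\<Sum>\<alpha>\<in>As h. \<Sum>v\<in>J. nat \<bar>lookup (\<alpha> - a h) v\<bar>)"
    using * finite_As by (intro member_le_sum[where f = "\<lambda>\<alpha>. \<Sum>v\<in>J. nat \<bar>lookup (\<alpha> - a h) v\<bar>"]) auto
  also have "\<dots> \<le> bnd"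
    unfolding bnd_def using * finite_H
    by (intro member_le_sum[where f = "\<lambda>h. \<Sum>\<alpha>\<in>As h. \<Sum>v\<in>J. nat \<bar>lookup (\<alpha> - a h) v\<bar>"]) auto
  finally show ?thesis by linarith
qed

text \<open>The monomials that can occur in a multihomogeneous polynomial of multidegree \<open>t\<close> after the
  coefficients of the monomials \<open>a h\<close> have been eliminated.\<close>

definition mons :: "('e \<Rightarrow> nat) \<Rightarrow> (('e \<times> ('v \<Rightarrow>\<^sub>0 int) \<Rightarrow>\<^sub>0 nat) \<times> ('v \<Rightarrow>\<^sub>0 int)) set" where
  "mons t = {(f, \<delta>). keys f \<subseteq> (SIGMA h:H. As h - {a h}) \<and> (\<forall>h\<in>H. (\<Sum>\<alpha>\<in>As h. lookup f (h, \<alpha>)) = t h)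
    \<and> \<delta> \<in> lattice_of As H \<and> (\<forall>v\<in>J. \<bar>lookup \<delta> v\<bar> \<le> int (bnd * sum t H))}"

text \<open>The exponents left to choose: those at a h are 0 after elimination, and those at c h are
  forced by the degree.\<close>

definition idx :: "('e \<times> ('v \<Rightarrow>\<^sub>0 int)) set" where
  "idx = (SIGMA h:H. As h - {a h, c h})"

lemma finite_idx: "finite idx"
  unfolding idx_def using finite_H finite_As by auto

text \<open>A pair is determined by its exponents in \<open>idx\<close> and the coordinates of
  \<delta> in J: the degree gives back the exponent at c h, and \<open>separating\<close> gives back
  \<delta>.\<close>

lemma mons_bound:
  assumes "\<And>h. h \<in> H \<Longrightarrow> t h = T"
  shows "finite (mons t)" "card (mons t) \<le> (T + 1) ^ card idx * (2 * (bnd * (card H * T)) + 1) ^ card J"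
proof -
  let ?B = "int (bnd * (card H * T))"
  define enc where "enc s = (restrict (lookup (fst s)) idx, restrict (lookup (snd s)) J)"
    for s :: "('e \<times> ('v \<Rightarrow>\<^sub>0 int) \<Rightarrow>\<^sub>0 nat) \<times> ('v \<Rightarrow>\<^sub>0 int)"
  let ?C = "(idx \<rightarrow>\<^sub>E {..T}) \<times> (J \<rightarrow>\<^sub>E {- ?B..?B})"
  have sumt: "sum t H = card H * T" using assms by simp
  have inj: "inj_on enc (mons t)"
  proof (rule inj_onI)
    fix s s' assume s: "s \<in> mons t" "s' \<in> mons t" "enc s = enc s'"
    obtain f \<delta> f' \<delta>' where eq: "s = (f, \<delta>)" "s' = (f', \<delta>')" by (cases s; cases s')
    have re: "restrict (lookup f) idx = restrict (lookup f') idx" "restrict (lookup \<delta>) J = restrict (lookup \<delta>') J"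
      using s(3) by (simp_all add: enc_def eq)
    have f_idx: "lookup f p = lookup f' p" if "p \<in> idx" for p
      using fun_cong[OF re(1), of p] that by simp
    have \<delta>J: "lookup \<delta> v = lookup \<delta>' v" if "v \<in> J" for v
      using fun_cong[OF re(2), of v] that by simp
    have "\<delta> - \<delta>' = 0"
      using s \<delta>J by (intro separating lattice_of_minus) (auto simp: mons_def eq lookup_minus)
    moreover have "f = f'"
    proof (rule poly_mapping_eqI)
      fix p :: "'e \<times> ('v \<Rightarrow>\<^sub>0 int)"
      obtain h \<alpha> where p: "p = (h, \<alpha>)" by (cases p)
      have fa: "lookup f (h, a h) = 0" "lookup f' (h, a h) = 0" for h
        using s by (auto simp: mons_def eq in_keys_iff subset_iff)
      consider "p \<notin> (SIGMA h:H. As h - {a h})" | "p \<in> idx" | "h \<in> H" "\<alpha> = c h"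
        by (auto simp: idx_def p)
      then show "lookup f p = lookup f' p"
      proof cases
        case 1
        then have "p \<notin> keys f" "p \<notin> keys f'" using s by (auto simp: mons_def eq)
        then show ?thesis by (simp add: in_keys_iff)
      next
        case 3
        have split: "(\<Sum>\<alpha>\<in>As h. lookup g (h, \<alpha>)) = lookup g (h, c h) + (lookup g (h, a h) + (\<Sum>\<alpha>\<in>As h - {c h} - {a h}. lookup g (h, \<alpha>)))"
          for g :: "'e \<times> ('v \<Rightarrow>\<^sub>0 int) \<Rightarrow>\<^sub>0 nat"
          using 3 ac finite_As by (simp add: sum.remove[of _ "c h"] sum.remove[of _ "a h"])
        have "(\<Sum>\<alpha>\<in>As h - {c h} - {a h}. lookup f (h, \<alpha>)) = (\<Sum>\<alpha>\<in>As h - {c h} - {a h}. lookup f' (h, \<alpha>))"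
          using 3 by (intro sum.cong f_idx) (auto simp: idx_def)
        moreover have "(\<Sum>\<alpha>\<in>As h. lookup f (h, \<alpha>)) = (\<Sum>\<alpha>\<in>As h. lookup f' (h, \<alpha>))"
          using s 3 by (simp add: mons_def eq)
        ultimately show ?thesis unfolding split using fa 3 p by simp
      qed (rule f_idx)
    qed
    ultimately show "s = s'" by (simp add: eq)
  qed
  have img: "enc ` mons t \<subseteq> ?C"
  proof (rule image_subsetI)
    fix s assume s: "s \<in> mons t"
    obtain f \<delta> where eq: "s = (f, \<delta>)" by (cases s)
    have "lookup f (h, \<alpha>) \<le> T" if "(h, \<alpha>) \<in> idx" for h \<alpha>
    proof -
      have h: "h \<in> H" "\<alpha> \<in> As h" using that by (auto simp: idx_def)
      have "lookup f (h, \<alpha>) \<le> (\<Sum>\<alpha>\<in>As h. lookup f (h, \<alpha>))"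
        using h finite_As by (intro member_le_sum[where f = "\<lambda>\<alpha>. lookup f (h, \<alpha>)"]) auto
      then show ?thesis using s h assms by (auto simp: mons_def eq)
    qed
    moreover have "lookup \<delta> v \<in> {- ?B..?B}" if "v \<in> J" for v
    proof -
      have "\<bar>lookup \<delta> v\<bar> \<le> ?B" using s that sumt by (auto simp: mons_def eq)
      then show ?thesis by auto
    qed
    ultimately show "enc s \<in> ?C" by (auto simp: enc_def eq)
  qed
  have fin: "finite ?C" using finite_idx finite_J by (intro finite_cartesian_product finite_PiE) auto
  show "finite (mons t)" by (rule inj_on_finite[OF inj img fin])
  have "card (mons t) \<le> card ?C" by (rule card_inj_on_le[OF inj img fin])
  also have "\<dots> = (T + 1) ^ card idx * (2 * (bnd * (card H * T)) + 1) ^ card J"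
    using finite_idx finite_J by (simp add: card_cartesian_product card_PiE nat_add_distrib nat_mult_distrib mult_ac)
  finally show "card (mons t) \<le> (T + 1) ^ card idx * (2 * (bnd * (card H * T)) + 1) ^ card J" .
qed

section \<open>Few functions span all monomials of a given degree on solvable systems\<close>

definition chi :: "(('e \<times> ('v \<Rightarrow>\<^sub>0 int) \<Rightarrow>\<^sub>0 nat) \<times> ('v \<Rightarrow>\<^sub>0 int)) \<Rightarrow> ('e \<times> ('v \<Rightarrow>\<^sub>0 int) \<Rightarrow> complex) \<Rightarrow> ('v \<Rightarrow> complex) \<Rightarrow> complex" where
  "chi s z \<eta> = mev z (fst s) * lmev \<eta> (snd s)"

definition representable :: "('e \<Rightarrow> nat) \<Rightarrow> (('e \<times> ('v \<Rightarrow>\<^sub>0 int) \<Rightarrow> complex) \<Rightarrow> complex) \<Rightarrow> bool" where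
  "representable t \<phi> \<longleftrightarrow> (\<exists>A D. finite D \<and> D \<subseteq> mons t \<and> (\<forall>z \<eta>. solves z \<eta> \<longrightarrow> \<phi> z = (\<Sum>s\<in>D. A s * chi s z \<eta>)))"

text \<open>Pairs multiply by adding both components. Several products may coincide, so the
  coefficients are collected over the fibres of \<open>pl\<close>.\<close>

lemma representable_mult:
  assumes "representable t \<phi>" "representable t' \<psi>"
  shows "representable (\<lambda>h. t h + t' h) (\<lambda>z. \<phi> z * \<psi> z)"
proof -
  obtain A D where A: "finite D" "D \<subseteq> mons t" "\<And>z \<eta>. solves z \<eta> \<Longrightarrow> \<phi> z = (\<Sum>s\<in>D. A s * chi s z \<eta>)"
    using assms(1) by (auto simp: representable_def)
  obtain A' D' where A': "finite D'" "D' \<subseteq> mons t'" "\<And>z \<eta>. solves z \<eta> \<Longrightarrow> \<psi> z = (\<Sum>s\<in>D'. A' s * chi s z \<eta>)"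
    using assms(2) by (auto simp: representable_def)
  define pl where "pl = (\<lambda>((f, \<delta>), (f', \<delta>')). (f + f', \<delta> + \<delta>') :: ('e \<times> ('v \<Rightarrow>\<^sub>0 int) \<Rightarrow>\<^sub>0 nat) \<times> ('v \<Rightarrow>\<^sub>0 int))"
  define P where "P = D \<times> D'"
  have fin: "finite P" using A(1) A'(1) by (simp add: P_def)
  have chi_pl: "chi (pl (s, s')) z \<eta> = chi s z \<eta> * chi s' z \<eta>" if "solves z \<eta>" for s s' z \<eta>
    using that by (cases s; cases s') (simp add: pl_def chi_def mev_add lmev_add solves_def)
  have sub: "pl ` P \<subseteq> mons (\<lambda>h. t h + t' h)"
  proof (rule image_subsetI)
    fix p assume "p \<in> P"
    then have mem: "fst p \<in> mons t" "snd p \<in> mons t'" using A(2) A'(2) by (auto simp: P_def)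
    obtain f \<delta> f' \<delta>' where eq: "p = ((f, \<delta>), (f', \<delta>'))" by (cases p) auto
    then have p: "p = ((f, \<delta>), (f', \<delta>'))" "(f, \<delta>) \<in> mons t" "(f', \<delta>') \<in> mons t'"
      using mem by auto
    have "keys (f + f') \<subseteq> keys f \<union> keys f'" by (rule keys_add)
    moreover have "\<bar>lookup (\<delta> + \<delta>') v\<bar> \<le> int (bnd * (sum t H + sum t' H))" if "v \<in> J" for v
    proof -
      have "\<bar>lookup \<delta> v\<bar> \<le> int (bnd * sum t H)" "\<bar>lookup \<delta>' v\<bar> \<le> int (bnd * sum t' H)"
        using p that by (auto simp: mons_def)
      then show ?thesis by (simp add: lookup_add distrib_left)
    qed
    ultimately show "pl p \<in> mons (\<lambda>h. t h + t' h)"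
      using p lattice_of_add by (auto simp: pl_def mons_def lookup_add sum.distrib)
  qed
  have "\<phi> z * \<psi> z = (\<Sum>s\<in>pl ` P. (\<Sum>p\<in>{p \<in> P. pl p = s}. A (fst p) * A' (snd p)) * chi s z \<eta>)"
    if s: "solves z \<eta>" for z \<eta>
  proof -
    have "\<phi> z * \<psi> z = (\<Sum>p\<in>P. (A (fst p) * chi (fst p) z \<eta>) * (A' (snd p) * chi (snd p) z \<eta>))"
      by (simp add: A(3)[OF s] A'(3)[OF s] sum_product sum.cartesian_product P_def split_def)
    also have "\<dots> = (\<Sum>p\<in>P. A (fst p) * A' (snd p) * chi (pl p) z \<eta>)"
      using chi_pl[OF s] by (intro sum.cong) (auto simp: mult_ac)
    also have "\<dots> = (\<Sum>s\<in>pl ` P. \<Sum>p\<in>{p \<in> P. pl p = s}. A (fst p) * A' (snd p) * chi (pl p) z \<eta>)"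
      by (rule sum.image_gen[OF fin])
    also have "\<dots> = (\<Sum>s\<in>pl ` P. (\<Sum>p\<in>{p \<in> P. pl p = s}. A (fst p) * A' (snd p)) * chi s z \<eta>)"
      by (simp add: sum_distrib_right)
    finally show ?thesis .
  qed
  then show ?thesis
    unfolding representable_def using sub fin
    by (intro exI[of _ "\<lambda>s. \<Sum>p\<in>{p \<in> P. pl p = s}. A (fst p) * A' (snd p)"] exI[of _ "pl ` P"]) auto
qed

lemma representable_one: "representable (\<lambda>_. 0) (\<lambda>_. 1)"
  unfolding representable_def
  by (intro exI[of _ "\<lambda>_. 1"] exI[of _ "{(0, 0)}"]) (auto simp: mons_def chi_def lattice_of.zero)

text \<open>For \<alpha> = a h, equation h divided by the monomial a h expresses the coefficient by
  the others. This is where exponent differences of \<eta> enter.\<close>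

lemma representable_var:
  assumes h: "h \<in> H" "\<alpha> \<in> As h"
  shows "representable (\<lambda>k. if k = h then 1 else 0) (\<lambda>z. z (h, \<alpha>))"
proof -
  let ?t = "\<lambda>k. if k = h then 1 else 0 :: nat"
  have mem: "(single (h, \<beta>) 1, \<delta>) \<in> mons ?t"
    if "\<beta> \<in> As h" "\<beta> \<noteq> a h" "\<delta> \<in> lattice_of As H" "\<And>v. v \<in> J \<Longrightarrow> \<bar>lookup \<delta> v\<bar> \<le> int bnd" for \<beta> \<delta>
  proof -
    have "(\<Sum>\<alpha>\<in>As k. lookup (single (h, \<beta>) (1::nat)) (k, \<alpha>)) = ?t k" if "k \<in> H" for k
    proof -
      have "(\<Sum>\<alpha>\<in>As k. lookup (single (h, \<beta>) (1::nat)) (k, \<alpha>)) = (\<Sum>\<alpha>\<in>As k. if \<alpha> = \<beta> then ?t k else 0)"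
        by (intro sum.cong) (auto simp: lookup_single when_def)
      also have "\<dots> = ?t k" using \<open>\<beta> \<in> As h\<close> finite_As[OF that] by auto
      finally show ?thesis .
    qed
    then show ?thesis using that h finite_H by (auto simp: mons_def)
  qed
  show ?thesis
  proof (cases "\<alpha> = a h")
    case False
    then show ?thesis
      unfolding representable_def using h
      by (intro exI[of _ "\<lambda>_. 1"] exI[of _ "{(single (h, \<alpha>) 1, 0)}"])
        (auto intro!: mem[simplified] simp: chi_def lattice_of.zero)
  next
    case True
    define s where "s \<beta> = (single (h, \<beta>) (1::nat), \<beta> - a h)" for \<beta>
    have inj: "inj_on s (As h - {a h})" by (auto simp: s_def inj_on_def)
    have "z (h, \<alpha>) = (\<Sum>q\<in>s ` (As h - {a h}). - 1 * chi q z \<eta>)" if sol: "solves z \<eta>" for z \<eta>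
    proof -
      have \<eta>: "\<eta> v \<noteq> 0" for v using sol by (simp add: solves_def)
      have nz: "lmev \<eta> (a h) \<noteq> 0" by (rule lmev_nonzero[OF \<eta>])
      have "0 = z (h, a h) * lmev \<eta> (a h) + (\<Sum>\<beta>\<in>As h - {a h}. z (h, \<beta>) * lmev \<eta> \<beta>)"
        using sum.remove[OF finite_As[OF h(1)] ac(1)[OF h(1)], of "\<lambda>\<beta>. z (h, \<beta>) * lmev \<eta> \<beta>"] sol h
        by (simp add: solves_def)
      then have "z (h, a h) = - (\<Sum>\<beta>\<in>As h - {a h}. z (h, \<beta>) * lmev \<eta> \<beta>) / lmev \<eta> (a h)"
        using nz by (simp add: field_simps eq_neg_iff_add_eq_0)
      also have "\<dots> = (\<Sum>\<beta>\<in>As h - {a h}. - 1 * chi (s \<beta>) z \<eta>)"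
        by (simp add: s_def chi_def lmev_diff[OF \<eta>] sum_divide_distrib sum_negf)
      also have "\<dots> = (\<Sum>q\<in>s ` (As h - {a h}). - 1 * chi q z \<eta>)"
        by (simp add: sum.reindex[OF inj])
      finally show ?thesis using True by simp
    qed
    moreover have "s ` (As h - {a h}) \<subseteq> mons ?t"
      using h ac(1) bnd by (auto simp: s_def intro!: mem[simplified] lattice_of_diff)
    ultimately show ?thesis
      unfolding representable_def using finite_As[OF h(1)]
      by (intro exI[of _ "\<lambda>_. - 1"] exI[of _ "s ` (As h - {a h})"]) auto
  qed
qed

lemma representable_mev:
  assumes "keys m \<subseteq> Sigma H As"
  shows "representable (\<lambda>h. \<Sum>\<alpha>\<in>As h. lookup m (h, \<alpha>)) (\<lambda>z. mev z m)"
  using assms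
proof (induction m rule: monom_induct)
  case zero
  show ?case using representable_one by simp
next
  case (add p m)
  obtain h \<alpha> where p: "p = (h, \<alpha>)" "h \<in> H" "\<alpha> \<in> As h" using add by auto
  have rep: "representable (\<lambda>k. (if k = h then 1 else 0) + (\<Sum>\<alpha>\<in>As k. lookup m (k, \<alpha>))) (\<lambda>z. z (h, \<alpha>) * mev z m)"
    by (rule representable_mult[OF representable_var[OF p(2,3)] add(3)])
  have cong: "representable t' \<phi>" if "representable t \<phi>" "\<And>k. k \<in> H \<Longrightarrow> t k = t' k" for t t' \<phi>
  proof -
    have "mons t = mons t'" using that(2) by (auto simp: mons_def)
    then show ?thesis using that(1) by (simp add: representable_def)
  qed
  have "(if k = h then 1 else 0) + (\<Sum>\<alpha>\<in>As k. lookup m (k, \<alpha>)) = (\<Sum>\<alpha>\<in>As k. lookup (single p 1 + m) (k, \<alpha>))" if "k \<in> H" for k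
  proof -
    have "(\<Sum>\<beta>\<in>As k. lookup (single p (1::nat)) (k, \<beta>)) = (\<Sum>\<beta>\<in>As k. if \<beta> = \<alpha> then (if k = h then 1 else 0) else 0)"
      by (intro sum.cong) (auto simp: lookup_single when_def p)
    also have "\<dots> = (if k = h then 1 else 0)" using p finite_As[OF that] by auto
    finally show ?thesis by (simp add: lookup_add sum.distrib)
  qed
  from cong[OF rep this] show ?case by (simp add: mev_add p)
qed

text \<open>On solvable systems the monomials \<open>mm e\<close> lie in the span of
  \<open>mons\<close>, whose size grows with exponent at most card idx + card J in D, whereas their
  number grows with exponent card idx + card H. For large D they are linearly dependent.\<close>

theorem ex_vanishing_polynomial:
  "\<exists>g :: ('e \<times> ('v \<Rightarrow>\<^sub>0 int), complex) mpol. g \<noteq> 0 \<and> occurring g \<subseteq> Sigma H As \<and>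
    (\<exists>T. \<forall>m\<in>keys g. \<forall>h\<in>H. (\<Sum>\<alpha>\<in>As h. lookup m (h, \<alpha>)) = T) \<and>
    (\<forall>z \<eta>. solves z \<eta> \<longrightarrow> peval id z g = 0)"
proof -
  define N where "N = (\<Sum>h\<in>H. card (As h))"
  define q where "q = card idx + card J"
  \<comment> \<open>\<open>K\<close> makes \<open>mons (\<lambda>_. T)\<close> have at most \<open>(K * (D + 1)) ^ q = D * (D + 1) ^ q\<close> elements, fewer than the
    \<open>(D + 1) ^ (card idx + card H)\<close> monomials \<open>mm e\<close>.\<close>
  define K where "K = N + 2 * (bnd * (card H * N)) + 1"
  define D where "D = K ^ q"
  \<comment> \<open>At most N exponents, each at most D, occur besides the one at c h. Hence the
    truncated subtraction in \<open>mm\<close> is exact and c h fills the degree up to T.\<close>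
  define T where "T = N * D"
  define I where "I = (SIGMA h:H. As h - {c h}) \<rightarrow>\<^sub>E {..D}"
  define mm where "mm e = (\<Sum>p\<in>(SIGMA h:H. As h - {c h}). single p (e p))
    + (\<Sum>h\<in>H. single (h, c h) (T - (\<Sum>\<alpha>\<in>As h - {c h}. e (h, \<alpha>))))" for e :: "'e \<times> ('v \<Rightarrow>\<^sub>0 int) \<Rightarrow> nat"
  have fin_idx1: "finite (SIGMA h:H. As h - {c h})" using finite_H finite_As by auto
  have mm1: "lookup (mm e) (h, \<alpha>) = e (h, \<alpha>)" if "h \<in> H" "\<alpha> \<in> As h" "\<alpha> \<noteq> c h" for e h \<alpha>
  proof -
    have "(\<Sum>p\<in>(SIGMA h:H. As h - {c h}). lookup (single p (e p)) (h, \<alpha>))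
        = (\<Sum>p\<in>(SIGMA h:H. As h - {c h}). if p = (h, \<alpha>) then e (h, \<alpha>) else 0)"
      by (intro sum.cong) (auto simp: lookup_single when_def)
    also have "\<dots> = e (h, \<alpha>)" using that fin_idx1 by (subst sum.delta) auto
    finally have 1: "(\<Sum>p\<in>(SIGMA h:H. As h - {c h}). lookup (single p (e p)) (h, \<alpha>)) = e (h, \<alpha>)" .
    have 2: "(\<Sum>k\<in>H. lookup (single (k, c k) (T - (\<Sum>\<alpha>\<in>As k - {c k}. e (k, \<alpha>)))) (h, \<alpha>)) = 0"
      using that by (intro sum.neutral) (auto simp: lookup_single when_def)
    show ?thesis by (simp add: mm_def lookup_add lookup_sum 1 2)
  qed
  have mm2: "lookup (mm e) (h, c h) = T - (\<Sum>\<alpha>\<in>As h - {c h}. e (h, \<alpha>))" if "h \<in> H" for e h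
  proof -
    have 1: "(\<Sum>p\<in>(SIGMA h:H. As h - {c h}). lookup (single p (e p)) (h, c h)) = 0"
      by (intro sum.neutral) (auto simp: lookup_single when_def)
    have "(\<Sum>k\<in>H. lookup (single (k, c k) (T - (\<Sum>\<alpha>\<in>As k - {c k}. e (k, \<alpha>)))) (h, c h))
        = (\<Sum>k\<in>H. if k = h then T - (\<Sum>\<alpha>\<in>As h - {c h}. e (h, \<alpha>)) else 0)"
      by (intro sum.cong) (auto simp: lookup_single when_def)
    also have "\<dots> = T - (\<Sum>\<alpha>\<in>As h - {c h}. e (h, \<alpha>))" using that finite_H by simp
    finally show ?thesis by (simp add: mm_def lookup_add lookup_sum 1)
  qed
  have deg: "(\<Sum>\<alpha>\<in>As h. lookup (mm e) (h, \<alpha>)) = T" if "e \<in> I" "h \<in> H" for e h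
  proof -
    have "(\<Sum>\<alpha>\<in>As h. lookup (mm e) (h, \<alpha>)) = lookup (mm e) (h, c h) + (\<Sum>\<alpha>\<in>As h - {c h}. lookup (mm e) (h, \<alpha>))"
      using that ac(2) finite_As by (intro sum.remove) auto
    also have "(\<Sum>\<alpha>\<in>As h - {c h}. lookup (mm e) (h, \<alpha>)) = (\<Sum>\<alpha>\<in>As h - {c h}. e (h, \<alpha>))"
      using that by (intro sum.cong mm1) auto
    finally have eq: "(\<Sum>\<alpha>\<in>As h. lookup (mm e) (h, \<alpha>)) = T - (\<Sum>\<alpha>\<in>As h - {c h}. e (h, \<alpha>)) + (\<Sum>\<alpha>\<in>As h - {c h}. e (h, \<alpha>))"
      by (simp add: mm2[OF that(2)])
    have "(\<Sum>\<alpha>\<in>As h - {c h}. e (h, \<alpha>)) \<le> (\<Sum>\<alpha>\<in>As h - {c h}. D)"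
      using that by (intro sum_mono) (auto simp: I_def)
    also have "\<dots> \<le> card (As h) * D"
      using finite_As[OF that(2)] by (simp add: card_Diff1_le)
    also have "\<dots> \<le> T"
      unfolding T_def N_def using that finite_H by (intro mult_right_mono member_le_sum) auto
    finally show ?thesis using eq by simp
  qed
  have keys_mm: "keys (mm e) \<subseteq> Sigma H As" for e
  proof -
    have "keys (\<Sum>p\<in>(SIGMA h:H. As h - {c h}). single p (e p)) \<subseteq> Sigma H As"
      by (rule order_trans[OF keys_sum]) auto
    moreover have "keys (\<Sum>h\<in>H. single (h, c h) (T - (\<Sum>\<alpha>\<in>As h - {c h}. e (h, \<alpha>)))) \<subseteq> Sigma H As"
      by (rule order_trans[OF keys_sum]) (use ac(2) in auto)
    ultimately show ?thesis
      unfolding mm_def by (intro order_trans[OF keys_add] Un_least)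
  qed
  have inj: "inj_on mm I"
  proof (rule inj_onI)
    fix e e' assume e: "e \<in> I" "e' \<in> I" "mm e = mm e'"
    show "e = e'"
    proof (rule PiE_ext[of _ "SIGMA h:H. As h - {c h}" "\<lambda>_. {..D}"])
      fix p assume "p \<in> (SIGMA h:H. As h - {c h})"
      then obtain h \<alpha> where p: "p = (h, \<alpha>)" "h \<in> H" "\<alpha> \<in> As h" "\<alpha> \<noteq> c h" by auto
      show "e p = e' p"
        using mm1[OF p(2-4), of e] mm1[OF p(2-4), of e'] e(3) by (simp add: p(1))
    qed (use e in \<open>auto simp: I_def\<close>)
  qed
  have finI: "finite I" unfolding I_def using fin_idx1 by (intro finite_PiE) auto
  have card_idx1: "card (SIGMA h:H. As h - {c h}) = card idx + card H"
  proof -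
    have "(SIGMA h:H. As h - {c h}) = idx \<union> (\<lambda>h. (h, a h)) ` H"
      using ac by (auto simp: idx_def)
    moreover have "idx \<inter> (\<lambda>h. (h, a h)) ` H = {}" by (auto simp: idx_def)
    moreover have "card ((\<lambda>h. (h, a h)) ` H) = card H" by (rule card_image) (auto simp: inj_on_def)
    ultimately show ?thesis using finite_idx finite_H by (simp add: card_Un_disjoint)
  qed
  have cardI: "card I = (D + 1) ^ (card idx + card H)"
    unfolding I_def using fin_idx1 card_idx1 by (simp add: card_PiE)
  have fin_mons: "finite (mons (\<lambda>_. T))" by (rule mons_bound(1)) simp
  have "card (mons (\<lambda>_. T)) \<le> (T + 1) ^ card idx * (2 * (bnd * (card H * T)) + 1) ^ card J"
    by (rule mons_bound(2)) simp
  also have "\<dots> \<le> (K * (D + 1)) ^ card idx * (K * (D + 1)) ^ card J"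
  proof (intro mult_mono power_mono)
    show "T + 1 \<le> K * (D + 1)" by (simp add: T_def K_def algebra_simps)
    show "2 * (bnd * (card H * T)) + 1 \<le> K * (D + 1)" by (simp add: T_def K_def algebra_simps)
  qed auto
  also have "\<dots> = (K * (D + 1)) ^ q"
    by (simp only: q_def power_add)
  also have "\<dots> = D * (D + 1) ^ q"
    by (simp only: power_mult_distrib D_def[symmetric])
  also have "\<dots> < (D + 1) ^ Suc q" by simp
  also have "\<dots> \<le> card I"
    unfolding cardI using J_small by (intro power_increasing) (auto simp: q_def)
  finally have less: "card (mons (\<lambda>_. T)) < card I" .
  have "\<exists>B. \<forall>z \<eta>. solves z \<eta> \<longrightarrow> mev z (mm e) = (\<Sum>s\<in>mons (\<lambda>_. T). B s * chi s z \<eta>)" if "e \<in> I" for e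
  proof -
    obtain B Y where B: "finite Y" "Y \<subseteq> mons (\<lambda>h. \<Sum>\<alpha>\<in>As h. lookup (mm e) (h, \<alpha>))"
      "\<And>z \<eta>. solves z \<eta> \<Longrightarrow> mev z (mm e) = (\<Sum>s\<in>Y. B s * chi s z \<eta>)"
      using representable_mev[OF keys_mm, of e] by (auto simp: representable_def)
    have "mons (\<lambda>h. \<Sum>\<alpha>\<in>As h. lookup (mm e) (h, \<alpha>)) = mons (\<lambda>_. T)"
      using deg[OF that] by (auto simp: mons_def)
    then have "(\<Sum>s\<in>Y. B s * chi s z \<eta>) = (\<Sum>s\<in>mons (\<lambda>_. T). (if s \<in> Y then B s else 0) * chi s z \<eta>)" for z \<eta>
      using B(2) fin_mons by (intro sum.mono_neutral_cong_left) auto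
    then show ?thesis using B(3) by (intro exI[of _ "\<lambda>s. if s \<in> Y then B s else 0"]) auto
  qed
  then have "\<forall>e\<in>I. \<exists>B. \<forall>z \<eta>. solves z \<eta> \<longrightarrow> mev z (mm e) = (\<Sum>s\<in>mons (\<lambda>_. T). B s * chi s z \<eta>)"
    by blast
  from bchoice[OF this]
  obtain B where B: "\<And>e z \<eta>. e \<in> I \<Longrightarrow> solves z \<eta> \<Longrightarrow> mev z (mm e) = (\<Sum>s\<in>mons (\<lambda>_. T). B e s * chi s z \<eta>)"
    by blast
  obtain x where x: "\<exists>e\<in>I. x e \<noteq> 0" "\<And>s. s \<in> mons (\<lambda>_. T) \<Longrightarrow> (\<Sum>e\<in>I. x e * B e s) = 0"
    using ex_linear_relation[OF fin_mons finI less, of B] by blast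
  define g where "g = (\<Sum>e\<in>I. single (mm e) (x e))"
  have "lookup g (mm e) = x e" if "e \<in> I" for e
  proof -
    have "lookup g (mm e) = (\<Sum>e'\<in>I. if e' = e then x e else 0)"
      unfolding g_def lookup_sum
      by (intro sum.cong refl) (use inj that in \<open>auto simp: lookup_single when_def dest: inj_onD\<close>)
    then show ?thesis using that finI by simp
  qed
  then have "g \<noteq> 0" using x(1) by auto
  moreover have keys_g: "keys g \<subseteq> mm ` I"
    unfolding g_def by (rule order_trans[OF keys_sum]) auto
  then have "occurring g \<subseteq> Sigma H As" using keys_mm by (fastforce simp: occurring_def)
  moreover have "\<forall>m\<in>keys g. \<forall>h\<in>H. (\<Sum>\<alpha>\<in>As h. lookup m (h, \<alpha>)) = T"
    using keys_g deg by blast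
  moreover have "peval id z g = 0" if "solves z \<eta>" for z \<eta>
  proof -
    have "peval id z g = (\<Sum>e\<in>I. x e * mev z (mm e))"
      by (simp add: g_def peval_sum peval_single)
    also have "\<dots> = (\<Sum>e\<in>I. \<Sum>s\<in>mons (\<lambda>_. T). (x e * B e s) * chi s z \<eta>)"
      using B that by (intro sum.cong) (auto simp: sum_distrib_left mult.assoc)
    also have "\<dots> = (\<Sum>s\<in>mons (\<lambda>_. T). (\<Sum>e\<in>I. x e * B e s) * chi s z \<eta>)"
      by (subst sum.swap) (simp add: sum_distrib_right)
    also have "\<dots> = 0" using x(2) by simp
    finally show ?thesis .
  qed
  ultimately show ?thesis by blast
qed

end

section \<open>The variety of solvable systems\<close>

lemma leval_generic_P:
  fixes z :: "cvar \<Rightarrow> complex"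
  shows "leval (peval of_rat z) \<eta> (generic_P As h) = (\<Sum>\<alpha>\<in>As h. z (h, \<alpha>) * lmev \<eta> \<alpha>)"
  by (simp add: generic_P_def leval_sum leval_single)

lemma lmev_cong: "(\<And>v. v \<in> keys m \<Longrightarrow> x v = y v) \<Longrightarrow> lmev x m = lmev y m"
  unfolding lmev_def by (intro prod.cong) auto

lemma keys_map_of_int [simp]: "keys (Poly_Mapping.map of_int p :: _ \<Rightarrow>\<^sub>0 'a::ring_char_0) = keys p"
  by (auto simp: in_keys_iff map.rep_eq when_def)

lemma peval_map_of_int:
  fixes \<phi> :: "'a::ring_char_0 \<Rightarrow> 'b::comm_semiring_1"
  shows "peval \<phi> z (Poly_Mapping.map of_int p) = peval (\<lambda>c. \<phi> (of_int c)) z p"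
  unfolding peval_def keys_map_of_int by (intro sum.cong refl) (auto simp: map.rep_eq when_def)

locale resultant_variety =
  fixes L :: nat and As :: "nat \<Rightarrow> ymon set" and Res :: "(cvar, int) mpol"
  assumes finite_As: "\<And>h. h \<in> {1..L} \<Longrightarrow> finite (As h)"
    and keys_As: "\<And>h \<alpha>. h \<in> {1..L} \<Longrightarrow> \<alpha> \<in> As h \<Longrightarrow> keys \<alpha> \<subseteq> {1..L-1}"
    and nontrivial: "nontrivial_resultant L As" and res: "is_sparse_resultant L As Res"
begin

text \<open>Nonzero values are required at all indices, also outside {1..L-1}, where no exponent is
  supported; this makes the laws of \<open>lmev\<close> applicable directly.\<close>

definition torus_zero :: "(cvar \<Rightarrow> complex) \<Rightarrow> (nat \<Rightarrow> complex) \<Rightarrow> bool" where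
  "torus_zero z \<eta> \<longleftrightarrow> (\<forall>j. \<eta> j \<noteq> 0) \<and> (\<forall>h\<in>{1..L}. (\<Sum>\<alpha>\<in>As h. z (h, \<alpha>) * lmev \<eta> \<alpha>) = 0)"

lemma Res_props: "Res \<noteq> 0" "occurring Res \<subseteq> coeff_vars L As" "multihomogeneous L As Res"
  "zero_locus L As {Poly_Mapping.map of_int Res} = Zres L As"
  using res nontrivial by (auto simp: is_sparse_resultant_def irreducible_in_def)

text \<open>For the empty set the codimension is a supremum over no chains, hence 0 and not
  1.\<close>

lemma Zres_nonempty: "Zres L As \<noteq> {}"
proof
  assume empty: "Zres L As = {}"
  have "{m. \<exists>C. C 0 = Zres L As \<and> (\<forall>i\<le>m. irreducible_closed L As (C i)) \<and> (\<forall>i<m. C i \<subset> C (Suc i))} = {}"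
    by (auto simp: empty irreducible_closed_def)
  then have "codimension L As (Zres L As) = 0" unfolding codimension_def by (simp only: image_empty Sup_empty bot_enat_def)
  then show False using nontrivial by (simp add: nontrivial_resultant_def)
qed

section \<open>Projective classes and the closure of the solvable systems\<close>

abbreviation proj_rel :: "((cvar \<Rightarrow> complex) \<times> (cvar \<Rightarrow> complex)) set" where
  "proj_rel \<equiv> {(z, w). z \<in> coord_vectors L As \<and> w \<in> coord_vectors L As \<and>
        (\<exists>t. \<forall>h\<in>{1..L}. t h \<noteq> 0 \<and> (\<forall>\<alpha>\<in>As h. w (h, \<alpha>) = t h * z (h, \<alpha>)))}"

lemma class_in_multiproj: "z \<in> coord_vectors L As \<Longrightarrow> proj_rel `` {z} \<in> multiproj L As"
  unfolding multiproj_def by (rule quotientI)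

lemma self_in_class: "z \<in> coord_vectors L As \<Longrightarrow> z \<in> proj_rel `` {z}"
  by (auto intro!: exI[of _ "\<lambda>_. 1"])

lemma class_members:
  assumes X: "X \<in> multiproj L As" and z: "z \<in> X" "z' \<in> X"
  shows "z \<in> coord_vectors L As" "z' \<in> coord_vectors L As"
    "\<exists>t. \<forall>h\<in>{1..L}. t h \<noteq> 0 \<and> (\<forall>\<alpha>\<in>As h. z' (h, \<alpha>) = t h * z (h, \<alpha>))"
proof -
  obtain z0 where z0: "X = proj_rel `` {z0}" using X by (auto simp: multiproj_def quotient_def)
  obtain t t' where t: "\<forall>h\<in>{1..L}. t h \<noteq> 0 \<and> (\<forall>\<alpha>\<in>As h. z (h, \<alpha>) = t h * z0 (h, \<alpha>))"
    "\<forall>h\<in>{1..L}. t' h \<noteq> 0 \<and> (\<forall>\<alpha>\<in>As h. z' (h, \<alpha>) = t' h * z0 (h, \<alpha>))"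
    using z by (auto simp: z0)
  show "z \<in> coord_vectors L As" "z' \<in> coord_vectors L As" using z by (auto simp: z0)
  show "\<exists>t. \<forall>h\<in>{1..L}. t h \<noteq> 0 \<and> (\<forall>\<alpha>\<in>As h. z' (h, \<alpha>) = t h * z (h, \<alpha>))"
    using t by (intro exI[of _ "\<lambda>h. t' h / t h"]) auto
qed

lemma torus_zero_scale:
  assumes "torus_zero z \<eta>" "\<forall>h\<in>{1..L}. \<forall>\<alpha>\<in>As h. z' (h, \<alpha>) = t h * z (h, \<alpha>)"
  shows "torus_zero z' \<eta>"
proof -
  have "(\<Sum>\<alpha>\<in>As h. z' (h, \<alpha>) * lmev \<eta> \<alpha>) = t h * (\<Sum>\<alpha>\<in>As h. z (h, \<alpha>) * lmev \<eta> \<alpha>)" if "h \<in> {1..L}" for h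
    using assms(2) that by (simp add: sum_distrib_left mult.assoc)
  then show ?thesis using assms(1) by (auto simp: torus_zero_def)
qed

lemma Z0_iff: "X \<in> Z0 L As \<longleftrightarrow> X \<in> multiproj L As \<and> (\<exists>z\<in>X. \<exists>\<eta>. torus_zero z \<eta>)"
proof
  assume X: "X \<in> Z0 L As"
  then obtain z \<eta> where z: "X \<in> multiproj L As" "z \<in> X" "\<forall>j\<in>{1..L-1}. \<eta> j \<noteq> 0"
    "\<forall>h\<in>{1..L}. leval (peval of_rat z) \<eta> (generic_P As h) = 0"
    by (auto simp: Z0_def)
  define \<eta>' where "\<eta>' j = (if j \<in> {1..L-1} then \<eta> j else 1)" for j
  have "torus_zero z \<eta>'"
    unfolding torus_zero_def
  proof (intro conjI ballI allI)
    fix h assume h: "h \<in> {1..L}"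
    have "(\<Sum>\<alpha>\<in>As h. z (h, \<alpha>) * lmev \<eta>' \<alpha>) = (\<Sum>\<alpha>\<in>As h. z (h, \<alpha>) * lmev \<eta> \<alpha>)"
      using keys_As[OF h] by (intro sum.cong arg_cong2[where f = "(*)"] lmev_cong refl) (force simp: \<eta>'_def)
    then show "(\<Sum>\<alpha>\<in>As h. z (h, \<alpha>) * lmev \<eta>' \<alpha>) = 0"
      using z(4) h by (simp add: leval_generic_P)
  qed (use z(3) in \<open>auto simp: \<eta>'_def\<close>)
  then show "X \<in> multiproj L As \<and> (\<exists>z\<in>X. \<exists>\<eta>. torus_zero z \<eta>)" using z by blast
next
  assume "X \<in> multiproj L As \<and> (\<exists>z\<in>X. \<exists>\<eta>. torus_zero z \<eta>)"
  then obtain z \<eta> where z: "X \<in> multiproj L As" "z \<in> X" "torus_zero z \<eta>" by blast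
  have "\<forall>h\<in>{1..L}. leval (peval of_rat z) \<eta> (generic_P As h) = 0"
    using z(3) by (auto simp: leval_generic_P torus_zero_def)
  moreover have "\<forall>j\<in>{1..L-1}. \<eta> j \<noteq> 0" using z(3) by (auto simp: torus_zero_def)
  ultimately show "X \<in> Z0 L As" using z by (auto simp: Z0_def)
qed

lemma class_in_Z0:
  assumes "z \<in> coord_vectors L As" "torus_zero z \<eta>"
  shows "proj_rel `` {z} \<in> Z0 L As"
  unfolding Z0_iff
  by (intro conjI class_in_multiproj bexI[OF _ self_in_class] exI[of _ \<eta>] assms)

lemma Z0_sub_Zres: "Z0 L As \<subseteq> Zres L As"
  unfolding Zres_def zariski_closure_def by blast

text \<open>The zero locus of g is one of the closed sets whose intersection is the closure.\<close>

lemma Zres_vanish: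
  assumes g: "multihomogeneous L As g"
    and van: "\<And>z \<eta>. z \<in> coord_vectors L As \<Longrightarrow> torus_zero z \<eta> \<Longrightarrow> peval id z g = 0"
  shows "Zres L As \<subseteq> zero_locus L As {g}"
proof -
  have "Z0 L As \<subseteq> zero_locus L As {g}"
  proof
    fix X assume "X \<in> Z0 L As"
    then obtain z \<eta> where z: "X \<in> multiproj L As" "z \<in> X" "torus_zero z \<eta>" by (auto simp: Z0_iff)
    have "peval id z' g = 0" if z': "z' \<in> X" for z'
    proof -
      obtain t where "\<forall>h\<in>{1..L}. t h \<noteq> 0 \<and> (\<forall>\<alpha>\<in>As h. z' (h, \<alpha>) = t h * z (h, \<alpha>))"
        using class_members(3)[OF z(1,2) z'] by blast
      then have "torus_zero z' \<eta>" using torus_zero_scale[OF z(3), of z' t] by blast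
      then show ?thesis using van class_members(2)[OF z(1,2) z'] by blast
    qed
    then show "X \<in> zero_locus L As {g}" using z by (auto simp: zero_locus_def)
  qed
  moreover have "zariski_closed L As (zero_locus L As {g})"
    unfolding zariski_closed_def using g by blast
  ultimately show ?thesis unfolding Zres_def zariski_closure_def by blast
qed

lemma Z0_nonempty: "Z0 L As \<noteq> {}"
proof
  assume empty: "Z0 L As = {}"
  have "Zres L As \<subseteq> zero_locus L As {1}"
  proof (rule Zres_vanish)
    show "multihomogeneous L As 1"
      by (auto simp: multihomogeneous_def intro!: exI[of _ "\<lambda>_. 0"])
  next
    fix z \<eta> assume "z \<in> coord_vectors L As" "torus_zero z \<eta>"
    then have "proj_rel `` {z} \<in> Z0 L As" by (rule class_in_Z0)
    then show "peval id z 1 = 0" using empty by simp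
  qed
  then obtain X where X: "X \<in> multiproj L As" "\<forall>z\<in>X. peval id z (1 :: (cvar, complex) mpol) = 0"
    using Zres_nonempty by (auto simp: zero_locus_def)
  obtain z0 where "z0 \<in> coord_vectors L As" "X = proj_rel `` {z0}"
    using X(1) unfolding multiproj_def by (rule quotientE)
  then have "z0 \<in> X" using self_in_class by simp
  then show False using X(2) by auto
qed

text \<open>A single monomial with nonzero coefficient has no zero on the torus, but some system of
  nonzero polynomials is solvable.\<close>

lemma two_monomials:
  assumes h: "h \<in> {1..L}"
  shows "\<exists>\<alpha>\<in>As h. \<exists>\<beta>\<in>As h. \<alpha> \<noteq> \<beta>"
proof (rule ccontr)
  assume no: "\<not> ?thesis"
  obtain X z \<eta> where z: "X \<in> multiproj L As" "z \<in> X" "torus_zero z \<eta>"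
    using Z0_nonempty Z0_iff by blast
  have "z \<in> coord_vectors L As" by (rule class_members(1)[OF z(1,2,2)])
  then obtain \<alpha> where \<alpha>: "\<alpha> \<in> As h" "z (h, \<alpha>) \<noteq> 0" using h unfolding coord_vectors_def by blast
  then have "As h = {\<alpha>}" using no by auto
  then have "z (h, \<alpha>) * lmev \<eta> \<alpha> = 0" using bspec[OF conjunct2[OF z(3)[unfolded torus_zero_def]] h] by simp
  moreover have "lmev \<eta> \<alpha> \<noteq> 0" using z(3) by (intro lmev_nonzero) (auto simp: torus_zero_def)
  ultimately show False using \<alpha> by simp
qed

lemma Res_vanishes_coord:
  assumes "z \<in> coord_vectors L As" "torus_zero z \<eta>"
  shows "peval of_int z Res = (0 :: complex)"
proof -
  have "proj_rel `` {z} \<in> Z0 L As" using assms by (rule class_in_Z0)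
  then have "proj_rel `` {z} \<in> zero_locus L As {Poly_Mapping.map of_int Res}"
    using Z0_sub_Zres Res_props(4) by blast
  then have "peval id z (Poly_Mapping.map of_int Res) = 0"
    using self_in_class[OF assms(1)] unfolding zero_locus_def by blast
  then show ?thesis by (simp add: peval_map_of_int)
qed

lemma isCont_peval_of_int:
  fixes p :: "(cvar, int) mpol"
  assumes "\<And>w. isCont (\<lambda>s. y s w) (a::complex)"
  shows "isCont (\<lambda>s. peval of_int (y s) p :: complex) a"
  unfolding peval_def by (intro continuous_intros assms)

text \<open>Coordinate vectors exclude systems containing the zero polynomial. Each such polynomial
  is replaced by t times a binomial that vanishes at \<eta>, and then t tends to 0.\<close>

lemma Res_vanishes:
  assumes s: "torus_zero z \<eta>"
  shows "peval of_int z Res = (0 :: complex)"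
proof -
  have \<eta>: "\<eta> j \<noteq> 0" for j using s by (simp add: torus_zero_def)
  have "\<forall>h. \<exists>p. h \<in> {1..L} \<longrightarrow> fst p \<in> As h \<and> snd p \<in> As h \<and> fst p \<noteq> snd p"
    using two_monomials by (metis fst_conv snd_conv)
  then obtain p where p: "\<And>h. h \<in> {1..L} \<Longrightarrow> fst (p h) \<in> As h \<and> snd (p h) \<in> As h \<and> fst (p h) \<noteq> snd (p h)"
    by metis
  define w where "w = (\<lambda>(h, \<alpha>). if h \<in> {1..L} \<and> (\<forall>\<alpha>\<in>As h. z (h, \<alpha>) = 0) then
      (if \<alpha> = fst (p h) then inverse (lmev \<eta> \<alpha>) else if \<alpha> = snd (p h) then - inverse (lmev \<eta> \<alpha>) else 0) else 0)"
  define y where "y t c = (if c \<in> coeff_vars L As then z c + t * w c else 0)" for t c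
  have "peval of_int (y 0) Res = (0 :: complex)"
  proof (rule isCont_zero)
    show "isCont (\<lambda>t. peval of_int (y t) Res) 0"
    proof (rule isCont_peval_of_int)
      show "isCont (\<lambda>t. y t c) 0" for c
        by (cases "c \<in> coeff_vars L As") (auto simp: y_def intro!: continuous_intros)
    qed
  next
    fix t :: complex assume t: "t \<noteq> 0"
    have "y t \<in> coord_vectors L As"
      unfolding coord_vectors_def
    proof (intro CollectI conjI allI impI ballI)
      fix h assume h: "h \<in> {1..L}"
      show "\<exists>\<alpha>\<in>As h. y t (h, \<alpha>) \<noteq> 0"
      proof (cases "\<forall>\<alpha>\<in>As h. z (h, \<alpha>) = 0")
        case True
        then have "y t (h, fst (p h)) = t * inverse (lmev \<eta> (fst (p h)))"
          using p[OF h] h by (auto simp: y_def w_def coeff_vars_def)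
        then show ?thesis using t p[OF h] lmev_nonzero[of \<eta> "fst (p h)", OF \<eta>] by (intro bexI[of _ "fst (p h)"]) auto
      next
        case False
        then obtain \<alpha> where "\<alpha> \<in> As h" "z (h, \<alpha>) \<noteq> 0" by auto
        then show ?thesis using h by (intro bexI[of _ \<alpha>]) (auto simp: y_def w_def coeff_vars_def)
      qed
    qed (auto simp: y_def)
    moreover have "torus_zero (y t) \<eta>"
      unfolding torus_zero_def
    proof (intro conjI allI ballI \<eta>)
      fix h assume h: "h \<in> {1..L}"
      have "(\<Sum>\<alpha>\<in>As h. w (h, \<alpha>) * lmev \<eta> \<alpha>) = 0"
      proof (cases "\<forall>\<alpha>\<in>As h. z (h, \<alpha>) = 0")
        case True
        have "(\<Sum>\<alpha>\<in>As h. w (h, \<alpha>) * lmev \<eta> \<alpha>)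
            = (\<Sum>\<alpha>\<in>As h. (if \<alpha> = fst (p h) then 1 else 0) - (if \<alpha> = snd (p h) then 1 else 0))"
          using True h p[OF h] lmev_nonzero[of \<eta>, OF \<eta>] by (intro sum.cong) (auto simp: w_def)
        then show ?thesis using p[OF h] finite_As[OF h] by (simp add: sum_subtractf)
      next
        case False
        then show ?thesis by (intro sum.neutral) (auto simp: w_def)
      qed
      moreover have "(\<Sum>\<alpha>\<in>As h. y t (h, \<alpha>) * lmev \<eta> \<alpha>)
          = (\<Sum>\<alpha>\<in>As h. z (h, \<alpha>) * lmev \<eta> \<alpha>) + t * (\<Sum>\<alpha>\<in>As h. w (h, \<alpha>) * lmev \<eta> \<alpha>)"
        using h by (simp add: y_def coeff_vars_def sum_distrib_left sum.distrib[symmetric] algebra_simps)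
      ultimately show "(\<Sum>\<alpha>\<in>As h. y t (h, \<alpha>) * lmev \<eta> \<alpha>) = 0"
        using s h by (simp add: torus_zero_def)
    qed
    ultimately show "peval of_int (y t) Res = 0" by (rule Res_vanishes_coord)
  qed
  moreover have "peval of_int (y 0) Res = peval of_int z Res"
    by (rule peval_cong) (use Res_props(2) in \<open>auto simp: y_def\<close>)
  ultimately show ?thesis by simp
qed

lemma multihomogeneous_scale:
  assumes F: "multihomogeneous L As F" and \<phi>: "ring_hom \<phi>"
    and t: "\<forall>h\<in>{1..L}. \<forall>\<alpha>\<in>As h. z' (h, \<alpha>) = t h * z (h, \<alpha>)" and z: "peval \<phi> z F = (0 :: complex)"
  shows "peval \<phi> z' F = 0"
proof -
  obtain d where d: "\<forall>m\<in>keys F. \<forall>h\<in>{1..L}. (\<Sum>\<alpha>\<in>As h. lookup m (h, \<alpha>)) = d h"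
    and occ: "occurring F \<subseteq> coeff_vars L As"
    using F by (auto simp: multihomogeneous_def)
  have mon: "mev z' m = (\<Prod>h\<in>{1..L}. t h ^ d h) * mev z m" if m: "m \<in> keys F" for m
  proof -
    have sub: "keys m \<subseteq> Sigma {1..L} As" using occ m by (auto simp: occurring_def coeff_vars_def)
    have fin: "finite (Sigma {1..L} As)" using finite_As by auto
    have "mev z' m = (\<Prod>c\<in>Sigma {1..L} As. z' c ^ lookup m c)"
      by (rule mev_superset[OF fin sub])
    also have "\<dots> = (\<Prod>c\<in>Sigma {1..L} As. t (fst c) ^ lookup m c) * (\<Prod>c\<in>Sigma {1..L} As. z c ^ lookup m c)"
      unfolding prod.distrib[symmetric]
      by (intro prod.cong refl) (use t in \<open>auto simp: power_mult_distrib\<close>)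
    also have "(\<Prod>c\<in>Sigma {1..L} As. z c ^ lookup m c) = mev z m"
      by (rule mev_superset[OF fin sub, symmetric])
    also have "(\<Prod>c\<in>Sigma {1..L} As. t (fst c) ^ lookup m c) = (\<Prod>h\<in>{1..L}. \<Prod>\<alpha>\<in>As h. t h ^ lookup m (h, \<alpha>))"
      using finite_As by (subst prod.Sigma) (auto simp: split_def)
    also have "\<dots> = (\<Prod>h\<in>{1..L}. t h ^ d h)"
      using d m by (intro prod.cong refl) (simp add: power_sum[symmetric])
    finally show ?thesis .
  qed
  have "peval \<phi> z' F = (\<Sum>m\<in>keys F. \<phi> (lookup F m) * mev z' m)"
    by (rule peval_superset[OF \<phi>]) auto
  also have "\<dots> = (\<Prod>h\<in>{1..L}. t h ^ d h) * (\<Sum>m\<in>keys F. \<phi> (lookup F m) * mev z m)"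
    by (simp add: mon sum_distrib_left mult_ac)
  also have "(\<Sum>m\<in>keys F. \<phi> (lookup F m) * mev z m) = peval \<phi> z F"
    by (rule peval_superset[OF \<phi>, symmetric]) auto
  finally show ?thesis using z by simp
qed

lemma class_in_Zres:
  assumes "z \<in> coord_vectors L As" "peval of_int z Res = (0 :: complex)"
  shows "proj_rel `` {z} \<in> Zres L As"
proof -
  have "peval id z' (Poly_Mapping.map of_int Res) = 0" if z': "z' \<in> proj_rel `` {z}" for z'
  proof -
    obtain t where "\<forall>h\<in>{1..L}. t h \<noteq> 0 \<and> (\<forall>\<alpha>\<in>As h. z' (h, \<alpha>) = t h * z (h, \<alpha>))"
      using class_members(3)[OF class_in_multiproj[OF assms(1)] self_in_class[OF assms(1)] z'] by blast
    then have "peval of_int z' Res = (0 :: complex)"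
      using multihomogeneous_scale[OF Res_props(3) ring_hom_of_int _ assms(2), of z' t] by blast
    then show ?thesis by (simp add: peval_map_of_int)
  qed
  then have "proj_rel `` {z} \<in> zero_locus L As {Poly_Mapping.map of_int Res}"
    using class_in_multiproj[OF assms(1)] by (auto simp: zero_locus_def)
  then show ?thesis by (simp add: Res_props(4))
qed

text \<open>A nonzero constant does not vanish at a solvable system, and there is one.\<close>

lemma Res_not_constant: "occurring Res \<noteq> {}"
proof
  assume "occurring Res = {}"
  then have "keys Res \<subseteq> {0}" by (auto simp: occurring_def)
  then have c: "Res = const (lookup Res 0)"
    by (intro poly_mapping_eqI) (auto simp: const_def lookup_single when_def in_keys_iff)
  obtain X z \<eta> where z: "X \<in> multiproj L As" "z \<in> X" "torus_zero z \<eta>"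
    using Z0_nonempty Z0_iff by blast
  have "peval of_int z Res = (of_int (lookup Res 0) :: complex)" by (subst c) simp
  then have "lookup Res 0 = 0" using Res_vanishes[OF z(3)] by simp
  then show False using c Res_props(1) by simp
qed

text \<open>Give the indeterminates other than \<open>v\<close> generic values and solve for \<open>v\<close>: the variety of the resultant
  has a point where \<open>g\<close> does not vanish.\<close>

lemma Res_variable_occurs:
  assumes g: "g \<noteq> 0" "multihomogeneous L As g" and v: "v \<in> occurring Res" "v \<notin> occurring g"
    and van: "\<And>z \<eta>. z \<in> coord_vectors L As \<Longrightarrow> torus_zero z \<eta> \<Longrightarrow> peval id z g = 0"
  shows False
proof -
  let ?R = "Poly_Mapping.map of_int Res :: (cvar, complex) mpol"
  have keysR: "keys ?R = keys Res" by simp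
  then have occR: "occurring ?R = occurring Res" by (simp add: occurring_def)
  have R0: "?R \<noteq> 0" using keysR Res_props(1) by (metis keys_eq_empty)
  let ?d = "degree_in v ?R"
  let ?lc = "coeff_in v ?d ?R"
  have d: "0 < ?d" using v(1) by (simp add: degree_in_pos_iff occR)
  have "g * ?lc \<noteq> 0" using g(1) lead_coeff_in_nonzero[OF R0] by simp
  then obtain y :: "cvar \<Rightarrow> complex" where y: "\<forall>c. y c \<noteq> 0" "peval id y (g * ?lc) \<noteq> 0"
    using ex_nonroot[of "id :: complex \<Rightarrow> complex" "g * ?lc"] by auto
  define P where "P = (\<Sum>k\<le>?d. monom (peval id y (coeff_in v k ?R)) k)"
  have "coeff P ?d = peval id y ?lc" by (simp add: P_def coeff_sum)
  then have "coeff P ?d \<noteq> 0" using y(2) by (auto simp: peval_mult)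
  then have "0 < degree P" using d le_degree[of P ?d] by simp
  then have "\<not> constant (poly P)" using constant_degree[of P] by simp
  then obtain t where t: "poly P t = 0" using fundamental_theorem_of_algebra by blast
  define z where "z c = (if c \<in> coeff_vars L As then (y(v := t)) c else 0)" for c
  have "z \<in> coord_vectors L As"
    unfolding coord_vectors_def
  proof (intro CollectI conjI ballI)
    fix h assume h: "h \<in> {1..L}"
    obtain \<alpha> \<beta> where ab: "\<alpha> \<in> As h" "\<beta> \<in> As h" "\<alpha> \<noteq> \<beta>" using two_monomials[OF h] by blast
    \<comment> \<open>Only the coordinate v may be 0; the second monomial of the support keeps the
      vector admissible.\<close>
    then obtain \<gamma> where "\<gamma> \<in> As h" "(h, \<gamma>) \<noteq> v" by (cases v) auto
    then show "\<exists>\<alpha>\<in>As h. z (h, \<alpha>) \<noteq> 0"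
      using h y(1) by (intro bexI[of _ \<gamma>]) (auto simp: z_def coeff_vars_def)
  qed (auto simp: z_def)
  moreover have "peval of_int z Res = (0 :: complex)"
  proof -
    have "peval of_int z Res = peval id z ?R" by (simp add: peval_map_of_int)
    also have "\<dots> = peval id (y(v := t)) ?R"
      by (rule peval_cong) (use Res_props(2) occR in \<open>auto simp: z_def\<close>)
    also have "\<dots> = (\<Sum>k\<le>?d. peval id (y(v := t)) (coeff_in v k ?R) * t ^ k)"
      by (subst mpol_eq_sum_coeff_in[of ?R v]) (simp add: peval_sum peval_mult peval_power)
    also have "\<dots> = (\<Sum>k\<le>?d. peval id y (coeff_in v k ?R) * t ^ k)"
      using occurring_coeff_in[of v _ ?R] by (intro sum.cong arg_cong2[where f = "(*)"] peval_cong refl) auto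
    also have "\<dots> = poly P t" by (simp add: P_def poly_sum poly_monom)
    finally show ?thesis using t by simp
  qed
  ultimately have "proj_rel `` {z} \<in> Zres L As" by (rule class_in_Zres)
  moreover have "Zres L As \<subseteq> zero_locus L As {g}"
    by (rule Zres_vanish[OF g(2)]) (rule van)
  ultimately have "proj_rel `` {z} \<in> zero_locus L As {g}" by blast
  then have "peval id z g = 0"
    using self_in_class[OF \<open>z \<in> coord_vectors L As\<close>] unfolding zero_locus_def by blast
  moreover have "peval id z g = peval id y g"
    by (rule peval_cong) (use g(2) v(2) in \<open>auto simp: z_def multihomogeneous_def\<close>)
  ultimately show False using y(2) by (simp add: peval_mult)
qed

text \<open>If J separated the lattice of W, counting would give a polynomial vanishing on all
  solvable systems. One of the two surplus equations is given up beforehand, namely that of v if it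
  belongs to W, so that v does not occur in this polynomial.\<close>

theorem full_rank:
  assumes W: "W \<subseteq> {1..L}" and J: "finite J" "card J + 2 \<le> card W"
  shows "\<exists>\<delta>\<in>lattice_of As W. \<delta> \<noteq> 0 \<and> (\<forall>v\<in>J. lookup \<delta> v = 0)"
proof (rule ccontr)
  assume no: "\<not> ?thesis"
  obtain v where v: "v \<in> occurring Res" using Res_not_constant by blast
  have "W \<noteq> {}" using J(2) by auto
  then obtain h1 where h1: "h1 \<in> W" "fst v \<in> W \<longrightarrow> h1 = fst v" by blast
  let ?H = "W - {h1}"
  have finW: "finite W" using W finite_subset by blast
  have "\<forall>h. \<exists>p. h \<in> {1..L} \<longrightarrow> fst p \<in> As h \<and> snd p \<in> As h \<and> fst p \<noteq> snd p"
    using two_monomials by (metis fst_conv snd_conv)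
  then obtain p where p: "\<And>h. h \<in> {1..L} \<Longrightarrow> fst (p h) \<in> As h \<and> snd (p h) \<in> As h \<and> fst (p h) \<noteq> snd (p h)"
    by metis
  have mono: "lattice_of As ?H \<subseteq> lattice_of As W"
  proof
    fix \<delta> assume "\<delta> \<in> lattice_of As ?H"
    then show "\<delta> \<in> lattice_of As W"
      by (induction rule: lattice_of.induct) (auto intro: lattice_of.intros)
  qed
  interpret deficient_system As ?H J "\<lambda>h. fst (p h)" "\<lambda>h. snd (p h)"
  proof
    show "card J < card ?H" using J(2) h1(1) finW card_Suc_Diff1[of W h1] by linarith
    show "\<delta> = 0" if "\<delta> \<in> lattice_of As ?H" "\<And>v. v \<in> J \<Longrightarrow> lookup \<delta> v = 0" for \<delta>
      using no mono that by blast
  qed (use finW J W p finite_As in auto)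
  obtain g :: "(cvar, complex) mpol" and T where g: "g \<noteq> 0" "occurring g \<subseteq> Sigma ?H As"
    "\<And>m h. m \<in> keys g \<Longrightarrow> h \<in> ?H \<Longrightarrow> (\<Sum>\<alpha>\<in>As h. lookup m (h, \<alpha>)) = T"
    "\<And>z \<eta>. solves z \<eta> \<Longrightarrow> peval id z g = 0"
    using ex_vanishing_polynomial by blast
  have "multihomogeneous L As g"
    unfolding multihomogeneous_def
  proof (intro conjI exI ballI)
    show "occurring g \<subseteq> coeff_vars L As" using g(2) W by (auto simp: coeff_vars_def)
    fix m h assume m: "m \<in> keys g" and h: "h \<in> {1..L}"
    show "(\<Sum>\<alpha>\<in>As h. lookup m (h, \<alpha>)) = (if h \<in> ?H then T else 0)"
    proof (cases "h \<in> ?H")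
      case False
      have "lookup m (h, \<alpha>) = 0" for \<alpha>
      proof (rule ccontr)
        assume "lookup m (h, \<alpha>) \<noteq> 0"
        then have "(h, \<alpha>) \<in> occurring g" using m by (auto simp: occurring_def in_keys_iff)
        then show False using g(2) False by auto
      qed
      then have "(\<Sum>\<alpha>\<in>As h. lookup m (h, \<alpha>)) = 0" by simp
      then show ?thesis unfolding if_not_P[OF False] .
    qed (use g(3)[OF m] in auto)
  qed
  moreover have "v \<notin> occurring g" using g(2) h1 by auto
  moreover have "peval id z g = 0" if "torus_zero z \<eta>" for z \<eta>
    by (rule g(4)[of z \<eta>]) (use that W in \<open>auto simp: torus_zero_def solves_def\<close>)
  ultimately show False using Res_variable_occurs[OF g(1) _ v] by blast
qed

end

section \<open>The algebraic generic system\<close>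

text \<open>Each derivation replaces one factor of a monomial by its derivative and so raises an
  order by at most one.\<close>

lemma occurring_der_F:
  assumes "(j, s) \<in> occurring (der_F l M i k)"
  shows "\<exists>s0. (j, s0) \<in> occurring (gen_F l M i) \<and> s0 \<le> s \<and> s \<le> s0 + k"
  using assms
proof (induction k arbitrary: s)
  case 0
  then show ?case by (auto simp: der_F_def)
next
  case (Suc k)
  let ?f = "der_F l M i k"
  have "occurring (lderiv ?f) \<subseteq> occurring ?f \<union> u_next ` occurring ?f"
    unfolding lderiv_def
  proof (rule occurring_sum_subset)
    fix m assume m: "m \<in> keys ?f"
    then have sub: "keys m \<subseteq> occurring ?f" by (auto simp: occurring_def)
    have "occurring (single (m - single v 1 + single (u_next v) 1) (of_int (lookup m v) * lookup ?f m))
        \<subseteq> occurring ?f \<union> u_next ` occurring ?f" if "v \<in> keys m" for v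
    proof -
      have "keys (m - single v 1 + single (u_next v) 1) \<subseteq> keys m \<union> {v, u_next v}"
        by (auto simp: in_keys_iff lookup_add lookup_minus lookup_single when_def split: if_splits)
      then have "keys (m - single v 1 + single (u_next v) 1) \<subseteq> occurring ?f \<union> u_next ` occurring ?f"
        using sub that by auto
      then show ?thesis by (rule order_trans[OF occurring_single])
    qed
    then have "occurring (\<Sum>v\<in>keys m. single (m - single v 1 + single (u_next v) 1)
        (of_int (lookup m v) * lookup ?f m)) \<subseteq> occurring ?f \<union> u_next ` occurring ?f"
      by (rule occurring_sum_subset)
    moreover have "occurring (single m (dderiv (lookup ?f m))) \<subseteq> occurring ?f"
      by (rule order_trans[OF occurring_single sub])
    ultimately show "occurring (single m (dderiv (lookup ?f m)) + (\<Sum>v\<in>keys m.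
        single (m - single v 1 + single (u_next v) 1) (of_int (lookup m v) * lookup ?f m)))
        \<subseteq> occurring ?f \<union> u_next ` occurring ?f"
      by (intro order_trans[OF occurring_add] Un_least) auto
  qed
  moreover have "der_F l M i (Suc k) = lderiv ?f" by (simp add: der_F_def)
  ultimately consider "(j, s) \<in> occurring ?f" | s' where "s = Suc s'" "(j, s') \<in> occurring ?f"
    using Suc.prems by fastforce
  then show ?case
  proof cases
    case 1
    then show ?thesis using Suc.IH[of s] by fastforce
  next
    case 2
    then show ?thesis using Suc.IH[of s'] by fastforce
  qed
qed

section \<open>Renaming exponent vectors along \<upsilon>\<close>

lemma lookup_umon:
  assumes "inj_on \<upsilon> N" "keys \<alpha> \<subseteq> N" "j \<in> N"
  shows "lookup (umon \<upsilon> \<alpha>) (\<upsilon> j) = lookup \<alpha> j"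
proof -
  have "lookup (umon \<upsilon> \<alpha>) (\<upsilon> j) = (\<Sum>h\<in>keys \<alpha>. if h = j then lookup \<alpha> j else 0)"
    unfolding umon_def lookup_sum
    using assms by (intro sum.cong) (auto simp: lookup_single when_def dest: inj_onD)
  then show ?thesis by (auto simp: in_keys_iff)
qed

lemma keys_umon: "keys (umon \<upsilon> \<alpha>) \<subseteq> \<upsilon> ` keys \<alpha>"
  unfolding umon_def by (rule order_trans[OF keys_sum]) (auto split: if_splits)

lemma umon_superset: "finite N \<Longrightarrow> keys \<alpha> \<subseteq> N \<Longrightarrow> umon \<upsilon> \<alpha> = (\<Sum>h\<in>N. single (\<upsilon> h) (lookup \<alpha> h))"
  unfolding umon_def by (rule sum.mono_neutral_left) (auto simp: in_keys_iff)

lemma umon_0 [simp]: "umon \<upsilon> 0 = 0"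
  by (simp add: umon_def)

lemma umon_add_diff: "umon \<upsilon> (\<delta> + (\<alpha> - \<beta>)) = umon \<upsilon> \<delta> + (umon \<upsilon> \<alpha> - umon \<upsilon> \<beta>)"
proof -
  let ?N = "keys \<delta> \<union> keys \<alpha> \<union> keys \<beta> \<union> keys (\<delta> + (\<alpha> - \<beta>))"
  have "umon \<upsilon> \<gamma> = (\<Sum>h\<in>?N. single (\<upsilon> h) (lookup \<gamma> h))" if "keys \<gamma> \<subseteq> ?N" for \<gamma>
    by (rule umon_superset) (use that in auto)
  then have "umon \<upsilon> \<delta> = (\<Sum>h\<in>?N. single (\<upsilon> h) (lookup \<delta> h))" "umon \<upsilon> \<alpha> = (\<Sum>h\<in>?N. single (\<upsilon> h) (lookup \<alpha> h))"
    "umon \<upsilon> \<beta> = (\<Sum>h\<in>?N. single (\<upsilon> h) (lookup \<beta> h))"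
    "umon \<upsilon> (\<delta> + (\<alpha> - \<beta>)) = (\<Sum>h\<in>?N. single (\<upsilon> h) (lookup (\<delta> + (\<alpha> - \<beta>)) h))"
    by blast+
  then show ?thesis
    by (simp only: lookup_add lookup_minus single_add single_diff sum.distrib sum_subtractf)
qed

lemma inj_on_umon:
  assumes "inj_on \<upsilon> N"
  shows "inj_on (umon \<upsilon>) {\<alpha>. keys \<alpha> \<subseteq> N}"
proof (rule inj_onI, rule poly_mapping_eqI)
  fix \<alpha> \<beta> j assume *: "\<alpha> \<in> {\<alpha>. keys \<alpha> \<subseteq> N}" "\<beta> \<in> {\<alpha>. keys \<alpha> \<subseteq> N}" "umon \<upsilon> \<alpha> = umon \<upsilon> \<beta>"
  show "lookup \<alpha> j = lookup \<beta> j"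
  proof (cases "j \<in> N")
    case True
    then show ?thesis using * lookup_umon[OF assms, of \<alpha> j] lookup_umon[OF assms, of \<beta> j] by simp
  next
    case False
    then have "j \<notin> keys \<alpha>" "j \<notin> keys \<beta>" using * by auto
    then show ?thesis by (simp add: in_keys_iff)
  qed
qed

lemma umon_surj:
  assumes \<upsilon>: "bij_betw \<upsilon> N V" and "finite N" and \<mu>: "keys \<mu> \<subseteq> V"
  shows "\<exists>\<alpha>. keys \<alpha> \<subseteq> N \<and> umon \<upsilon> \<alpha> = \<mu>"
proof -
  define \<alpha> where "\<alpha> = (\<Sum>j\<in>N. single j (lookup \<mu> (\<upsilon> j)))"
  have \<alpha>: "lookup \<alpha> j = (if j \<in> N then lookup \<mu> (\<upsilon> j) else 0)" for j
    using \<open>finite N\<close> by (simp add: \<alpha>_def lookup_sum lookup_single when_def)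
  then have keys: "keys \<alpha> \<subseteq> N" by (auto simp: in_keys_iff split: if_splits)
  have "lookup (umon \<upsilon> \<alpha>) v = lookup \<mu> v" for v
  proof (cases "v \<in> V")
    case True
    then obtain j where "j \<in> N" "v = \<upsilon> j" using \<upsilon> by (auto simp: bij_betw_def)
    then show ?thesis using lookup_umon[OF bij_betw_imp_inj_on[OF \<upsilon>] keys] \<alpha> by simp
  next
    case False
    then have "v \<notin> keys (umon \<upsilon> \<alpha>)" using keys_umon[of \<upsilon> \<alpha>] keys \<upsilon> by (auto simp: bij_betw_def)
    then show ?thesis using False \<mu> by (auto simp: in_keys_iff)
  qed
  then show ?thesis using keys by (intro exI[of _ \<alpha>]) (auto intro: poly_mapping_eqI)
qed

lemma lmev_umon:
  assumes "inj_on \<upsilon> N" "keys \<alpha> \<subseteq> N" "\<And>j. j \<in> N \<Longrightarrow> \<eta> j = u (\<upsilon> j)"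
  shows "lmev \<eta> \<alpha> = lmev u (umon \<upsilon> \<alpha>)"
proof -
  have inj: "inj_on \<upsilon> (keys \<alpha>)" using assms(1,2) by (rule inj_on_subset)
  have "lmev u (umon \<upsilon> \<alpha>) = (\<Prod>v\<in>\<upsilon> ` keys \<alpha>. u v powi lookup (umon \<upsilon> \<alpha>) v)"
    by (rule lmev_superset) (auto simp: keys_umon)
  also have "\<dots> = (\<Prod>j\<in>keys \<alpha>. u (\<upsilon> j) powi lookup (umon \<upsilon> \<alpha>) (\<upsilon> j))"
    by (simp add: prod.reindex[OF inj])
  also have "\<dots> = lmev \<eta> \<alpha>"
    unfolding lmev_def
    by (intro prod.cong refl) (use assms in \<open>auto simp: lookup_umon[OF assms(1,2)] subset_iff\<close>)
  finally show ?thesis by simp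
qed

section \<open>Indexing the equations of the system by pairs (i, k)\<close>

locale algebraic_generic_system = sparse_system n l M for n l M +
  fixes lam :: "dlpol \<Rightarrow> nat" and \<upsilon> :: "nat \<Rightarrow> uvar"
  assumes ags: "is_ags n l M lam \<upsilon>"
begin

definition E :: "(nat \<times> nat) set" where
  "E = {(i, k). i \<in> {1..n} \<and> ereal (real k) \<le> jac n l M i - ereal (real (gamma_sum n l M))}"

abbreviation L :: nat where "L \<equiv> num_ps n l M"

abbreviation As :: "nat \<Rightarrow> ymon set" where "As \<equiv> ags_support n l M lam \<upsilon>"

definition ix :: "nat \<times> nat \<Rightarrow> nat" where "ix e = lam (F e)"

lemma ps_eq: "ps n l M = F ` E"
  by (force simp: ps_def E_def der_F_def)

text \<open>The coefficient of \<open>M i 0\<close> in F (i, k) contains (i, 0, k), whereas F (i',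
  k') contains only indeterminates of block i' of order at most k'. So the pairs can replace the
  members of the set \<open>ps\<close>.\<close>

lemma inj_F: "inj_on F E"
proof -
  have key: "fst e = fst e' \<and> snd e \<le> snd e'" if "F e = F e'" for e e'
  proof -
    have "lookup (lookup (F e) (M (fst e) 0)) (single (fst e, 0, snd e) 1) = 1"
      using lookup_lookup_der_F[of 0 l "fst e" 0 "snd e" M "M (fst e) 0"] by (simp add: mcoeff_0)
    then have "(fst e, 0, snd e) \<in> occurring (lookup (F e') (M (fst e) 0))"
      unfolding that occurring_def
      by (intro UN_I[of "single (fst e, 0, snd e) 1"]) (auto simp: in_keys_iff)
    then show ?thesis using occurring_lookup_der_F[of l M "fst e'" "snd e'" "M (fst e) 0"] by auto
  qed
  show ?thesis
    by (rule inj_onI) (metis key order_antisym prod_eqI)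
qed

lemma lam_bij: "bij_betw lam (ps n l M) {1..L}" and \<upsilon>_bij: "bij_betw \<upsilon> {1..L-1} (ps_vars n l M)"
  using ags by (auto simp: is_ags_def)

lemma finite_E: "finite E"
  using bij_betw_finite[OF lam_bij] finite_imageD[OF _ inj_F] by (simp add: ps_eq)

lemma E_down: "(i, k) \<in> E \<Longrightarrow> k' \<le> k \<Longrightarrow> (i, k') \<in> E"
  by (auto simp: E_def intro: order_trans[rotated])

lemma ix_bij: "bij_betw ix E {1..L}"
proof -
  have "bij_betw (lam \<circ> F) E {1..L}"
    using bij_betw_trans[OF inj_on_imp_bij_betw[OF inj_F]] lam_bij by (simp add: ps_eq)
  then show ?thesis by (simp add: ix_def[abs_def] comp_def)
qed

lemma ix_in: "e \<in> E \<Longrightarrow> ix e \<in> {1..L}"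
  using ix_bij by (auto simp: bij_betw_def)

lemma rho_ix: "e \<in> E \<Longrightarrow> rho n l M lam (ix e) = F e"
  using lam_bij by (auto simp: rho_def ix_def ps_eq bij_betw_def intro!: inv_into_f_f)

lemma finite_order_set: "finite (order_set j (gen_F l M i))"
proof -
  have "order_set j (gen_F l M i) \<subseteq> snd ` occurring (gen_F l M i)" by (force simp: order_set_def)
  then show ?thesis by (rule finite_subset) simp
qed

text \<open>The bounds in \<open>ps_vars\<close> fit exactly: an order in the i-th generator is at
  most \<open>ord\<close>, and the derivations in \<open>ps\<close> raise it by at most
  \<open>jac\<close> minus \<open>gamma_sum\<close>. Hence \<upsilon> reaches every monomial and
  \<open>ags_support\<close> loses none.\<close>

lemma keys_F_ps_vars:
  assumes e: "e \<in> E" and \<mu>: "\<mu> \<in> keys (F e)"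
  shows "keys \<mu> \<subseteq> ps_vars n l M"
proof
  fix v assume v: "v \<in> keys \<mu>"
  obtain j s where js: "v = (j, s)" by (cases v)
  obtain i k where ik: "e = (i, k)" by (cases e)
  have i: "i \<in> {1..n}" and k: "ereal (real k) \<le> jac n l M i - ereal (real (gamma_sum n l M))"
    using e by (auto simp: E_def ik)
  have "(j, s) \<in> occurring (der_F l M i k)" using v \<mu> by (auto simp: occurring_def js ik)
  then obtain s0 where s0: "(j, s0) \<in> occurring (gen_F l M i)" "s0 \<le> s" "s \<le> s0 + k"
    using occurring_der_F by blast
  have j: "j \<in> {1..n-1}"
  proof -
    obtain m where "m \<in> keys (gen_F l M i)" "(j, s0) \<in> keys m" using s0(1) by (auto simp: occurring_def)
    moreover have "keys (gen_F l M i) \<subseteq> M i ` {..l i}"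
      unfolding gen_F_def by (rule order_trans[OF keys_sum]) (auto split: if_splits)
    ultimately obtain m' where "m' \<le> l i" "(j, s0) \<in> keys (M i m')" by auto
    then show ?thesis using keys_M[OF i, of m'] by auto
  qed
  have in_set: "s0 \<in> order_set j (gen_F l M i)" using s0(1) by (simp add: order_set_def)
  have "gam n l M j \<le> s0"
    unfolding gam_def by (rule Min_le) (use i in_set finite_order_set in auto)
  moreover have "ereal (real s) \<le> top_order n l M j"
  proof -
    have ord: "ereal (real s0) \<le> ord l M i j"
      using in_set Max_ge[OF finite_order_set in_set] by (auto simp: ord_def)
    have max: "ord l M i j + jac n l M i \<le> Max ((\<lambda>i. ord l M i j + jac n l M i) ` {1..n})"
      by (rule Max_ge) (use i in auto)
    have "ereal (real s) \<le> ereal (real s0) + ereal (real k)" using s0(3) by simp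
    also have "\<dots> \<le> ord l M i j + (jac n l M i - ereal (real (gamma_sum n l M)))"
      by (rule add_mono[OF ord k])
    also have "\<dots> = (ord l M i j + jac n l M i) - ereal (real (gamma_sum n l M))"
      by (cases "ord l M i j"; cases "jac n l M i") auto
    also have "\<dots> \<le> top_order n l M j"
      unfolding top_order_def by (rule ereal_minus_mono[OF max]) simp
    finally show ?thesis .
  qed
  ultimately show "v \<in> ps_vars n l M" using j s0(2) by (auto simp: ps_vars_def js)
qed

lemma As_ix: "e \<in> E \<Longrightarrow> As (ix e) = {\<alpha>. keys \<alpha> \<subseteq> {1..L-1} \<and> umon \<upsilon> \<alpha> \<in> keys (F e)}"
  by (auto simp: ags_support_def rho_ix in_keys_iff)

lemma inj_\<upsilon>: "inj_on \<upsilon> {1..L-1}"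
  using \<upsilon>_bij by (rule bij_betw_imp_inj_on)

lemma umon_bij: "e \<in> E \<Longrightarrow> bij_betw (umon \<upsilon>) (As (ix e)) (keys (F e))"
proof (rule bij_betwI')
  fix \<alpha> \<beta> assume "e \<in> E" "\<alpha> \<in> As (ix e)" "\<beta> \<in> As (ix e)"
  then show "umon \<upsilon> \<alpha> = umon \<upsilon> \<beta> \<longleftrightarrow> \<alpha> = \<beta>"
    using inj_on_eq_iff[OF inj_on_umon[OF inj_\<upsilon>]] by (auto simp: As_ix)
next
  fix \<mu> assume "e \<in> E" "\<mu> \<in> keys (F e)"
  then show "\<exists>\<alpha>\<in>As (ix e). \<mu> = umon \<upsilon> \<alpha>"
    using umon_surj[OF \<upsilon>_bij, of \<mu>] keys_F_ps_vars[of e \<mu>] by (auto simp: As_ix)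
qed (auto simp: As_ix)

definition unix :: "nat \<Rightarrow> nat \<times> nat" where "unix = inv_into E ix"

lemma unix: "e \<in> E \<Longrightarrow> unix (ix e) = e" "h \<in> {1..L} \<Longrightarrow> unix h \<in> E" "h \<in> {1..L} \<Longrightarrow> ix (unix h) = h"
  unfolding unix_def using ix_bij by (auto simp: bij_betw_def f_inv_into_f inv_into_into)

lemma Xi_const:
  "Xi n l M lam \<upsilon> (const q) = const (peval const (\<lambda>(h, \<beta>). lookup (rho n l M lam h) (umon \<upsilon> \<beta>)) q)"
  by (cases "q = 0") (auto simp: Xi_def const_def)

text \<open>The standing assumption on the distinguished monomial, freed from \<open>Xi\<close>; it
  lets that coefficient be specialized by renaming.\<close>

lemma pivot:
  assumes e: "e \<in> E"
  shows "lookup (F e) (M (fst e) 0) = pvar (fst e, 0, snd e)"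
proof -
  obtain i k where ik: "e = (i, k)" by (cases e)
  have i: "i \<in> {1..n}" and k: "ereal (real k) \<le> jac n l M i - ereal (real (gamma_sum n l M))"
    using e by (auto simp: E_def ik)
  have "rho n l M lam (ix e) = (lderiv ^^ k) (gen_F l M i)"
    using rho_ix[OF e] by (simp add: ik der_F_def)
  with ags i k ix_in[OF e] obtain \<alpha> where \<alpha>: "\<alpha> \<in> As (ix e)" "umon \<upsilon> \<alpha> = M i 0"
    "Xi n l M lam \<upsilon> (const (pvar (ix e, \<alpha>))) = const ((dderiv ^^ k) (pvar (i, 0, 0)))"
    unfolding is_ags_def by blast
  then have "const (lookup (F e) (M i 0)) = (const (pvar (i, 0, k)) :: dlpol)"
    using rho_ix[OF e] by (simp add: Xi_const dderiv_pow_pvar)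
  then show ?thesis by (simp add: ik const_inject)
qed

end

section \<open>The resultant of the algebraic generic system as an instance of the abstract
  setting\<close>

locale specialization = algebraic_generic_system n l M lam \<upsilon> for n l M lam \<upsilon> +
  fixes Res :: "(cvar, int) mpol" and R :: dpol
  assumes dres: "is_sparse_diff_resultant n l M R"
    and ares: "is_sparse_resultant (num_ps n l M) (ags_support n l M lam \<upsilon>) Res"
    and nontriv: "nontrivial_resultant (num_ps n l M) (ags_support n l M lam \<upsilon>)"
begin

sublocale resultant_variety L As Res
proof
  fix h assume "h \<in> {1..L}"
  then have h: "As h = As (ix (unix h))" "unix h \<in> E" by (simp_all add: unix)
  show "finite (As h)"
    using bij_betw_finite[OF umon_bij[OF h(2)]] h(1) by simp
qed (auto simp: ags_support_def nontriv ares)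

text \<open>The resultant with coefficients indexed by pairs (i, k) and monomials in u, so that
  specializing it refers neither to \<open>lam\<close> nor to \<upsilon>.\<close>

definition Q :: "(cidx, rat) mpol" where
  "Q = peval const (\<lambda>(h, \<alpha>). pvar (unix h, umon \<upsilon> \<alpha>)) (Poly_Mapping.map of_int Res)"

lemma occurring_map_of_int: "occurring (Poly_Mapping.map of_int Res :: (cvar, rat) mpol) = occurring Res"
  by (simp add: occurring_def)

lemma Q_vanishes:
  fixes z :: "cidx \<Rightarrow> complex"
  assumes u: "\<And>v. u v \<noteq> 0" and z: "\<And>e. e \<in> E \<Longrightarrow> (\<Sum>\<mu>\<in>keys (F e). z (e, \<mu>) * lmev u \<mu>) = 0"
  shows "peval of_rat z Q = 0"
proof -
  define z' where "z' = (\<lambda>(h, \<alpha>). z (unix h, umon \<upsilon> \<alpha>))"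
  define \<eta> where "\<eta> j = (if j \<in> {1..L-1} then u (\<upsilon> j) else 1)" for j
  have "torus_zero z' \<eta>"
    unfolding torus_zero_def
  proof (intro conjI allI ballI)
    show "\<eta> j \<noteq> 0" for j using u by (simp add: \<eta>_def)
    fix h assume h: "h \<in> {1..L}"
    define e where "e = unix h"
    have e: "e \<in> E" "h = ix e" using h by (simp_all add: e_def unix)
    have "(\<Sum>\<mu>\<in>keys (F e). z (e, \<mu>) * lmev u \<mu>) = (\<Sum>\<alpha>\<in>As h. z (e, umon \<upsilon> \<alpha>) * lmev u (umon \<upsilon> \<alpha>))"
      unfolding e(2) by (rule sum.reindex_bij_betw[OF umon_bij[OF e(1)], symmetric])
    also have "\<dots> = (\<Sum>\<alpha>\<in>As h. z' (h, \<alpha>) * lmev \<eta> \<alpha>)"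
    proof (rule sum.cong[OF refl])
      fix \<alpha> assume "\<alpha> \<in> As h"
      then have "lmev \<eta> \<alpha> = lmev u (umon \<upsilon> \<alpha>)"
        by (intro lmev_umon[OF inj_\<upsilon>] keys_As[OF h]) (simp_all add: \<eta>_def)
      then show "z (e, umon \<upsilon> \<alpha>) * lmev u (umon \<upsilon> \<alpha>) = z' (h, \<alpha>) * lmev \<eta> \<alpha>"
        by (simp add: z'_def e_def)
    qed
    finally show "(\<Sum>\<alpha>\<in>As h. z' (h, \<alpha>) * lmev \<eta> \<alpha>) = 0" using z[OF e(1)] by simp
  qed
  then have "peval of_int z' Res = 0" by (rule Res_vanishes)
  moreover have "peval of_rat z Q
      = peval of_rat (\<lambda>p. peval of_rat z (case p of (h, \<alpha>) \<Rightarrow> pvar (unix h, umon \<upsilon> \<alpha>))) (Poly_Mapping.map of_int Res)"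
    unfolding Q_def by (rule peval_peval) auto
  ultimately show ?thesis by (simp add: z'_def split_def peval_map_of_int)
qed

lemma Q_occ: "occurring Q \<subseteq> Sigma E (\<lambda>e. keys (F e))"
proof
  fix p assume "p \<in> occurring Q"
  then obtain h \<alpha> where h: "(h, \<alpha>) \<in> occurring Res" "p = (unix h, umon \<upsilon> \<alpha>)"
    using occurring_peval[of "\<lambda>(h, \<alpha>). pvar (unix h, umon \<upsilon> \<alpha>) :: (cidx, rat) mpol"
        "Poly_Mapping.map of_int Res"]
    unfolding Q_def occurring_map_of_int by auto
  then have "h \<in> {1..L}" "\<alpha> \<in> As h" using Res_props(2) by (auto simp: coeff_vars_def)
  then show "p \<in> Sigma E (\<lambda>e. keys (F e))"
    using h(2) bij_betwE[OF umon_bij[of "unix h"]] by (auto simp: unix)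
qed

lemma lattice_umon:
  assumes W: "W \<subseteq> E" and "\<delta> \<in> lattice_of As (ix ` W)"
  shows "keys \<delta> \<subseteq> {1..L-1} \<and> umon \<upsilon> \<delta> \<in> lattice_of (\<lambda>e. keys (F e)) W"
  using assms(2)
proof induction
  case zero
  show ?case by (simp add: lattice_of.zero)
next
  case (step \<delta> h \<alpha> \<beta>)
  obtain e where e: "e \<in> W" "h = ix e" using step(2) by blast
  then have eE: "e \<in> E" using W by auto
  have k: "keys \<alpha> \<subseteq> {1..L-1}" "keys \<beta> \<subseteq> {1..L-1}" "umon \<upsilon> \<alpha> \<in> keys (F e)" "umon \<upsilon> \<beta> \<in> keys (F e)"
    using step(3,4) unfolding e(2) As_ix[OF eE] by auto
  have "keys (\<delta> + (\<alpha> - \<beta>)) \<subseteq> keys \<delta> \<union> (keys \<alpha> \<union> keys \<beta>)"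
    by (auto simp: in_keys_iff lookup_add lookup_minus)
  then have "keys (\<delta> + (\<alpha> - \<beta>)) \<subseteq> {1..L-1}" using k(1,2) step.IH by blast
  moreover have "umon \<upsilon> (\<delta> + (\<alpha> - \<beta>)) \<in> lattice_of (\<lambda>e. keys (F e)) W"
    unfolding umon_add_diff using conjunct2[OF step.IH] e(1) k(3,4) by (rule lattice_of.step)
  ultimately show ?case ..
qed

text \<open>Renamed exponents vanish outside the range of \<upsilon>, so J can be pulled back along
  \<upsilon>, which does not increase its size.\<close>

lemma full_rank_E:
  assumes W: "W \<subseteq> E" and J: "finite J" "card J + 2 \<le> card W"
  shows "\<exists>\<delta>\<in>lattice_of (\<lambda>e. keys (F e)) W. \<delta> \<noteq> 0 \<and> (\<forall>v\<in>J. lookup \<delta> v = 0)"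
proof -
  define J' where "J' = {j\<in>{1..L-1}. \<upsilon> j \<in> J}"
  have "card J' \<le> card J"
  proof (rule card_inj_on_le)
    show "inj_on \<upsilon> J'" by (rule inj_on_subset[OF inj_\<upsilon>]) (auto simp: J'_def)
  qed (use J in \<open>auto simp: J'_def\<close>)
  moreover have "card (ix ` W) = card W"
    by (rule card_image[OF inj_on_subset[OF bij_betw_imp_inj_on[OF ix_bij] W]])
  ultimately have "card J' + 2 \<le> card (ix ` W)" using J(2) by linarith
  moreover have "ix ` W \<subseteq> {1..L}" using ix_in W by blast
  moreover have "finite J'" by (simp add: J'_def)
  ultimately obtain \<delta> where \<delta>: "\<delta> \<in> lattice_of As (ix ` W)" "\<delta> \<noteq> 0" "\<forall>j\<in>J'. lookup \<delta> j = 0"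
    using full_rank[of "ix ` W" J'] by blast
  have k: "keys \<delta> \<subseteq> {1..L-1}" and lat: "umon \<upsilon> \<delta> \<in> lattice_of (\<lambda>e. keys (F e)) W"
    using lattice_umon[OF W \<delta>(1)] by auto
  have "umon \<upsilon> \<delta> \<noteq> umon \<upsilon> 0"
    using inj_onD[OF inj_on_umon[OF inj_\<upsilon>], of \<delta> 0] k \<delta>(2) by auto
  moreover have "lookup (umon \<upsilon> \<delta>) v = 0" if v: "v \<in> J" for v
  proof (rule ccontr)
    assume "lookup (umon \<upsilon> \<delta>) v \<noteq> 0"
    then have "v \<in> keys (umon \<upsilon> \<delta>)" by (simp add: in_keys_iff)
    then obtain j where j: "j \<in> keys \<delta>" "v = \<upsilon> j" using keys_umon by blast
    then have "j \<in> J'" using k v by (auto simp: J'_def)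
    then show False using j(1) \<delta>(3) by (simp add: in_keys_iff)
  qed
  ultimately show ?thesis using lat by (intro bexI[of _ "umon \<upsilon> \<delta>"]) auto
qed

text \<open>The first index 0 lies outside {1..n}, so these names are fresh for
  \<open>D_ring\<close>.\<close>

lemma ex_encoding: "\<exists>b :: cidx \<Rightarrow> avar. inj_on b (Sigma E (\<lambda>e. keys (F e))) \<and> (\<forall>p. fst (b p) = 0)"
proof -
  have fin: "finite (Sigma E (\<lambda>e. keys (F e)))" using finite_E by auto
  obtain enc :: "cidx \<Rightarrow> nat" where "inj_on enc (Sigma E (\<lambda>e. keys (F e)))"
    using finite_imp_inj_to_nat_seg[OF fin] by auto
  then show ?thesis
    by (intro exI[of _ "\<lambda>p. (0, enc p, 0)"]) (auto simp: inj_on_def)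
qed

lemma R_dvd_specialization:
  "R dvd peval const (\<lambda>(h, \<beta>). lookup (rho n l M lam h) (umon \<upsilon> \<beta>)) (Poly_Mapping.map of_int Res)"
proof -
  obtain b :: "cidx \<Rightarrow> avar" where b: "inj_on b (Sigma E (\<lambda>e. keys (F e)))" "\<forall>p. fst (b p) = 0"
    using ex_encoding by blast
  interpret sp: specialized_resultant n l M E R b Q
  proof
    show "finite E" by (rule finite_E)
    show "E \<subseteq> {1..n} \<times> UNIV" by (auto simp: E_def)
    show "(i, k') \<in> E" if "(i, k) \<in> E" "k' \<le> k" for i k k' using that by (rule E_down)
    show "is_sparse_diff_resultant n l M R" by (rule dres)
    show "lookup (F e) (M (fst e) 0) = pvar (fst e, 0, snd e)" if "e \<in> E" for e using that by (rule pivot)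
    show "inj_on b (Sigma E (\<lambda>e. keys (F e)))" "\<And>p. fst (b p) = 0" using b by auto
    show "occurring Q \<subseteq> Sigma E (\<lambda>e. keys (F e))" by (rule Q_occ)
    show "peval of_rat z Q = 0"
      if "\<And>v. u v \<noteq> 0" "\<And>e. e \<in> E \<Longrightarrow> (\<Sum>\<mu>\<in>keys (F e). z (e, \<mu>) * lmev u \<mu>) = 0"
      for z :: "cidx \<Rightarrow> complex" and u
      using that by (rule Q_vanishes)
    show "\<exists>\<delta>\<in>lattice_of (\<lambda>e. keys (F e)) W. \<delta> \<noteq> 0 \<and> (\<forall>v\<in>J. lookup \<delta> v = 0)"
      if "W \<subseteq> E" "finite J" "card J + 2 \<le> card W" for W J
      using that by (rule full_rank_E)
  qed
  have "peval const (\<lambda>p. lookup (F (fst p)) (snd p)) Q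
      = peval const (\<lambda>p. peval const (\<lambda>p. lookup (F (fst p)) (snd p))
          (case p of (h, \<alpha>) \<Rightarrow> pvar (unix h, umon \<upsilon> \<alpha>))) (Poly_Mapping.map of_int Res)"
    unfolding Q_def by (rule peval_peval) auto
  also have "\<dots> = peval const (\<lambda>(h, \<beta>). lookup (rho n l M lam h) (umon \<upsilon> \<beta>)) (Poly_Mapping.map of_int Res)"
  proof (rule peval_cong)
    fix p assume "p \<in> occurring (Poly_Mapping.map of_int Res :: (cvar, rat) mpol)"
    then obtain h \<alpha> where p: "p = (h, \<alpha>)" "h \<in> {1..L}"
      using Res_props(2) by (auto simp: coeff_vars_def occurring_map_of_int)
    have "rho n l M lam h = F (unix h)" using rho_ix[of "unix h"] p(2) by (simp add: unix)
    then show "peval const (\<lambda>p. lookup (F (fst p)) (snd p)) (case p of (h, \<alpha>) \<Rightarrow> pvar (unix h, umon \<upsilon> \<alpha>))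
        = (case p of (h, \<beta>) \<Rightarrow> lookup (rho n l M lam h) (umon \<upsilon> \<beta>))"
      by (simp add: p(1))
  qed
  finally show ?thesis using sp.R_dvd_specialized by simp
qed

end

lemma D_ring_lookup_der_F: "i \<in> {1..n} \<Longrightarrow> lookup (der_F l M i k) \<mu> \<in> D_ring n l"
  using occurring_lookup_der_F[of l M i k \<mu>] by (auto simp: D_ring_def A_derivs_def)

theorem corollary6p13:
  fixes n :: nat
    and l :: "nat \<Rightarrow> nat"
    and M :: "nat \<Rightarrow> nat \<Rightarrow> (uvar \<Rightarrow>\<^sub>0 int)"
    and lam :: "dlpol \<Rightarrow> nat"
    and \<upsilon> :: "nat \<Rightarrow> uvar"
    and Res :: "(cvar, int) mpol"
    and R :: dpol
  defines "L \<equiv> num_ps n l M"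
    and "As \<equiv> ags_support n l M lam \<upsilon>"
    and "XiRes \<equiv> Xi n l M lam \<upsilon> (const (Poly_Mapping.map of_int Res))"
  assumes "generic_system n l M"
    and "laurent_diff_essential n l M"
    and "super_essential n l M"
    and "is_ags n l M lam \<upsilon>"
    and "is_sparse_diff_resultant n l M R"
    and "is_sparse_resultant L As Res"
    and "nontrivial_resultant L As"
    and "XiRes \<noteq> 0"
  shows "\<exists>E \<in> D_ring n l. XiRes = const (E * R)"
proof -
  interpret s: specialization n l M lam \<upsilon> Res R
    using assms(4,7-10) unfolding L_def As_def by unfold_locales
  let ?f = "peval const (\<lambda>(h, \<beta>). lookup (rho n l M lam h) (umon \<upsilon> \<beta>)) (Poly_Mapping.map of_int Res)"
  have Xi: "XiRes = const ?f" unfolding XiRes_def by (rule s.Xi_const)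
  obtain q where q: "?f = R * q" using s.R_dvd_specialization by (auto simp: dvd_def)
  have f0: "?f \<noteq> 0" using assms(11) Xi by (metis const_0)
  \<comment> \<open>The quotient divides a nonzero polynomial of \<open>D_ring\<close>, so it has no
    other indeterminates.\<close>
  have "occurring q \<subseteq> occurring ?f" by (rule dvd_occurring[OF _ f0]) (simp add: q)
  also have "\<dots> \<subseteq> A_derivs n l"
  proof
    fix v assume "v \<in> occurring ?f"
    then obtain h \<beta> where h: "(h, \<beta>) \<in> occurring (Poly_Mapping.map of_int Res :: (cvar, rat) mpol)"
      "v \<in> occurring (lookup (rho n l M lam h) (umon \<upsilon> \<beta>))"
      using occurring_peval[of "\<lambda>(h, \<beta>). lookup (rho n l M lam h) (umon \<upsilon> \<beta>)" "Poly_Mapping.map of_int Res"]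
      by auto
    then have "h \<in> {1..num_ps n l M}"
      using s.Res_props(2) by (auto simp: coeff_vars_def s.occurring_map_of_int)
    then have e: "s.unix h \<in> s.E" "rho n l M lam h = s.F (s.unix h)"
      using s.rho_ix[of "s.unix h"] by (simp_all add: s.unix)
    then show "v \<in> A_derivs n l"
      using h(2) D_ring_lookup_der_F[of "fst (s.unix h)" n l M "snd (s.unix h)" "umon \<upsilon> \<beta>"]
      by (auto simp: D_ring_def s.E_def)
  qed
  finally have "q \<in> D_ring n l" by (simp add: D_ring_def)
  then show ?thesis using Xi q by (auto simp: mult.commute)
qed

end
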